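(* Let $\mathcal H$ be a complex Hilbert space of arbitrary dimension and let $P$ be a positive operator on $\mathcal H$. Then the following statements are equivalent. (1) $P\in\mathcal{AN}_{[\pi,k]}(\mathcal H)$ for every $\pi\in\Pi$ and for every $k\in\mathbb N$. (2) $P\in\mathcal{AN}_{[\pi,k]}(\mathcal H)$ for some $\pi\in\Pi$ and for some $k\in\mathbb N$. (3) $P=\alpha I+K+F$, where $\alpha\ge0$, $K$ is a positive compact operator and $F$ is a self-adjoint finite-rank operator.
   Context: For a positive $A\in\mathcal B(\mathcal H)$ define $\lambda_j(A)$ as follows. The essential spectrum $\sigma_e(A)$ is the set of points of $\sigma(A)$ that are accumulation points of $\sigma(A)$ or eigenvalues of infinite multiplicity. Let $\mu=\sup\sigma(A)$. If $\mu\in\sigma_e(A)$, put $\lambda_j(A)=\mu$ for $j=1,\dots,\operatorname{rank}(A)$. Otherwise $\mu$ is an eigenvalue of finite multiplicity $m$; put $\lambda_j(A)=\mu$ for $1\le j\le m$ and $\lambda_{m+j}(A)=\lambda_j(A_1)$ for $1\le j\le\operatorname{rank}(A_1)$, where $A_1=A-\mu P_{E_\mu}$ and $P_{E_\mu}$ is the orthogonal projection onto the eigenspace of $\mu$. If $\operatorname{rank}(A)<\infty$, put $\lambda_j(A)=0$ for $j>\operatorname{rank}(A)$. For $T\in\mathcal B(\mathcal H,\mathcal K)$, with $|T|=\sqrt{T^*T}$, the s-numbers are $s_j(T)=\lambda_j(|T|)$. $\Pi$ is the set of all nonincreasing sequences $\pi=(\pi_j)_{j\in\mathbb N}$ of positive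 numbers with $\pi_1=1$. The weighted Ky Fan $\pi,k$-norm is $\|T\|_{[\pi,k]}=\sum_{j=1}^k\pi_js_j(T)$. $T\in\mathcal B(\mathcal H,\mathcal K)$ is $[\pi,k]$-norming, written $T\in\mathcal N_{[\pi,k]}(\mathcal H,\mathcal K)$, if there are orthonormal $x_1,\dots,x_k\in\mathcal H$ with $\|T\|_{[\pi,k]}=\sum_{j=1}^k\pi_j\|Tx_j\|$; if $\dim\mathcal H=r<k$, the requirement is instead that there are orthonormal $x_1,\dots,x_r\in\mathcal H$ with $\|T\|_{[\pi,k]}=\sum_{j=1}^r\pi_j\|Tx_j\|$. $T$ is absolutely $[\pi,k]$-norming, written $T\in\mathcal{AN}_{[\pi,k]}(\mathcal H,\mathcal K)$, if for every nontrivial (nonzero; $\mathcal M=\mathcal H$ allowed) closed subspace $\mathcal M\subseteq\mathcal H$ the restriction $T|_{\mathcal M}:\mathcal M\to\mathcal K$ is $[\pi,k]$-norming. $\mathcal{AN}_{[\pi,k]}(\mathcal H)=\mathcal{AN}_{[\pi,k]}(\mathcal H,\mathcal H)$. *)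

theory Defs
  imports "HOL-Analysis.Analysis" "HOL-Library.Extended_Nat"
begin

text \<open>
  A complex Hilbert space carries its canonical real inner product
  \<open>inner x y = Re (cinner x y)\<close>, hence the norm \<open>sqrt (Re (cinner x x))\<close>.  The complex
  inner product is linear in its first argument.
\<close>

class complex_hilbert_space = real_inner + complete_space +
  fixes scaleC :: "complex \<Rightarrow> 'a \<Rightarrow> 'a" (infixr "*\<^sub>C" 75)
    and cinner :: "'a \<Rightarrow> 'a \<Rightarrow> complex"
  assumes scaleC_add_right: "a *\<^sub>C (x + y) = a *\<^sub>C x + a *\<^sub>C y"
    and scaleC_add_left: "(a + b) *\<^sub>C x = a *\<^sub>C x + b *\<^sub>C x"
    and scaleC_scaleC: "a *\<^sub>C b *\<^sub>C x = (a * b) *\<^sub>C x"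
    and scaleC_of_real: "complex_of_real r *\<^sub>C x = r *\<^sub>R x"
    and cinner_commute: "cinner x y = cnj (cinner y x)"
    and cinner_add_left: "cinner (x + y) z = cinner x z + cinner y z"
    and cinner_scaleC_left: "cinner (a *\<^sub>C x) y = a * cinner x y"
    and Re_cinner: "Re (cinner x y) = inner x y"

instantiation complex :: complex_hilbert_space
begin
definition "scaleC_complex (a :: complex) (x :: complex) = a * x"
definition "cinner_complex (x :: complex) (y :: complex) = x * cnj y"
instance
  by standard
    (simp_all add: scaleC_complex_def cinner_complex_def algebra_simps scaleR_conv_of_real
      inner_complex_def)
end

interpretation complex_vector: vector_space "scaleC :: complex \<Rightarrow> 'a \<Rightarrow> 'a::complex_hilbert_space"
proof
  show "1 *\<^sub>C x = x" for x :: 'a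
    using scaleC_of_real[of 1 x] by simp
qed (simp_all add: scaleC_add_right scaleC_add_left scaleC_scaleC)

text \<open>The dimension of an infinite-dimensional space is recorded as \<open>\<infinity>\<close>.\<close>

definition cdim :: "'a::complex_hilbert_space set \<Rightarrow> enat" where
  "cdim S = (if \<exists>B. finite B \<and> S \<subseteq> complex_vector.span B
             then enat (complex_vector.dim S) else \<infinity>)"

definition closed_csubspace :: "'a::complex_hilbert_space set \<Rightarrow> bool" where
  "closed_csubspace M \<longleftrightarrow> complex_vector.subspace M \<and> closed M"

text \<open>
  A closed subspace \<open>M\<close> of a Hilbert space is a Hilbert space in its own right.  Everything
  below is stated for operators with domain such an \<open>M\<close>: an operator is represented by a
  function on the ambient type of which only the values on \<open>M\<close> matter, so that the same
  function \<open>T\<close> with domain \<open>M\<close> represents the restriction of \<open>T\<close> to \<open>M\<close>.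
  The space itself is \<open>M = UNIV\<close>.
\<close>

definition bounded_ops ::
  "'a::complex_hilbert_space set \<Rightarrow> 'b::complex_hilbert_space set \<Rightarrow> ('a \<Rightarrow> 'b) set" where
  "bounded_ops M N = {T. T \<in> M \<rightarrow> N \<and>
     (\<forall>x\<in>M. \<forall>y\<in>M. T (x + y) = T x + T y) \<and>
     (\<forall>a. \<forall>x\<in>M. T (a *\<^sub>C x) = a *\<^sub>C T x) \<and>
     (\<exists>C. \<forall>x\<in>M. norm (T x) \<le> C * norm x)}"

definition positive_op :: "'a::complex_hilbert_space set \<Rightarrow> ('a \<Rightarrow> 'a) \<Rightarrow> bool" where
  "positive_op M A \<longleftrightarrow> A \<in> bounded_ops M M \<and> (\<forall>x\<in>M. cinner (A x) x \<in> \<real>\<^sub>\<ge>\<^sub>0)"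

definition selfadjoint_op :: "'a::complex_hilbert_space set \<Rightarrow> ('a \<Rightarrow> 'a) \<Rightarrow> bool" where
  "selfadjoint_op M A \<longleftrightarrow> A \<in> bounded_ops M M \<and>
     (\<forall>x\<in>M. \<forall>y\<in>M. cinner (A x) y = cinner x (A y))"

definition op_rank :: "'a::complex_hilbert_space set \<Rightarrow> ('a \<Rightarrow> 'b::complex_hilbert_space) \<Rightarrow> enat" where
  "op_rank M A = cdim (A ` M)"

definition compact_op ::
  "'a::complex_hilbert_space set \<Rightarrow> ('a \<Rightarrow> 'b::complex_hilbert_space) \<Rightarrow> bool" where
  "compact_op M A \<longleftrightarrow> A \<in> bounded_ops M UNIV \<and> compact (closure (A ` (M \<inter> cball 0 1)))"

definition finite_rank_op ::
  "'a::complex_hilbert_space set \<Rightarrow> ('a \<Rightarrow> 'b::complex_hilbert_space) \<Rightarrow> bool" where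
  "finite_rank_op M A \<longleftrightarrow> A \<in> bounded_ops M UNIV \<and> op_rank M A < \<infinity>"

definition orth_proj :: "'a::complex_hilbert_space set \<Rightarrow> 'a \<Rightarrow> 'a" where
  "orth_proj E x = (THE y. y \<in> E \<and> (\<forall>z\<in>E. cinner (x - y) z = 0))"

definition adj_op ::
  "'a::complex_hilbert_space set \<Rightarrow> ('a \<Rightarrow> 'b::complex_hilbert_space) \<Rightarrow> 'b \<Rightarrow> 'a" where
  "adj_op M T y = (THE z. z \<in> M \<and> (\<forall>x\<in>M. cinner (T x) y = cinner x z))"

text \<open>Extensionality on \<open>M\<close> makes the square root unique as a function on the ambient type.\<close>

definition sqrt_op :: "'a::complex_hilbert_space set \<Rightarrow> ('a \<Rightarrow> 'a) \<Rightarrow> 'a \<Rightarrow> 'a" where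
  "sqrt_op M A = (THE S. S \<in> extensional M \<and> positive_op M S \<and> (\<forall>x\<in>M. S (S x) = A x))"

definition abs_op ::
  "'a::complex_hilbert_space set \<Rightarrow> ('a \<Rightarrow> 'b::complex_hilbert_space) \<Rightarrow> 'a \<Rightarrow> 'a" where
  "abs_op M T = sqrt_op M (\<lambda>x. adj_op M T (T x))"

definition spectrum :: "'a::complex_hilbert_space set \<Rightarrow> ('a \<Rightarrow> 'a) \<Rightarrow> complex set" where
  "spectrum M A = {z. \<not> (\<exists>B\<in>bounded_ops M M. \<forall>x\<in>M.
     B (A x - z *\<^sub>C x) = x \<and> A (B x) - z *\<^sub>C B x = x)}"

definition eigenspace :: "'a::complex_hilbert_space set \<Rightarrow> ('a \<Rightarrow> 'a) \<Rightarrow> complex \<Rightarrow> 'a set" where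
  "eigenspace M A z = {x \<in> M. A x = z *\<^sub>C x}"

definition ess_spectrum :: "'a::complex_hilbert_space set \<Rightarrow> ('a \<Rightarrow> 'a) \<Rightarrow> complex set" where
  "ess_spectrum M A =
     {z \<in> spectrum M A. z islimpt spectrum M A \<or> cdim (eigenspace M A z) = \<infinity>}"

text \<open>
  The supremum of the spectrum; for a positive operator the spectrum consists of nonnegative
  real numbers.
\<close>

definition sup_spectrum :: "'a::complex_hilbert_space set \<Rightarrow> ('a \<Rightarrow> 'a) \<Rightarrow> real" where
  "sup_spectrum M A = Sup {r. complex_of_real r \<in> spectrum M A}"

text \<open>
  \<open>eig_num M A j\<close> is the number \<open>\<lambda>\<^sub>j(A)\<close> of a positive operator \<open>A\<close> on \<open>M \<noteq> {0}\<close>, for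
  \<open>j \<ge> 1\<close>.  In the third branch the multiplicity \<open>m\<close> of \<open>\<mu>\<close> is a positive integer, as
  \<open>\<mu>\<close> is an isolated point of the spectrum; the alternative \<open>m = 0\<close> only serves to make
  the recursion terminate on arbitrary arguments.
\<close>

function eig_num :: "'a::complex_hilbert_space set \<Rightarrow> ('a \<Rightarrow> 'a) \<Rightarrow> nat \<Rightarrow> real" where
  "eig_num M A j =
     (let \<mu> = sup_spectrum M A;
          E = eigenspace M A (complex_of_real \<mu>);
          m = the_enat (cdim E)
      in if op_rank M A < enat j then 0
         else if complex_of_real \<mu> \<in> ess_spectrum M A then \<mu>
         else if j \<le> m \<or> m = 0 then \<mu>
         else eig_num M (\<lambda>x. A x - \<mu> *\<^sub>R orth_proj E x) (j - m))"
  by pat_completeness auto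
termination
  by (relation "Wellfounded.measure (\<lambda>(M, A, j). j)") auto

text \<open>The defining equation loops as a rewrite rule.\<close>

declare eig_num.simps [simp del]

definition s_num ::
  "'a::complex_hilbert_space set \<Rightarrow> ('a \<Rightarrow> 'b::complex_hilbert_space) \<Rightarrow> nat \<Rightarrow> real" where
  "s_num M T j = eig_num M (abs_op M T) j"

text \<open>Sequences are indexed from \<open>1\<close>; the value at \<open>0\<close> is irrelevant.\<close>

definition weights :: "(nat \<Rightarrow> real) set" where
  "weights = {\<pi>. \<pi> 1 = 1 \<and> (\<forall>j\<ge>1. 0 < \<pi> j \<and> \<pi> (Suc j) \<le> \<pi> j)}"

definition ky_fan_norm ::
  "(nat \<Rightarrow> real) \<Rightarrow> nat \<Rightarrow> 'a::complex_hilbert_space set \<Rightarrow>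
     ('a \<Rightarrow> 'b::complex_hilbert_space) \<Rightarrow> real" where
  "ky_fan_norm \<pi> k M T = (\<Sum>j=1..k. \<pi> j * s_num M T j)"

definition orthonormal_upto :: "nat \<Rightarrow> (nat \<Rightarrow> 'a::complex_hilbert_space) \<Rightarrow> bool" where
  "orthonormal_upto n x \<longleftrightarrow>
     (\<forall>i\<in>{1..n}. \<forall>j\<in>{1..n}. cinner (x i) (x j) = (if i = j then 1 else 0))"

definition norming ::
  "(nat \<Rightarrow> real) \<Rightarrow> nat \<Rightarrow> 'a::complex_hilbert_space set \<Rightarrow>
     ('a \<Rightarrow> 'b::complex_hilbert_space) \<Rightarrow> bool" where
  "norming \<pi> k M T \<longleftrightarrow> T \<in> bounded_ops M UNIV \<and>
     (let n = (if cdim M < enat k then the_enat (cdim M) else k)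
      in \<exists>x. (\<forall>j\<in>{1..n}. x j \<in> M) \<and> orthonormal_upto n x \<and>
             ky_fan_norm \<pi> k M T = (\<Sum>j=1..n. \<pi> j * norm (T (x j))))"

definition abs_norming ::
  "(nat \<Rightarrow> real) \<Rightarrow> nat \<Rightarrow> ('a::complex_hilbert_space \<Rightarrow> 'b::complex_hilbert_space) \<Rightarrow> bool" where
  "abs_norming \<pi> k T \<longleftrightarrow> T \<in> bounded_ops UNIV UNIV \<and>
     (\<forall>M. closed_csubspace M \<and> M \<noteq> {0} \<longrightarrow> norming \<pi> k M T)"

end

theory Submission
  imports Defs
begin

text \<open>
  All three conditions are equivalent to: \<open>P\<close> attains its norm on every closed subspace.

  If \<open>P\<close> is absolutely norming for one pair \<open>\<pi>, k\<close>, there is no orthonormal sequence \<open>e\<^sub>n\<close> with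
  pairwise orthogonal images and \<open>\<parallel>P e\<^sub>n\<parallel>\<close> strictly increasing: on its closed span all s-numbers would
  equal \<open>lim \<parallel>P e\<^sub>n\<parallel>\<close>, and no unit vector attains that value.  Where the norm is not attained on some
  closed subspace, such a sequence can be constructed.

  If the norm is attained on every closed subspace, the recursion for the s-numbers runs through genuine
  eigenvectors of \<open>|P|\<^sub>M|\<close>, so \<open>P\<close> is norming for all \<open>\<pi>, k\<close>; and splitting off maximal eigenvectors
  \<open>x\<^sub>1, x\<^sub>2, \<dots>\<close> with eigenvalues decreasing to \<open>\<alpha>\<close> makes \<open>P - \<alpha>\<close> positive and compact on their closed
  span and of finite rank on its complement.  Conversely \<open>\<alpha> I + K + F\<close> attains its norm on each closed
  subspace, because \<open>\<parallel>P x\<parallel>\<^sup>2\<close> differs from \<open>\<alpha>\<^sup>2 \<parallel>x\<parallel>\<^sup>2\<close> by a compact form.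
\<close>

text \<open>Spectral calculus is replaced by one observation: on an invariant subspace of a positive
  operator, a unit vector maximizing the norm of its image is an eigenvector. The main obstacle is
  that a closed subspace \<open>M\<close> is in general not \<open>P\<close>-invariant, so the
  absolute value of the restriction is not a compression of \<open>P\<close>. What survives is
  \<open>norm (abs_op M P x) = norm (P x)\<close>, and attainment is a statement about these norms
  only. Orthogonal images are demanded of the sequences because they turn the
  \<open>e\<^sub>n\<close> into eigenvectors of the absolute value on their closed span. Strict
  growth then makes the limit unattainable: a maximizer would be an eigenvector for a different
  eigenvalue than every \<open>e\<^sub>n\<close>, hence orthogonal to all of them. An unattained
  norm yields such a sequence because passing to finite codimension cannot lower the supremum;
  otherwise a finite-dimensional perturbation argument would produce a maximizer. The exclusion of
  sequences is used once more for the finite rank of \<open>F\<close>: infinitely many eigenvectors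
  below \<alpha> could be mixed with the eigenvectors above it into a forbidden sequence.\<close>

abbreviation csubspace :: "'a::complex_hilbert_space set \<Rightarrow> bool" where
  "csubspace \<equiv> complex_vector.subspace"

abbreviation cspan :: "'a::complex_hilbert_space set \<Rightarrow> 'a set" where
  "cspan \<equiv> complex_vector.span"

section \<open>Complex inner product\<close>

lemma cinner_add_right: "cinner x (y + z) = cinner x y + cinner x (z::'a::complex_hilbert_space)"
  by (metis cinner_add_left cinner_commute complex_cnj_add)

lemma cinner_scaleC_right: "cinner x (a *\<^sub>C y) = cnj a * cinner x (y::'a::complex_hilbert_space)"
  by (metis cinner_commute cinner_scaleC_left complex_cnj_mult)

lemma scaleR_eq_scaleC: "r *\<^sub>R x = complex_of_real r *\<^sub>C (x::'a::complex_hilbert_space)"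
  by (simp add: scaleC_of_real)

lemma cinner_zero_left [simp]: "cinner 0 (y::'a::complex_hilbert_space) = 0"
  using cinner_add_left[of 0 0 y] by simp

lemma cinner_zero_right [simp]: "cinner (y::'a::complex_hilbert_space) 0 = 0"
  using cinner_add_right[of y 0 0] by simp

lemma cinner_minus_left [simp]: "cinner (- x) (y::'a::complex_hilbert_space) = - cinner x y"
  using cinner_add_left[of x "- x" y] by (simp add: add_eq_0_iff)

lemma cinner_minus_right [simp]: "cinner (x::'a::complex_hilbert_space) (- y) = - cinner x y"
  using cinner_add_right[of x y "- y"] by (simp add: add_eq_0_iff)

lemma cinner_diff_left: "cinner (x - y) (z::'a::complex_hilbert_space) = cinner x z - cinner y z"
  using cinner_add_left[of x "- y" z] by simp

lemma cinner_diff_right: "cinner (z::'a::complex_hilbert_space) (x - y) = cinner z x - cinner z y"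
  using cinner_add_right[of z x "- y"] by simp

lemma cinner_scaleR_left [simp]:
  "cinner (r *\<^sub>R x) (y::'a::complex_hilbert_space) = complex_of_real r * cinner x y"
  by (simp add: scaleR_eq_scaleC cinner_scaleC_left)

lemma cinner_scaleR_right [simp]:
  "cinner (x::'a::complex_hilbert_space) (r *\<^sub>R y) = complex_of_real r * cinner x y"
  by (simp add: scaleR_eq_scaleC cinner_scaleC_right)

lemma cinner_sum_left: "cinner (sum f A) (y::'a::complex_hilbert_space) = (\<Sum>i\<in>A. cinner (f i) y)"
  by (induction A rule: infinite_finite_induct) (auto simp: cinner_add_left)

lemma cinner_sum_right: "cinner (y::'a::complex_hilbert_space) (sum f A) = (\<Sum>i\<in>A. cinner y (f i))"
  by (induction A rule: infinite_finite_induct) (auto simp: cinner_add_right)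

lemma cinner_self: "cinner x x = complex_of_real ((norm (x::'a::complex_hilbert_space))\<^sup>2)"
proof -
  have "Im (cinner x x) = 0"
    using cinner_commute[of x x] by (metis Im_divide_of_real complex_cnj_cancel_iff add.inverse_neutral cnj.simps(2) equation_minus_iff neg_equal_zero)
  then show ?thesis
    by (simp add: complex_eq_iff Re_cinner power2_norm_eq_inner)
qed

lemma cinner_eq_zero_iff [simp]: "cinner x x = 0 \<longleftrightarrow> (x::'a::complex_hilbert_space) = 0"
  by (simp add: cinner_self)

lemma cinner_eq_0_commute: "cinner x (y::'a::complex_hilbert_space) = 0 \<longleftrightarrow> cinner y x = 0"
  by (metis cinner_commute complex_cnj_zero_iff)

lemma norm_scaleC [simp]: "norm (a *\<^sub>C x) = cmod a * norm (x::'a::complex_hilbert_space)"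
proof -
  have "complex_of_real ((norm (a *\<^sub>C x))\<^sup>2) = a * cnj a * complex_of_real ((norm x)\<^sup>2)"
    by (simp only: cinner_self [symmetric]) (simp add: cinner_scaleC_left cinner_scaleC_right)
  also have "\<dots> = complex_of_real ((cmod a * norm x)\<^sup>2)"
    by (simp only: complex_norm_square [symmetric]) (simp add: power_mult_distrib)
  finally show ?thesis
    by (simp only: of_real_eq_iff) (simp add: power2_eq_iff_nonneg)
qed

lemma cmod_cinner_le: "cmod (cinner x y) \<le> norm x * norm (y::'a::complex_hilbert_space)"
proof (cases "cinner x y = 0")
  case False
  \<comment> \<open>A unimodular factor that makes the inner product real and nonnegative, so that
    the real Cauchy-Schwarz inequality applies to \<open>u *\<^sub>C x\<close> and
    \<open>y\<close>.\<close>
  define u where "u = cnj (sgn (cinner x y))"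
  have "cmod u = 1" using False by (simp add: u_def norm_sgn)
  have "complex_of_real (cmod (cinner x y)) = u * cinner x y"
    using False by (simp add: u_def sgn_eq complex_norm_square[symmetric] field_simps power2_eq_square)
  then have "cmod (cinner x y) = Re (cinner (u *\<^sub>C x) y)"
    by (metis Re_complex_of_real cinner_scaleC_left)
  also have "\<dots> \<le> norm (u *\<^sub>C x) * norm y"
    by (simp only: Re_cinner norm_cauchy_schwarz)
  finally show ?thesis using \<open>cmod u = 1\<close> by simp
qed simp

lemma bounded_linear_cinner_left: "bounded_linear (\<lambda>x. cinner x (y::'a::complex_hilbert_space))"
  by (rule bounded_linear_intro[where K = "norm y"])
     (auto simp: cinner_add_left scaleR_conv_of_real cmod_cinner_le)

lemma bounded_linear_cinner_right: "bounded_linear (\<lambda>y. cinner x (y::'a::complex_hilbert_space))"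
  by (rule bounded_linear_intro[where K = "norm x"])
     (auto simp: cinner_add_right scaleR_conv_of_real cmod_cinner_le mult.commute[of "norm x"]
       intro: order_trans[OF cmod_cinner_le])

lemma bounded_linear_scaleC: "bounded_linear (\<lambda>x::'a::complex_hilbert_space. a *\<^sub>C x)"
  by (rule bounded_linear_intro[where K = "cmod a"])
     (auto simp: scaleC_add_right scaleR_eq_scaleC scaleC_scaleC mult.commute)

lemmas tendsto_cinner_left = bounded_linear.tendsto[OF bounded_linear_cinner_left]
lemmas continuous_on_cinner_left [continuous_intros] =
  bounded_linear.continuous_on[OF bounded_linear_cinner_left]
lemmas tendsto_scaleC = bounded_linear.tendsto[OF bounded_linear_scaleC]
lemmas continuous_on_scaleC [continuous_intros] =
  bounded_linear.continuous_on[OF bounded_linear_scaleC]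

lemma norm_add_square:
  "(norm (x + y))\<^sup>2 = (norm x)\<^sup>2 + 2 * Re (cinner x y) + (norm (y::'a::complex_hilbert_space))\<^sup>2"
  by (simp add: Re_cinner power2_norm_eq_inner inner_add_left inner_add_right inner_commute)

lemma norm_diff_square:
  "(norm (x - y))\<^sup>2 = (norm x)\<^sup>2 - 2 * Re (cinner x y) + (norm (y::'a::complex_hilbert_space))\<^sup>2"
  using norm_add_square[of x "- y"] by simp

lemma norm_add_square_orthogonal:
  "cinner x y = 0 \<Longrightarrow> (norm (x + y))\<^sup>2 = (norm x)\<^sup>2 + (norm (y::'a::complex_hilbert_space))\<^sup>2"
  by (simp add: norm_add_square)

lemma csubspace_scaleR: "csubspace M \<Longrightarrow> x \<in> M \<Longrightarrow> r *\<^sub>R x \<in> (M::'a::complex_hilbert_space set)"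
  by (simp add: scaleR_eq_scaleC complex_vector.subspace_scale)

lemma csubspace_uminus: "csubspace M \<Longrightarrow> x \<in> M \<Longrightarrow> - x \<in> (M::'a::complex_hilbert_space set)"
  using csubspace_scaleR[of M x "-1"] by simp

lemmas csubspace_intros = complex_vector.subspace_0 complex_vector.subspace_add
  complex_vector.subspace_diff complex_vector.subspace_scale csubspace_scaleR csubspace_uminus
  complex_vector.subspace_sum

lemma csubspace_eq_0_iff:
  assumes "csubspace (N::'a::complex_hilbert_space set)"
  shows "N \<noteq> {0} \<longleftrightarrow> (\<exists>x\<in>N. norm x = 1)"
proof
  assume "N \<noteq> {0}"
  then obtain x where x: "x \<in> N" "x \<noteq> 0" using assms complex_vector.subspace_0 by blast
  then show "\<exists>x\<in>N. norm x = 1"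
    using csubspace_scaleR[OF assms x(1), of "1 / norm x"] by force
qed auto

lemma closed_csubspaceD:
  assumes "closed_csubspace M"
  shows "csubspace M" "closed M"
  using assms by (auto simp: closed_csubspace_def)

lemma closed_csubspace_UNIV: "closed_csubspace UNIV"
  by (simp add: closed_csubspace_def complex_vector.subspace_UNIV)

section \<open>Orthogonal complements and closed linear spans\<close>

definition orth_compl :: "'a::complex_hilbert_space set \<Rightarrow> 'a set" where
  "orth_compl E = {x. \<forall>e\<in>E. cinner x e = 0}"

lemma csubspace_orth_compl: "csubspace (orth_compl E)"
  by (auto simp: orth_compl_def complex_vector.subspace_def cinner_add_left cinner_scaleC_left)

lemma closed_orth_compl: "closed (orth_compl E)"
proof -
  have "orth_compl E = (\<Inter>e\<in>E. {x. cinner x e = 0})" by (auto simp: orth_compl_def)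
  moreover have "closed {x. cinner x e = 0}" for e :: 'a
    by (intro closed_Collect_eq continuous_intros)
  ultimately show ?thesis by auto
qed

lemma closed_csubspace_orth_compl: "closed_csubspace (orth_compl E)"
  by (simp add: closed_csubspace_def csubspace_orth_compl closed_orth_compl)

lemma closed_csubspace_Int:
  "closed_csubspace M \<Longrightarrow> closed_csubspace N \<Longrightarrow> closed_csubspace (M \<inter> N)"
  by (auto simp: closed_csubspace_def complex_vector.subspace_inter)

lemma csubspace_closure:
  assumes "csubspace (M::'a::complex_hilbert_space set)"
  shows "csubspace (closure M)"
  unfolding complex_vector.subspace_def
proof (intro conjI ballI allI)
  show "0 \<in> closure M" using assms closure_subset complex_vector.subspace_0 by blast
next
  fix x y assume "x \<in> closure M" "y \<in> closure M"
  then obtain f g where "\<forall>n. f n \<in> M" "f \<longlonglongrightarrow> x" "\<forall>n. g n \<in> M" "g \<longlonglongrightarrow> y"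
    by (auto simp: closure_sequential)
  then show "x + y \<in> closure M"
    unfolding closure_sequential using assms
    by (intro exI[of _ "\<lambda>n. f n + g n"]) (auto intro: tendsto_add csubspace_intros)
next
  fix c x assume "x \<in> closure M"
  then obtain f where "\<forall>n. f n \<in> M" "f \<longlonglongrightarrow> x"
    by (auto simp: closure_sequential)
  then show "c *\<^sub>C x \<in> closure M"
    unfolding closure_sequential using assms
    by (intro exI[of _ "\<lambda>n. c *\<^sub>C f n"]) (auto intro: tendsto_scaleC csubspace_intros)
qed

lemma closed_csubspace_closure_cspan: "closed_csubspace (closure (cspan B))"
  by (simp add: closed_csubspace_def csubspace_closure complex_vector.subspace_span)

lemma closure_cspan_least:
  assumes "B \<subseteq> M" "closed_csubspace M"
  shows "closure (cspan B) \<subseteq> M"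
  using assms by (meson closed_csubspaceD closure_minimal complex_vector.span_minimal)

section \<open>Orthogonal projections\<close>

text \<open>The parallelogram law delivers its estimates in exactly this form, one error term per
  index, both for minimizing sequences of a distance and for maximizing sequences of a norm.\<close>

lemma Cauchy_if_dist_le:
  fixes y :: "nat \<Rightarrow> 'a::real_normed_vector"
  assumes "\<And>m n. (norm (y m - y n))\<^sup>2 \<le> b m + b n" "b \<longlonglongrightarrow> (0::real)"
  shows "Cauchy y"
proof (rule CauchyI)
  fix e :: real assume "e > 0"
  then have "\<forall>\<^sub>F n in sequentially. b n < e\<^sup>2 / 2"
    using assms(2) by (intro order_tendstoD(2)[of b 0]) auto
  then obtain N where N: "\<And>n. n \<ge> N \<Longrightarrow> b n < e\<^sup>2 / 2" by (auto simp: eventually_sequentially)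
  show "\<exists>N. \<forall>m\<ge>N. \<forall>n\<ge>N. norm (y m - y n) < e"
  proof (intro exI[of _ N] allI impI)
    fix m n assume "m \<ge> N" "n \<ge> N"
    then have "(norm (y m - y n))\<^sup>2 < e\<^sup>2"
      using assms(1)[of m n] N[of m] N[of n] by linarith
    then show "norm (y m - y n) < e" using \<open>e > 0\<close> by (simp add: power2_less_imp_less)
  qed
qed

lemma orth_proj_exists:
  fixes x :: "'a::complex_hilbert_space"
  assumes M: "closed_csubspace M"
  shows "\<exists>y\<in>M. \<forall>z\<in>M. cinner (x - y) z = 0"
proof -
  note sM = closed_csubspaceD(1)[OF M] and cM = closed_csubspaceD(2)[OF M]
  define d where "d = (INF y\<in>M. (norm (x - y))\<^sup>2)"
  have ne: "M \<noteq> {}" using complex_vector.subspace_0[OF sM] by auto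
  have bd: "bdd_below ((\<lambda>y. (norm (x - y))\<^sup>2) ` M)" by (rule bdd_belowI2[of _ 0]) simp
  have dle: "d \<le> (norm (x - y))\<^sup>2" if "y \<in> M" for y
    unfolding d_def by (rule cINF_lower[OF bd that])
  have "\<exists>y\<in>M. (norm (x - y))\<^sup>2 < d + 1 / real (Suc n)" for n
    using cINF_less_iff[OF ne bd, of "d + 1 / real (Suc n)"] unfolding d_def by auto
  then obtain y where y: "\<And>n. y n \<in> M" "\<And>n. (norm (x - y n))\<^sup>2 < d + 1 / real (Suc n)" by metis
  have "(norm (y m - y n))\<^sup>2 \<le> 2 * (1 / real (Suc m)) + 2 * (1 / real (Suc n))" for m n
  proof -
    define w where "w = (1/2) *\<^sub>R (y m + y n)"
    have "w \<in> M" unfolding w_def by (intro csubspace_intros sM y)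
    have "(norm (y m - y n))\<^sup>2 + 4 * (norm (x - w))\<^sup>2 = 2 * (norm (x - y m))\<^sup>2 + 2 * (norm (x - y n))\<^sup>2"
      unfolding w_def power2_norm_eq_inner
      by (simp add: inner_diff_left inner_diff_right inner_add_left inner_add_right inner_commute algebra_simps)
    then show ?thesis using dle[OF \<open>w \<in> M\<close>] y(2)[of m] y(2)[of n] by linarith
  qed
  moreover have "(\<lambda>n. 2 * (1 / real (Suc n))) \<longlonglongrightarrow> 0"
    using tendsto_mult_right_zero[OF LIMSEQ_Suc[OF lim_1_over_n], of 2] by simp
  ultimately have "Cauchy y" by (rule Cauchy_if_dist_le)
  then obtain p where p: "y \<longlonglongrightarrow> p" using Cauchy_convergent_iff convergent_def by blast
  have pM: "p \<in> M" using cM p y(1) closed_sequentially by blast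
  have "(\<lambda>n. (norm (x - y n))\<^sup>2) \<longlonglongrightarrow> (norm (x - p))\<^sup>2" by (intro tendsto_intros p)
  moreover have "(\<lambda>n. d + 1 / real (Suc n)) \<longlonglongrightarrow> d + 0"
    by (intro tendsto_intros LIMSEQ_Suc[OF lim_1_over_n])
  ultimately have pd: "(norm (x - p))\<^sup>2 \<le> d"
    using y(2) by (intro LIMSEQ_le[of _ _ "\<lambda>n. d + 1 / real (Suc n)"]) (auto intro: less_imp_le)
  \<comment> \<open>Moving \<open>p\<close> by the optimal real multiple \<open>t\<close> of
    \<open>z\<close> would lower the squared distance by
    \<open>(Re (cinner (x - p) z))\<^sup>2 / (norm z)\<^sup>2\<close>, which minimality forbids
    unless it is zero.\<close>
  have re: "Re (cinner (x - p) z) = 0" if z: "z \<in> M" for z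
  proof (cases "z = 0")
    case False
    define t where "t = Re (cinner (x - p) z) / (norm z)\<^sup>2"
    have "p + t *\<^sub>R z \<in> M" by (intro csubspace_intros sM pM z)
    then have "d \<le> (norm ((x - p) - t *\<^sub>R z))\<^sup>2" using dle by (metis diff_diff_eq)
    also have "\<dots> = (norm (x - p))\<^sup>2 - 2 * t * Re (cinner (x - p) z) + t\<^sup>2 * (norm z)\<^sup>2"
      by (simp add: norm_diff_square power_mult_distrib)
    also have "\<dots> = (norm (x - p))\<^sup>2 - (Re (cinner (x - p) z))\<^sup>2 / (norm z)\<^sup>2"
      using False by (simp add: t_def field_simps power2_eq_square)
    finally have "(Re (cinner (x - p) z))\<^sup>2 / (norm z)\<^sup>2 \<le> 0" using pd by linarith
    then show ?thesis using False by (simp add: divide_le_0_iff)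
  qed simp
  \<comment> \<open>The imaginary part is the real part for \<open>\<i> *\<^sub>C z\<close>, which
    also lies in \<open>M\<close>.\<close>
  have "cinner (x - p) z = 0" if z: "z \<in> M" for z
    using re[OF z] re[OF complex_vector.subspace_scale[OF sM z, of \<i>]]
    by (simp add: complex_eq_iff cinner_scaleC_right)
  then show ?thesis using pM by blast
qed

lemma orth_proj_eqI:
  assumes M: "csubspace M" and y: "y \<in> M" "\<And>z. z \<in> M \<Longrightarrow> cinner (x - y) z = 0"
  shows "orth_proj M x = y"
  unfolding orth_proj_def
proof (rule the_equality)
  fix w assume w: "w \<in> M \<and> (\<forall>z\<in>M. cinner (x - w) z = 0)"
  then have "y - w \<in> M" using M y by (auto intro: csubspace_intros)
  then have "cinner ((x - w) - (x - y)) (y - w) = 0"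
    using w y by (metis cinner_diff_left diff_self)
  then show "w = y" by simp
qed (use y in auto)

lemma orth_proj_in: "closed_csubspace M \<Longrightarrow> orth_proj M x \<in> M"
  using orth_proj_exists[of M x] orth_proj_eqI closed_csubspaceD(1) by metis

lemma orth_proj_orthogonal:
  "closed_csubspace M \<Longrightarrow> z \<in> M \<Longrightarrow> cinner (x - orth_proj M x) z = 0"
  using orth_proj_exists[of M x] orth_proj_eqI closed_csubspaceD(1) by metis

lemma cinner_orth_proj:
  "closed_csubspace M \<Longrightarrow> z \<in> M \<Longrightarrow> cinner (orth_proj M x) z = cinner x z"
  using orth_proj_orthogonal[of M z x] by (simp add: cinner_diff_left)

lemma cinner_orth_proj_right:
  "closed_csubspace M \<Longrightarrow> z \<in> M \<Longrightarrow> cinner z (orth_proj M x) = cinner z x"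
  by (metis cinner_commute cinner_orth_proj)

lemma orth_proj_id: "closed_csubspace M \<Longrightarrow> x \<in> M \<Longrightarrow> orth_proj M x = x"
  by (intro orth_proj_eqI closed_csubspaceD) auto

lemma diff_orth_proj_in: "closed_csubspace M \<Longrightarrow> x - orth_proj M x \<in> orth_compl M"
  by (simp add: orth_compl_def orth_proj_orthogonal)

lemma orth_proj_add:
  assumes "closed_csubspace M"
  shows "orth_proj M (x + y) = orth_proj M x + orth_proj M y"
  by (intro orth_proj_eqI closed_csubspaceD(1) complex_vector.subspace_add orth_proj_in assms)
     (simp_all add: cinner_add_left cinner_diff_left cinner_orth_proj assms)

lemma orth_proj_scaleC:
  assumes "closed_csubspace M"
  shows "orth_proj M (c *\<^sub>C x) = c *\<^sub>C orth_proj M x"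
  by (intro orth_proj_eqI closed_csubspaceD(1) complex_vector.subspace_scale orth_proj_in assms)
     (simp_all add: cinner_diff_left cinner_scaleC_left cinner_orth_proj assms)

lemma norm_orth_proj_Pythagoras:
  assumes "closed_csubspace M"
  shows "(norm x)\<^sup>2 = (norm (orth_proj M x))\<^sup>2 + (norm (x - orth_proj M x))\<^sup>2"
  using norm_add_square_orthogonal[of "x - orth_proj M x" "orth_proj M x"]
  by (simp add: orth_proj_orthogonal orth_proj_in assms)

lemma norm_orth_proj_le:
  assumes "closed_csubspace M"
  shows "norm (orth_proj M x) \<le> norm x" "norm (x - orth_proj M x) \<le> norm x"
  using norm_orth_proj_Pythagoras[OF assms, of x]
  by (simp_all add: power2_le_imp_le)

section \<open>Dimension and orthonormal families\<close>

lemma cdim_le_card: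
  assumes "finite W" "V \<subseteq> cspan W"
  shows "cdim V \<le> enat (card W)"
  using assms complex_vector.dim_le_card[of V W] by (auto simp: cdim_def)

lemma finite_basis_of_cdim:
  assumes "cdim V \<noteq> \<infinity>"
  obtains B where "finite B" "B \<subseteq> V" "V \<subseteq> cspan B" "complex_vector.independent B"
    "cdim V = enat (card B)"
proof -
  from assms obtain C where C: "finite C" "V \<subseteq> cspan C" by (auto simp: cdim_def split: if_splits)
  obtain B where B: "B \<subseteq> V" "complex_vector.independent B" "V \<subseteq> cspan B"
    "card B = complex_vector.dim V"
    using complex_vector.basis_exists[of V] by blast
  have "finite B"
    using complex_vector.independent_span_bound[OF C(1) B(2)] B(1) C(2) by blast
  moreover have "cdim V = enat (card B)" using C B(4) by (auto simp: cdim_def)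
  ultimately show ?thesis using that B by blast
qed

lemma independent_card_le_cdim:
  assumes "finite B" "B \<subseteq> V" "complex_vector.independent B"
  shows "enat (card B) \<le> cdim V"
proof (cases "cdim V = \<infinity>")
  case False
  then obtain C where "finite C" "V \<subseteq> cspan C" "cdim V = enat (card C)"
    by (rule finite_basis_of_cdim)
  then show ?thesis
    using complex_vector.independent_span_bound[of C B] assms by auto
qed simp

lemma cdim_le_Suc:
  assumes "V \<subseteq> cspan (insert v W)"
  shows "cdim V \<le> cdim W + 1"
proof (cases "cdim W = \<infinity>")
  case False
  then obtain B where B: "finite B" "W \<subseteq> cspan B" "cdim W = enat (card B)"
    by (rule finite_basis_of_cdim)
  have "insert v W \<subseteq> cspan (insert v B)"
    using B(2) complex_vector.span_mono[of B "insert v B"] by (auto simp: complex_vector.span_base)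
  then have "V \<subseteq> cspan (insert v B)"
    using assms by (meson complex_vector.span_minimal complex_vector.subspace_span order_trans)
  then have "cdim V \<le> enat (card (insert v B))" using B(1) by (intro cdim_le_card) auto
  also have "\<dots> \<le> cdim W + 1"
    using B(1,3) card_insert_le_m1[of "Suc (card B)" B v] by (auto simp: one_enat_def card_insert_if)
  finally show ?thesis .
qed simp

lemma cdim_mono: "V \<subseteq> cspan W \<Longrightarrow> cdim V \<le> cdim W"
proof (cases "cdim W = \<infinity>")
  case False
  assume V: "V \<subseteq> cspan W"
  from False obtain B where B: "finite B" "W \<subseteq> cspan B" "cdim W = enat (card B)"
    by (rule finite_basis_of_cdim)
  then have "V \<subseteq> cspan B"
    using V by (meson complex_vector.span_minimal complex_vector.subspace_span order_trans)
  then show ?thesis using B cdim_le_card by metis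
qed simp

lemma cdim_subset: "V \<subseteq> W \<Longrightarrow> cdim V \<le> cdim W"
  by (meson cdim_mono complex_vector.span_superset order_trans)

text \<open>Each vector of \<open>C\<close> imposes one linear condition, and passing to its kernel
  in \<open>V\<close> lowers the dimension by at most one; this drives the induction, and infinite
  dimension is covered by the same count.\<close>

lemma exists_orthogonal_unit:
  assumes "finite C" "csubspace V" "enat (card C) < cdim V"
  shows "\<exists>v\<in>V. norm v = 1 \<and> (\<forall>c\<in>C. cinner v c = 0)"
  using assms
proof (induction C arbitrary: V rule: finite_induct)
  case empty
  have "V \<noteq> {0}" using empty(2) cdim_le_card[of "{}" V] by (auto simp: zero_enat_def)
  then show ?case using csubspace_eq_0_iff[OF empty(1)] by blast
next
  case (insert c C)
  define W where "W = V \<inter> orth_compl {c}"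
  have sW: "csubspace W"
    unfolding W_def by (intro complex_vector.subspace_inter csubspace_orth_compl insert.prems)
  have "enat (card C) < cdim W"
  proof (cases "\<exists>v\<in>V. cinner v c \<noteq> 0")
    case True
    then obtain v where v: "v \<in> V" "cinner v c \<noteq> 0" by blast
    have "V \<subseteq> cspan (insert v W)"
    proof
      fix u assume u: "u \<in> V"
      define a where "a = cinner u c / cinner v c"
      have "u - a *\<^sub>C v \<in> W"
        using u v insert.prems
        by (auto simp: W_def orth_compl_def cinner_diff_left cinner_scaleC_left a_def intro!: csubspace_intros)
      then have "(u - a *\<^sub>C v) + a *\<^sub>C v \<in> cspan (insert v W)"
        by (intro complex_vector.span_add complex_vector.span_scale complex_vector.span_base) auto
      then show "u \<in> cspan (insert v W)" by simp
    qed
    then have "cdim V \<le> cdim W + 1" by (rule cdim_le_Suc)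
    then show ?thesis using insert.prems(2) insert.hyps
      by (cases "cdim W"; cases "cdim V") (auto simp: one_enat_def)
  next
    case False
    then have "W = V" by (auto simp: W_def orth_compl_def)
    then show ?thesis using insert.prems(2) insert.hyps
      by (simp add: order.strict_trans[rotated])
  qed
  from insert.IH[OF sW this] show ?case by (auto simp: W_def orth_compl_def)
qed

lemma orthonormal_uptoD:
  "orthonormal_upto n x \<Longrightarrow> i \<in> {1..n} \<Longrightarrow> j \<in> {1..n} \<Longrightarrow>
    cinner (x i) (x j) = (if i = j then 1 else 0)"
  unfolding orthonormal_upto_def by blast

lemma orthonormal_upto_norm:
  assumes "orthonormal_upto n x" "i \<in> {1..n}"
  shows "norm (x i) = 1"
proof -
  have "cinner (x i) (x i) = 1" using assms by (auto simp: orthonormal_upto_def)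
  then have "(norm (x i))\<^sup>2 = 1\<^sup>2"
    by (simp only: cinner_self of_real_eq_1_iff power_one)
  then show ?thesis by (simp only: power2_eq_iff_nonneg norm_ge_zero zero_le_one)
qed

lemma orthonormal_upto_le: "orthonormal_upto n x \<Longrightarrow> m \<le> n \<Longrightarrow> orthonormal_upto m x"
  by (auto simp: orthonormal_upto_def)

lemma orthonormal_upto_Suc:
  assumes "orthonormal_upto n x" "norm (x (Suc n)) = 1" "\<And>i. i \<in> {1..n} \<Longrightarrow> cinner (x (Suc n)) (x i) = 0"
  shows "orthonormal_upto (Suc n) x"
  unfolding orthonormal_upto_def
proof (intro ballI)
  have new: "cinner (x i) (x (Suc n)) = 0" if "i \<in> {1..n}" for i
    using assms(3)[OF that] cinner_eq_0_commute by blast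
  fix i j assume ij: "i \<in> {1..Suc n}" "j \<in> {1..Suc n}"
  show "cinner (x i) (x j) = (if i = j then 1 else 0)"
  proof (cases "i = Suc n"; cases "j = Suc n")
    assume "i = Suc n" "j = Suc n"
    then show ?thesis using assms(2) by (simp add: cinner_self)
  next
    assume "i \<noteq> Suc n" "j \<noteq> Suc n"
    then show ?thesis using assms(1) ij by (auto simp: orthonormal_upto_def)
  next
    assume "i = Suc n" "j \<noteq> Suc n"
    then show ?thesis using assms(3)[of j] ij by auto
  next
    assume "i \<noteq> Suc n" "j = Suc n"
    then show ?thesis using new[of i] ij by auto
  qed
qed

lemma orthonormal_upto_extend:
  assumes "csubspace V" "enat n \<le> cdim V" "m \<le> n" "orthonormal_upto m x" "x ` {1..m} \<subseteq> V"
  shows "\<exists>y. orthonormal_upto n y \<and> y ` {1..n} \<subseteq> V \<and> (\<forall>i\<in>{1..m}. y i = x i)"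
  using assms(3,2)
proof (induction n rule: dec_induct)
  case base
  then show ?case using assms by blast
next
  case (step n)
  have "enat n \<le> cdim V" using step.prems by (meson Suc_ile_eq order_less_imp_le)
  from step.IH[OF this] obtain y where y: "orthonormal_upto n y" "y ` {1..n} \<subseteq> V" "\<forall>i\<in>{1..m}. y i = x i"
    by blast
  have "enat (card (y ` {1..n})) < cdim V"
    using step.prems card_image_le[of "{1..n}" y] by (cases "cdim V") auto
  then obtain v where v: "v \<in> V" "norm v = 1" "\<forall>i\<in>{1..n}. cinner v (y i) = 0"
    using exists_orthogonal_unit[of "y ` {1..n}" V] assms(1) by auto
  define z where "z = y(Suc n := v)"
  have "orthonormal_upto n z" using y(1) by (simp add: orthonormal_upto_def z_def)
  then have "orthonormal_upto (Suc n) z"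
    using v by (intro orthonormal_upto_Suc) (auto simp: z_def)
  moreover have "z ` {1..Suc n} \<subseteq> V" using y(2) v(1) by (auto simp: z_def image_subset_iff)
  moreover have "\<forall>i\<in>{1..m}. z i = x i" using y(3) step.hyps by (auto simp: z_def)
  ultimately show ?case by blast
qed

lemma cinner_cspan_zero:
  assumes "\<And>b. b \<in> B \<Longrightarrow> cinner b c = 0" "x \<in> cspan B"
  shows "cinner x c = 0"
proof -
  have "cspan B \<subseteq> orth_compl {c}"
    using assms(1) by (intro complex_vector.span_minimal csubspace_orth_compl) (auto simp: orth_compl_def)
  then show ?thesis using assms(2) by (auto simp: orth_compl_def)
qed

lemma orthonormal_upto_independent:
  assumes "orthonormal_upto n x"
  shows "complex_vector.independent (x ` {1..n}) \<and> card (x ` {1..n}) = n"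
  using assms
proof (induction n)
  case 0
  then show ?case by (simp add: complex_vector.independent_empty)
next
  case (Suc n)
  have IH: "complex_vector.independent (x ` {1..n})" "card (x ` {1..n}) = n"
    using Suc orthonormal_upto_le[OF Suc.prems, of n] by auto
  have "x (Suc n) \<notin> cspan (x ` {1..n})"
  proof
    assume "x (Suc n) \<in> cspan (x ` {1..n})"
    then have "cinner (x (Suc n)) (x (Suc n)) = 0"
      by (rule cinner_cspan_zero[rotated]) (use orthonormal_uptoD[OF Suc.prems, of _ "Suc n"] in force)
    then show False using orthonormal_upto_norm[OF Suc.prems, of "Suc n"] by auto
  qed
  moreover have "x ` {1..Suc n} = insert (x (Suc n)) (x ` {1..n})"
    by (auto simp: atLeastAtMostSuc_conv)
  ultimately show ?case
    using IH complex_vector.span_base[of "x (Suc n)" "x ` {1..n}"]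
      complex_vector.independent_insertI[of "x (Suc n)" "x ` {1..n}"]
    by (metis card_insert_disjoint finite_atLeastAtMost finite_imageI)
qed

lemma orthonormal_upto_le_cdim:
  assumes "orthonormal_upto n x" "x ` {1..n} \<subseteq> V"
  shows "enat n \<le> cdim V"
  using independent_card_le_cdim[of "x ` {1..n}" V] orthonormal_upto_independent[OF assms(1)] assms(2)
  by auto

text \<open>Turns dimension comparisons into the existence of orthonormal families, uniformly for
  finite and infinite dimension.\<close>

lemma enat_le_cdim_iff:
  assumes "csubspace V"
  shows "enat n \<le> cdim V \<longleftrightarrow> (\<exists>x. orthonormal_upto n x \<and> x ` {1..n} \<subseteq> V)"
proof
  assume "enat n \<le> cdim V"
  then show "\<exists>x. orthonormal_upto n x \<and> x ` {1..n} \<subseteq> V"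
    using orthonormal_upto_extend[OF assms, of n 0] by (auto simp: orthonormal_upto_def[of 0])
qed (use orthonormal_upto_le_cdim in blast)

lemma orthonormal_basis:
  assumes "csubspace V" "cdim V = enat n"
  obtains x where "orthonormal_upto n x" "x ` {1..n} \<subseteq> V"
    "\<And>v. v \<in> V \<Longrightarrow> v = (\<Sum>i\<in>{1..n}. cinner v (x i) *\<^sub>C x i)"
proof -
  obtain x where x: "orthonormal_upto n x" "x ` {1..n} \<subseteq> V"
    using enat_le_cdim_iff[OF assms(1), of n] assms(2) by auto
  have "v = (\<Sum>i\<in>{1..n}. cinner v (x i) *\<^sub>C x i)" if "v \<in> V" for v
  proof (rule ccontr)
    \<comment> \<open>The residual is orthogonal to all \<open>x i\<close>; normalized, it would be
      vector number \<open>n + 1\<close> of an orthonormal family in a space of dimension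
      \<open>n\<close>.\<close>
    define w where "w = v - (\<Sum>i\<in>{1..n}. cinner v (x i) *\<^sub>C x i)"
    assume "v \<noteq> (\<Sum>i\<in>{1..n}. cinner v (x i) *\<^sub>C x i)"
    then have "w \<noteq> 0" by (simp add: w_def)
    have "w \<in> V"
      unfolding w_def using x(2) that by (intro csubspace_intros assms) auto
    have 1: "cinner w (x i) = 0" if i: "i \<in> {1..n}" for i
    proof -
      have "(\<Sum>j\<in>{1..n}. cinner v (x j) * cinner (x j) (x i)) = (\<Sum>j\<in>{1..n}. if j = i then cinner v (x i) else 0)"
        by (intro sum.cong refl) (simp add: orthonormal_uptoD[OF x(1) _ i])
      then show ?thesis using i
        by (simp add: w_def cinner_diff_left cinner_sum_left cinner_scaleC_left)
    qed
    define z where "z = x(Suc n := (1 / norm w) *\<^sub>R w)"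
    have "orthonormal_upto n z" using x(1) by (simp add: orthonormal_upto_def z_def)
    then have "orthonormal_upto (Suc n) z"
      using \<open>w \<noteq> 0\<close> 1 by (intro orthonormal_upto_Suc) (auto simp: z_def)
    moreover have "z ` {1..Suc n} \<subseteq> V"
      using x(2) \<open>w \<in> V\<close> assms(1) by (auto simp: z_def image_subset_iff intro!: csubspace_intros)
    ultimately show False using orthonormal_upto_le_cdim[of "Suc n" z V] assms(2) by auto
  qed
  then show ?thesis using that x by blast
qed

section \<open>Compactness in finite-dimensional subspaces\<close>

lemma compact_bounded_combinations:
  fixes x :: "'i \<Rightarrow> 'a::complex_hilbert_space"
  assumes "finite I"
  shows "compact {(\<Sum>i\<in>I. a i *\<^sub>C x i) | a. \<forall>i\<in>I. cmod (a i) \<le> R}" (is "compact (?L I)")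
  using assms
proof (induction I rule: finite_induct)
  case empty
  then show ?case by simp
next
  case (insert j I)
  have "?L (insert j I) = {u + v | u v. u \<in> (\<lambda>a. a *\<^sub>C x j) ` cball 0 R \<and> v \<in> ?L I}"
  proof (intro equalityI subsetI)
    fix y assume "y \<in> ?L (insert j I)"
    then obtain a where a: "\<forall>i\<in>insert j I. cmod (a i) \<le> R" "y = (\<Sum>i\<in>insert j I. a i *\<^sub>C x i)"
      by blast
    have "y = a j *\<^sub>C x j + (\<Sum>i\<in>I. a i *\<^sub>C x i)" using a(2) insert.hyps by simp
    moreover have "a j *\<^sub>C x j \<in> (\<lambda>a. a *\<^sub>C x j) ` cball 0 R" using a(1) by auto
    moreover have "(\<Sum>i\<in>I. a i *\<^sub>C x i) \<in> ?L I" using a(1) by blast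
    ultimately show "y \<in> {u + v | u v. u \<in> (\<lambda>a. a *\<^sub>C x j) ` cball 0 R \<and> v \<in> ?L I}"
      by blast
  next
    fix y assume "y \<in> {u + v | u v. u \<in> (\<lambda>a. a *\<^sub>C x j) ` cball 0 R \<and> v \<in> ?L I}"
    then obtain b a where b: "cmod b \<le> R" "\<forall>i\<in>I. cmod (a i) \<le> R" "y = b *\<^sub>C x j + (\<Sum>i\<in>I. a i *\<^sub>C x i)"
      by auto
    have "y = (\<Sum>i\<in>insert j I. (a(j := b)) i *\<^sub>C x i)"
      using insert.hyps b(3) by (auto intro!: sum.cong)
    moreover have "\<forall>i\<in>insert j I. cmod ((a(j := b)) i) \<le> R" using b by auto
    ultimately show "y \<in> ?L (insert j I)" by blast
  qed
  have "compact ((\<lambda>a. a *\<^sub>C x j) ` cball 0 R)"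
  proof (intro compact_continuous_image)
    have "bounded_linear (\<lambda>a. a *\<^sub>C x j)"
      by (rule bounded_linear_intro[where K = "norm (x j)"])
         (simp_all add: scaleC_add_left scaleR_eq_scaleC[of _ "_ *\<^sub>C _"] scaleC_scaleC scaleR_conv_of_real)
    then show "continuous_on (cball 0 R) (\<lambda>a. a *\<^sub>C x j)"
      by (rule linear_continuous_on)
  qed simp
  from compact_sums[OF this insert.IH] show ?case by (simp only: \<open>?L (insert j I) = _\<close>)
qed

text \<open>Bolzano-Weierstrass: coordinates in an orthonormal basis are bounded by the norm, so the
  sequence stays in a compact set of linear combinations that is itself contained in
  \<open>V\<close>.\<close>

lemma finite_cdim_bounded_subseq:
  fixes v :: "nat \<Rightarrow> 'a::complex_hilbert_space"
  assumes "csubspace V" "cdim V \<noteq> \<infinity>" "\<And>n. v n \<in> V" "\<And>n. norm (v n) \<le> R"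
  shows "\<exists>l r. l \<in> V \<and> strict_mono r \<and> (v \<circ> r) \<longlonglongrightarrow> l"
proof -
  obtain d where d: "cdim V = enat d" using assms(2) by auto
  from assms(1) d obtain x where x: "orthonormal_upto d x" "x ` {1..d} \<subseteq> V"
    "\<And>v. v \<in> V \<Longrightarrow> v = (\<Sum>i\<in>{1..d}. cinner v (x i) *\<^sub>C x i)"
    by (rule orthonormal_basis) blast
  define L where "L = {(\<Sum>i\<in>{1..d}. a i *\<^sub>C x i) | a. \<forall>i\<in>{1..d}. cmod (a i) \<le> R}"
  have "compact L" unfolding L_def by (intro compact_bounded_combinations) auto
  moreover have "v n \<in> L" for n
  proof -
    have le: "cmod (cinner (v n) (x i)) \<le> R" if "i \<in> {1..d}" for i
      using cmod_cinner_le[of "v n" "x i"] orthonormal_upto_norm[OF x(1) that] assms(4)[of n] by simp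
    show ?thesis
      unfolding L_def
      by (intro CollectI exI[of _ "\<lambda>i. cinner (v n) (x i)"] conjI ballI le x(3)[OF assms(3)])
  qed
  ultimately obtain l r where lr: "l \<in> L" "strict_mono r" "(v \<circ> r) \<longlonglongrightarrow> l"
    unfolding compact_def by blast
  have "L \<subseteq> V" using x(2) assms(1) by (auto simp: L_def intro!: csubspace_intros)
  with lr show ?thesis by blast
qed

lemma closed_csubspace_finite_cdim:
  assumes "csubspace V" "cdim V \<noteq> \<infinity>"
  shows "closed_csubspace V"
  unfolding closed_csubspace_def
proof (intro conjI assms)
  show "closed V"
    unfolding closed_sequential_limits
  proof (intro allI impI, elim conjE)
    fix v l assume v: "\<forall>n. v n \<in> V" "v \<longlonglongrightarrow> l"
    then have "Bseq v" using convergent_imp_Bseq convergentI by blast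
    then obtain R where "\<And>n. norm (v n) \<le> R" by (auto simp: Bseq_def)
    then obtain k r where "k \<in> V" "strict_mono r" "(v \<circ> r) \<longlonglongrightarrow> k"
      using finite_cdim_bounded_subseq[OF assms, of v R] v by blast
    then show "l \<in> V" using v(2) LIMSEQ_unique LIMSEQ_subseq_LIMSEQ by metis
  qed
qed

lemma cdim_cspan_finite: "finite B \<Longrightarrow> cdim (cspan B) \<noteq> \<infinity>"
  by (auto simp: cdim_def)

section \<open>Bounded and positive operators\<close>

lemma bounded_opsD:
  assumes "T \<in> bounded_ops M N"
  shows bounded_ops_in: "x \<in> M \<Longrightarrow> T x \<in> N"
    and bounded_ops_add: "x \<in> M \<Longrightarrow> y \<in> M \<Longrightarrow> T (x + y) = T x + T y"
    and bounded_ops_scaleC: "x \<in> M \<Longrightarrow> T (a *\<^sub>C x) = a *\<^sub>C T x"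
  using assms by (auto simp: bounded_ops_def)

lemma bounded_ops_bound:
  assumes "T \<in> bounded_ops M N"
  obtains C where "C > 0" "\<And>x. x \<in> M \<Longrightarrow> norm (T x) \<le> C * norm x"
proof -
  obtain C where C: "\<forall>x\<in>M. norm (T x) \<le> C * norm x" using assms by (auto simp: bounded_ops_def)
  have "norm (T x) \<le> (max C 1) * norm x" if "x \<in> M" for x
    using C that by (meson max.cobounded1 mult_right_mono norm_ge_zero order_trans)
  then show ?thesis using that[of "max C 1"] by auto
qed

lemma bounded_ops_scaleR: "T \<in> bounded_ops M N \<Longrightarrow> x \<in> M \<Longrightarrow> T (r *\<^sub>R x) = r *\<^sub>R T x"
  by (simp add: scaleR_eq_scaleC bounded_ops_scaleC)

lemma bounded_ops_minus: "T \<in> bounded_ops M N \<Longrightarrow> x \<in> M \<Longrightarrow> T (- x) = - T x"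
  using bounded_ops_scaleR[of T M N x "-1"] by simp

lemma bounded_ops_diff:
  "T \<in> bounded_ops M N \<Longrightarrow> csubspace M \<Longrightarrow> x \<in> M \<Longrightarrow> y \<in> M \<Longrightarrow> T (x - y) = T x - T y"
  using bounded_ops_add[of T M N x "- y"] bounded_ops_minus[of T M N y]
  by (simp add: csubspace_uminus)

lemma bounded_ops_0: "T \<in> bounded_ops M N \<Longrightarrow> csubspace M \<Longrightarrow> T 0 = 0"
  using bounded_ops_diff[of T M N 0 0] by (simp add: complex_vector.subspace_0)

lemma bounded_ops_sum:
  assumes "T \<in> bounded_ops M N" "csubspace M" "\<And>i. i \<in> I \<Longrightarrow> f i \<in> M"
  shows "T (\<Sum>i\<in>I. f i) = (\<Sum>i\<in>I. T (f i))"
  using assms(3)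
  by (induction I rule: infinite_finite_induct)
     (auto simp: bounded_ops_0[OF assms(1,2)] bounded_ops_add[OF assms(1)] assms(2) complex_vector.subspace_sum)

lemma bounded_opsI:
  assumes "\<And>x. x \<in> M \<Longrightarrow> T x \<in> N" "\<And>x y. x \<in> M \<Longrightarrow> y \<in> M \<Longrightarrow> T (x + y) = T x + T y"
    "\<And>a x. x \<in> M \<Longrightarrow> T (a *\<^sub>C x) = a *\<^sub>C T x" "\<And>x. x \<in> M \<Longrightarrow> norm (T x) \<le> C * norm x"
  shows "T \<in> bounded_ops M N"
  using assms by (auto simp: bounded_ops_def intro!: exI[of _ C])

lemma bounded_ops_mono:
  assumes "T \<in> bounded_ops M N" "M' \<subseteq> M" "\<And>x. x \<in> M' \<Longrightarrow> T x \<in> N'"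
  shows "T \<in> bounded_ops M' N'"
  using assms by (auto simp: bounded_ops_def subset_iff; blast)

lemma bounded_ops_plus:
  assumes "T \<in> bounded_ops M N" "U \<in> bounded_ops M N" "csubspace N"
  shows "(\<lambda>x. T x + U x) \<in> bounded_ops M N"
proof -
  obtain C D where C: "\<And>x. x \<in> M \<Longrightarrow> norm (T x) \<le> C * norm x"
    and D: "\<And>x. x \<in> M \<Longrightarrow> norm (U x) \<le> D * norm x"
    using bounded_ops_bound assms(1,2) by metis
  show ?thesis
  proof (rule bounded_opsI[where C = "C + D"])
    show "norm (T x + U x) \<le> (C + D) * norm x" if "x \<in> M" for x
      using norm_triangle_mono[OF C[OF that] D[OF that]] by (simp add: distrib_right)
  qed (simp_all add: bounded_ops_in[OF assms(1)] bounded_ops_in[OF assms(2)] bounded_ops_add[OF assms(1)]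
      bounded_ops_add[OF assms(2)] bounded_ops_scaleC[OF assms(1)] bounded_ops_scaleC[OF assms(2)]
      complex_vector.subspace_add[OF assms(3)] scaleC_add_right)
qed

lemma bounded_ops_scale:
  assumes "T \<in> bounded_ops M N" "csubspace N"
  shows "(\<lambda>x. r *\<^sub>R T x) \<in> bounded_ops M N"
proof -
  obtain C where C: "\<And>x. x \<in> M \<Longrightarrow> norm (T x) \<le> C * norm x"
    using bounded_ops_bound assms(1) by metis
  show ?thesis
  proof (rule bounded_opsI[where C = "\<bar>r\<bar> * C"])
    show "norm (r *\<^sub>R T x) \<le> \<bar>r\<bar> * C * norm x" if "x \<in> M" for x
      using mult_left_mono[OF C[OF that], of "\<bar>r\<bar>"] by simp
  qed (simp_all add: bounded_ops_in[OF assms(1)] bounded_ops_add[OF assms(1)] complex_vector.subspace_scale[OF assms(2)]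
      bounded_ops_scaleC[OF assms(1)] scaleC_add_right scaleR_eq_scaleC mult.commute)
qed

lemma bounded_ops_id: "(\<lambda>x. x) \<in> bounded_ops M M"
  by (rule bounded_opsI[where C = 1]) auto

lemma csubspace_image:
  assumes "T \<in> bounded_ops M N" "csubspace M"
  shows "csubspace (T ` M)"
  unfolding complex_vector.subspace_def
proof (intro conjI ballI allI)
  show "0 \<in> T ` M"
    using bounded_ops_0[OF assms] complex_vector.subspace_0[OF assms(2)] by force
  fix x y c assume "x \<in> T ` M" "y \<in> T ` M"
  then obtain u v where uv: "u \<in> M" "x = T u" "v \<in> M" "y = T v" by blast
  then show "x + y \<in> T ` M"
    using bounded_ops_add[OF assms(1)] complex_vector.subspace_add[OF assms(2)] by (metis imageI)
  show "c *\<^sub>C x \<in> T ` M"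
    using uv bounded_ops_scaleC[OF assms(1)] complex_vector.subspace_scale[OF assms(2)] by (metis imageI)
qed

lemma bounded_ops_tendsto:
  assumes T: "T \<in> bounded_ops M N" and sM: "csubspace M"
    and "\<And>n. f n \<in> M" "l \<in> M" "f \<longlonglongrightarrow> l"
  shows "(\<lambda>n. T (f n)) \<longlonglongrightarrow> T l"
proof -
  obtain C where C: "C > 0" "\<And>x. x \<in> M \<Longrightarrow> norm (T x) \<le> C * norm x"
    using bounded_ops_bound[OF T] by blast
  have "(\<lambda>n. T (f n) - T l) \<longlonglongrightarrow> 0"
  proof (rule Lim_null_comparison)
    show "\<forall>\<^sub>F n in sequentially. norm (T (f n) - T l) \<le> C * norm (f n - l)"
      using C(2) assms bounded_ops_diff[OF T sM]
      by (intro always_eventually allI) (metis complex_vector.subspace_diff)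
    show "(\<lambda>n. C * norm (f n - l)) \<longlonglongrightarrow> 0"
      using assms(5) by (simp add: LIM_zero_iff tendsto_mult_right_zero tendsto_norm_zero)
  qed
  then show ?thesis by (simp add: LIM_zero_iff)
qed

lemma bounded_ops_continuous_on:
  assumes "T \<in> bounded_ops M N" "csubspace M"
  shows "continuous_on M T"
  unfolding continuous_on_sequentially
  using bounded_ops_tendsto[OF assms] by (auto simp: o_def)

lemma closed_csubspace_eigenspace:
  assumes T: "T \<in> bounded_ops M M" and M: "closed_csubspace M"
  shows "closed_csubspace (eigenspace M T z)"
  unfolding closed_csubspace_def
proof
  note sM = closed_csubspaceD(1)[OF M]
  show "csubspace (eigenspace M T z)"
    using sM by (auto simp: eigenspace_def complex_vector.subspace_def bounded_ops_add[OF T]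
        bounded_ops_scaleC[OF T] bounded_ops_0[OF T sM] scaleC_add_right scaleC_scaleC mult.commute)
  have "continuous_on M (\<lambda>x. T x - z *\<^sub>C x)"
    by (intro continuous_intros bounded_ops_continuous_on[OF T sM])
  then have "closed {x \<in> M. T x - z *\<^sub>C x = 0}"
    by (intro continuous_closed_preimage_constant closed_csubspaceD M)
  then show "closed (eigenspace M T z)" by (simp add: eigenspace_def)
qed

section \<open>Self-adjoint and positive operators\<close>

lemma selfadjoint_op_add:
  assumes "selfadjoint_op M A" "selfadjoint_op M B" "csubspace M"
  shows "selfadjoint_op M (\<lambda>x. A x + B x)"
  using assms by (simp add: selfadjoint_op_def bounded_ops_plus cinner_add_left cinner_add_right)

lemma selfadjoint_op_scale:
  assumes "selfadjoint_op M A" "csubspace M"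
  shows "selfadjoint_op M (\<lambda>x. r *\<^sub>R A x)"
  using assms by (simp add: selfadjoint_op_def bounded_ops_scale)

lemma selfadjoint_op_diff:
  assumes "selfadjoint_op M A" "selfadjoint_op M B" "csubspace M"
  shows "selfadjoint_op M (\<lambda>x. A x - B x)"
  using selfadjoint_op_add[OF assms(1) selfadjoint_op_scale[OF assms(2,3), of "-1"] assms(3)] by simp

lemma selfadjoint_op_id: "selfadjoint_op M (\<lambda>x. x)"
  by (simp add: selfadjoint_op_def bounded_ops_id)

lemma positive_op_bounded: "positive_op M A \<Longrightarrow> A \<in> bounded_ops M M"
  by (simp add: positive_op_def)

lemma positive_op_cinner_ge_0: "positive_op M A \<Longrightarrow> x \<in> M \<Longrightarrow> 0 \<le> Re (cinner (A x) x)"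
  by (auto simp: positive_op_def complex_nonneg_Reals_iff)

text \<open>Polarization; real scalars would not suffice here.\<close>

lemma positive_op_selfadjoint:
  assumes A: "positive_op M A" and sM: "csubspace M"
  shows "selfadjoint_op M A"
  unfolding selfadjoint_op_def
proof (intro conjI ballI)
  show bA: "A \<in> bounded_ops M M" by (rule positive_op_bounded[OF A])
  define b where "b x y = cinner (A x) y - cinner x (A y)" for x y
  have b0: "b x x = 0" if "x \<in> M" for x
  proof -
    have "cinner (A x) x \<in> \<real>" using A that by (auto simp: positive_op_def nonneg_Reals_subset_Reals[THEN subsetD])
    then have "cnj (cinner (A x) x) = cinner (A x) x" by (simp add: Reals_cnj_iff)
    then show ?thesis by (simp add: b_def cinner_commute[of x "A x"])
  qed
  fix x y assume x: "x \<in> M" and y: "y \<in> M"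
  have iy: "\<i> *\<^sub>C y \<in> M" using y sM complex_vector.subspace_scale by blast
  have "b (x + y) (x + y) = b x x + b x y + b y x + b y y"
    by (simp add: b_def bounded_ops_add[OF bA] x y cinner_add_left cinner_add_right)
  then have 1: "b x y + b y x = 0"
    using b0 x y complex_vector.subspace_add[OF sM] by auto
  have "b (x + \<i> *\<^sub>C y) (x + \<i> *\<^sub>C y) = b x x - \<i> * b x y + \<i> * b y x + b y y"
    by (simp add: b_def bounded_ops_add[OF bA] bounded_ops_scaleC[OF bA] x y iy cinner_add_left
        cinner_add_right cinner_scaleC_left cinner_scaleC_right algebra_simps)
  then have "\<i> * (b y x - b x y) = 0"
    using b0 x y iy complex_vector.subspace_add[OF sM x iy] by (simp add: algebra_simps)
  then have "b y x = b x y" by simp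
  with 1 have "b x y = 0" by simp
  then show "cinner (A x) y = cinner x (A y)" by (simp add: b_def)
qed

lemma selfadjoint_opD:
  "selfadjoint_op M A \<Longrightarrow> x \<in> M \<Longrightarrow> y \<in> M \<Longrightarrow> cinner (A x) y = cinner x (A y)"
  by (simp add: selfadjoint_op_def)

lemma selfadjoint_op_bounded: "selfadjoint_op M A \<Longrightarrow> A \<in> bounded_ops M M"
  by (simp add: selfadjoint_op_def)

lemma selfadjoint_op_cinner_real:
  assumes "selfadjoint_op M A" "x \<in> M"
  shows "cinner (A x) x = complex_of_real (Re (cinner (A x) x))"
proof -
  have "cnj (cinner (A x) x) = cinner (A x) x"
    using selfadjoint_opD[OF assms assms(2)] cinner_commute[of x "A x"] by simp
  then show ?thesis by (simp add: complex_eq_iff)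
qed

lemma positive_opI:
  assumes "selfadjoint_op M A" "\<And>x. x \<in> M \<Longrightarrow> 0 \<le> Re (cinner (A x) x)"
  shows "positive_op M A"
  using assms selfadjoint_op_cinner_real[OF assms(1)]
  by (auto simp: positive_op_def selfadjoint_op_bounded) (metis nonneg_Reals_of_real_iff)

text \<open>Positivity evaluated at \<open>x - (1 / C) *\<^sub>R A x\<close>, where the quadratic
  term is controlled by the bound \<open>C\<close>. It yields both the contraction needed for square
  roots and the fact that a vanishing form means a vanishing image.\<close>

lemma positive_op_norm_square_le:
  assumes A: "positive_op M A" and sM: "csubspace M" and x: "x \<in> M"
    and C: "C > 0" "\<And>x. x \<in> M \<Longrightarrow> norm (A x) \<le> C * norm x"
  shows "(norm (A x))\<^sup>2 \<le> C * Re (cinner (A x) x)"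
proof -
  note bA = positive_op_bounded[OF A] and sA = positive_op_selfadjoint[OF A sM]
  have Ax: "A x \<in> M" using bA x bounded_ops_in by blast
  define y where "y = x - (1 / C) *\<^sub>R A x"
  have yM: "y \<in> M" unfolding y_def by (intro csubspace_intros sM x Ax)
  have Ay: "A y = A x - (1 / C) *\<^sub>R A (A x)"
    unfolding y_def by (simp add: bounded_ops_diff[OF bA sM] bounded_ops_scaleR[OF bA] x Ax csubspace_scaleR[OF sM])
  have e: "cinner (A (A x)) x = complex_of_real ((norm (A x))\<^sup>2)"
    using selfadjoint_opD[OF sA Ax x] by (simp add: cinner_self)
  have "Re (cinner (A y) y) = Re (cinner (A x) x) - 2 / C * (norm (A x))\<^sup>2
      + (1 / C)\<^sup>2 * Re (cinner (A (A x)) (A x))"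
    unfolding Ay unfolding y_def
    by (simp add: cinner_diff_left cinner_diff_right e cinner_self algebra_simps power2_eq_square)
  moreover have "Re (cinner (A (A x)) (A x)) \<le> C * (norm (A x))\<^sup>2"
  proof -
    have "Re (cinner (A (A x)) (A x)) \<le> norm (A (A x)) * norm (A x)"
      using complex_Re_le_cmod cmod_cinner_le order_trans by blast
    also have "\<dots> \<le> C * norm (A x) * norm (A x)" using C(2)[OF Ax] by (simp add: mult_right_mono)
    finally show ?thesis by (simp add: power2_eq_square)
  qed
  ultimately have "0 \<le> Re (cinner (A x) x) - 2 / C * (norm (A x))\<^sup>2 + (1 / C)\<^sup>2 * (C * (norm (A x))\<^sup>2)"
    using positive_op_cinner_ge_0[OF A yM] mult_left_mono[of _ _ "(1 / C)\<^sup>2"]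
    by (smt (verit) zero_le_power2)
  also have "\<dots> = Re (cinner (A x) x) - (norm (A x))\<^sup>2 / C"
    using C(1) by (simp add: power2_eq_square field_simps)
  finally show ?thesis using C(1) by (simp add: field_simps)
qed

lemma positive_op_eq_0:
  assumes A: "positive_op M A" and sM: "csubspace M" and x: "x \<in> M" "Re (cinner (A x) x) = 0"
  shows "A x = 0"
proof -
  obtain C where "C > 0" "\<And>x. x \<in> M \<Longrightarrow> norm (A x) \<le> C * norm x"
    using bounded_ops_bound[OF positive_op_bounded[OF A]] by blast
  from positive_op_norm_square_le[OF A sM x(1) this] x(2) show ?thesis by simp
qed

text \<open>The hypothesis factors as \<open>(A + s) (A - s) x = 0\<close>, so
  \<open>w = A x - s x\<close> satisfies \<open>A w = - s w\<close>, and positivity forces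
  \<open>w = 0\<close> or \<open>s = 0\<close>. For \<open>s = 0\<close> the squared norm of
  \<open>A x\<close> is \<open>cinner (A (A x)) x = 0\<close>.\<close>

lemma positive_op_eigenvector_of_square:
  assumes A: "positive_op M A" and sM: "csubspace M" and x: "x \<in> M"
    and s: "s \<ge> 0" "A (A x) = (s\<^sup>2) *\<^sub>R x"
  shows "A x = s *\<^sub>R x"
proof -
  note bA = positive_op_bounded[OF A] and sA = positive_op_selfadjoint[OF A sM]
  have Ax: "A x \<in> M" using bA x bounded_ops_in by blast
  define w where "w = A x - s *\<^sub>R x"
  have wM: "w \<in> M" unfolding w_def by (intro csubspace_intros sM x Ax)
  have "A w = - s *\<^sub>R w"
    unfolding w_def by (simp add: bounded_ops_diff[OF bA sM] bounded_ops_scaleR[OF bA] x Ax s(2)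
        csubspace_scaleR[OF sM] power2_eq_square scaleR_diff_right)
  then have "Re (cinner (A w) w) = - s * (norm w)\<^sup>2" by (simp add: cinner_self)
  then have "s * (norm w)\<^sup>2 \<le> 0" using positive_op_cinner_ge_0[OF A wM] by simp
  then have "s = 0 \<or> w = 0" using s(1) by (auto simp: mult_le_0_iff)
  moreover have "A x = 0" if "s = 0"
  proof -
    have "complex_of_real ((norm (A x))\<^sup>2) = cinner (A (A x)) x"
      using selfadjoint_opD[OF sA Ax x] by (simp add: cinner_self)
    also have "\<dots> = 0" using s that by simp
    finally show ?thesis by simp
  qed
  ultimately show ?thesis by (auto simp: w_def)
qed

text \<open>Equality case of Cauchy-Schwarz: with \<open>s = norm (A x)\<close>, expanding the
  square gives \<open>\<parallel>A\<^sup>2 x - s\<^sup>2 x\<parallel>\<^sup>2 = \<parallel>A\<^sup>2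
  x\<parallel>\<^sup>2 - s\<^sup>4\<close>, and maximality at \<open>A x\<close> makes this at most
  zero. Invariance of \<open>N\<close> is what allows maximality to be applied to
  \<open>A x\<close>.\<close>

lemma positive_op_eigenvector_of_max:
  assumes A: "positive_op M A" and sM: "csubspace M" and N: "N \<subseteq> M" "A ` N \<subseteq> N"
    and x: "x \<in> N" "norm x = 1" "\<And>y. y \<in> N \<Longrightarrow> norm (A y) \<le> norm (A x) * norm y"
  shows "A x = norm (A x) *\<^sub>R x"
proof (rule positive_op_eigenvector_of_square[OF A sM])
  note sA = positive_op_selfadjoint[OF A sM]
  define s where "s = norm (A x)"
  have AxN: "A x \<in> N" and xM: "x \<in> M" and AxM: "A x \<in> M" using N x by auto
  have "norm (A (A x)) \<le> s\<^sup>2" using x(3)[OF AxN] by (simp add: s_def power2_eq_square)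
  then have 1: "(norm (A (A x)))\<^sup>2 \<le> (s\<^sup>2)\<^sup>2" by (intro power_mono) auto
  have "Re (cinner (A (A x)) x) = s\<^sup>2"
    using selfadjoint_opD[OF sA AxM xM] by (simp add: cinner_self s_def)
  then have "(norm (A (A x) - t *\<^sub>R x))\<^sup>2 = (norm (A (A x)))\<^sup>2 - 2 * t * s\<^sup>2 + t\<^sup>2" for t
    using x(2) by (simp add: norm_diff_square)
  from this[of "s\<^sup>2"] have "(norm (A (A x) - (s\<^sup>2) *\<^sub>R x))\<^sup>2 = (norm (A (A x)))\<^sup>2 - (s\<^sup>2)\<^sup>2"
    by (simp add: power2_eq_square)
  with 1 have "(norm (A (A x) - (s\<^sup>2) *\<^sub>R x))\<^sup>2 \<le> 0" by simp
  then show "A (A x) = (norm (A x))\<^sup>2 *\<^sub>R x" by (simp add: s_def)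
qed (use N x in auto)

section \<open>Square roots\<close>

text \<open>
  The square root of \<open>1 - B\<close> for \<open>0 \<le> B \<le> 1\<close> is \<open>1 - Y\<close> with \<open>Y\<close> the limit of the iteration
  \<open>Y\<^sub>n\<^sub>+\<^sub>1 = (B + Y\<^sub>n\<^sup>2) / 2\<close>.  The same iteration for \<open>B = 1\<close> is a scalar sequence that majorizes the
  norms of the operators and of their consecutive differences.
\<close>

primrec sqrt_iter :: "('a::real_vector \<Rightarrow> 'a) \<Rightarrow> nat \<Rightarrow> 'a \<Rightarrow> 'a" where
  "sqrt_iter B 0 x = 0"
| "sqrt_iter B (Suc n) x = (1/2) *\<^sub>R (B x + sqrt_iter B n (sqrt_iter B n x))"

primrec sqrt_majorant :: "nat \<Rightarrow> real" where
  "sqrt_majorant 0 = 0"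
| "sqrt_majorant (Suc n) = (1 + (sqrt_majorant n)\<^sup>2) / 2"

lemma sqrt_majorant_bounds: "0 \<le> sqrt_majorant n" "sqrt_majorant n \<le> 1"
proof (induction n)
  case (Suc n)
  {
    case 1
    then show ?case by simp
  next
    case 2
    have "(sqrt_majorant n)\<^sup>2 \<le> 1" using Suc by (simp add: power_le_one)
    then show ?case by simp
  }
qed auto

lemma sqrt_majorant_Suc_ge: "sqrt_majorant n \<le> sqrt_majorant (Suc n)"
  using zero_le_power2[of "1 - sqrt_majorant n"] by (simp add: power2_diff)

lemma convergent_sqrt_majorant: "convergent sqrt_majorant"
proof (rule Bseq_mono_convergent)
  show "Bseq sqrt_majorant"
    by (rule BseqI[of 1]) (use sqrt_majorant_bounds in auto)
  show "\<forall>m n. m \<le> n \<longrightarrow> sqrt_majorant m \<le> sqrt_majorant n"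
    using lift_Suc_mono_le[of sqrt_majorant, OF sqrt_majorant_Suc_ge] by blast
qed

context
  fixes M :: "'a::complex_hilbert_space set" and B :: "'a \<Rightarrow> 'a"
  assumes M: "closed_csubspace M" and B: "selfadjoint_op M B"
    and B1: "\<And>x. x \<in> M \<Longrightarrow> norm (B x) \<le> norm x"
begin

private lemma sM: "csubspace M"
  by (rule closed_csubspaceD[OF M])

private lemma bB: "B \<in> bounded_ops M M"
  by (rule selfadjoint_op_bounded[OF B])

private lemma sqrt_iter_props:
  "(\<forall>x\<in>M. sqrt_iter B n x \<in> M) \<and>
   (\<forall>x\<in>M. \<forall>y\<in>M. sqrt_iter B n (x + y) = sqrt_iter B n x + sqrt_iter B n y) \<and>
   (\<forall>a. \<forall>x\<in>M. sqrt_iter B n (a *\<^sub>C x) = a *\<^sub>C sqrt_iter B n x) \<and>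
   (\<forall>x\<in>M. norm (sqrt_iter B n x) \<le> sqrt_majorant n * norm x) \<and>
   (\<forall>x\<in>M. \<forall>y\<in>M. cinner (sqrt_iter B n x) y = cinner x (sqrt_iter B n y))"
proof (induction n)
  case 0
  then show ?case using complex_vector.subspace_0[OF sM] by auto
next
  case (Suc n)
  have "norm (sqrt_iter B (Suc n) x) \<le> sqrt_majorant (Suc n) * norm x" if x: "x \<in> M" for x
  proof -
    have "norm (sqrt_iter B n (sqrt_iter B n x)) \<le> sqrt_majorant n * (sqrt_majorant n * norm x)"
      using Suc x sqrt_majorant_bounds(1)[of n] by (meson mult_left_mono order_trans)
    then have "norm (B x + sqrt_iter B n (sqrt_iter B n x)) \<le> norm x + sqrt_majorant n * (sqrt_majorant n * norm x)"
      using B1[OF x] by (intro norm_triangle_le) simp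
    moreover have "norm (sqrt_iter B (Suc n) x) = norm (B x + sqrt_iter B n (sqrt_iter B n x)) / 2"
      by (simp only: sqrt_iter.simps norm_scaleR)
    ultimately show ?thesis by (simp add: power2_eq_square field_simps del: sqrt_iter.simps)
  qed
  moreover have "cinner (sqrt_iter B (Suc n) x) y = cinner x (sqrt_iter B (Suc n) y)" if "x \<in> M" "y \<in> M" for x y
    using Suc selfadjoint_opD[OF B that] that
    by (simp add: cinner_add_left cinner_add_right)
  ultimately show ?case
    using Suc bounded_ops_in[OF bB] bounded_ops_add[OF bB] bounded_ops_scaleC[OF bB]
    by (simp add: csubspace_intros sM scaleC_add_right scaleR_eq_scaleC scaleC_scaleC algebra_simps)
qed

lemmas sqrt_iter_in = sqrt_iter_props[THEN conjunct1, rule_format]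
lemmas sqrt_iter_add = sqrt_iter_props[THEN conjunct2, THEN conjunct1, rule_format]
lemmas sqrt_iter_scaleC = sqrt_iter_props[THEN conjunct2, THEN conjunct2, THEN conjunct1, rule_format]
lemmas sqrt_iter_norm = sqrt_iter_props[THEN conjunct2, THEN conjunct2, THEN conjunct2, THEN conjunct1, rule_format]
lemmas sqrt_iter_selfadjoint =
  sqrt_iter_props[THEN conjunct2, THEN conjunct2, THEN conjunct2, THEN conjunct2, rule_format]

lemma sqrt_iter_bounded: "sqrt_iter B n \<in> bounded_ops M M"
  by (rule bounded_opsI[where C = "sqrt_majorant n"]) (auto simp: sqrt_iter_in sqrt_iter_add sqrt_iter_scaleC sqrt_iter_norm)

text \<open>The iterates are polynomials in \<open>B\<close>, so they inherit its commutation
  relations; in the limit this becomes the key to uniqueness of the square root.\<close>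

lemma sqrt_iter_commute:
  assumes C: "C \<in> bounded_ops M M" and CB: "\<And>x. x \<in> M \<Longrightarrow> C (B x) = B (C x)" and x: "x \<in> M"
  shows "C (sqrt_iter B n x) = sqrt_iter B n (C x)"
  using x
proof (induction n arbitrary: x)
  case 0
  then show ?case by (simp add: bounded_ops_0[OF C sM])
next
  case (Suc n)
  then show ?case
    by (simp add: bounded_ops_scaleR[OF C] bounded_ops_add[OF C] CB sqrt_iter_in bounded_ops_in[OF bB]
        csubspace_intros[OF sM] bounded_ops_in[OF C])
qed

lemma sqrt_iter_commute_iter:
  assumes x: "x \<in> M"
  shows "sqrt_iter B m (sqrt_iter B n x) = sqrt_iter B n (sqrt_iter B m x)"
  by (rule sqrt_iter_commute[OF sqrt_iter_bounded _ x])
     (simp add: sqrt_iter_commute[OF bB])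

text \<open>Because the iterates commute, a difference of squares factors as sum times difference.
  The same factorization for the scalar majorant closes the induction.\<close>

lemma sqrt_iter_step:
  "x \<in> M \<Longrightarrow> norm (sqrt_iter B (Suc n) x - sqrt_iter B n x) \<le> (sqrt_majorant (Suc n) - sqrt_majorant n) * norm x"
proof (induction n arbitrary: x)
  case 0
  then show ?case using B1[of x] by (simp add: bounded_ops_0[OF sqrt_iter_bounded sM])
next
  case (Suc n)
  let ?Y = "sqrt_iter B" and ?y = sqrt_majorant
  have x: "x \<in> M" by fact
  define d where "d = ?Y (Suc n) x - ?Y n x"
  have dM: "d \<in> M" unfolding d_def by (intro csubspace_intros sM sqrt_iter_in x)
  define a where "a = ?Y (Suc n) (?Y (Suc n) x)"
  define b where "b = ?Y n (?Y n x)"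
  have ab: "?Y (Suc n) d + ?Y n d = a - b"
    unfolding d_def a_def b_def
    by (simp add: bounded_ops_diff[OF sqrt_iter_bounded sM] sqrt_iter_in x
        sqrt_iter_commute_iter[OF x, of n "Suc n"] del: sqrt_iter.simps)
  have "?Y (Suc (Suc n)) x = (1/2) *\<^sub>R (B x + a)" "?Y (Suc n) x = (1/2) *\<^sub>R (B x + b)"
    unfolding a_def b_def by (rule sqrt_iter.simps(2))+
  then have "?Y (Suc (Suc n)) x - ?Y (Suc n) x = (1/2) *\<^sub>R (?Y (Suc n) d + ?Y n d)"
    unfolding ab by (simp add: scaleR_add_right scaleR_diff_right del: sqrt_iter.simps)
  also have "norm \<dots> \<le> (1/2) * (?y (Suc n) * norm d + ?y n * norm d)"
    using norm_triangle_mono[OF sqrt_iter_norm[OF dM, of "Suc n"] sqrt_iter_norm[OF dM, of n]]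
    by (simp del: sqrt_iter.simps sqrt_majorant.simps)
  also have "\<dots> = (1/2) * (?y (Suc n) + ?y n) * norm d" by (simp add: algebra_simps)
  also have "\<dots> \<le> (1/2) * (?y (Suc n) + ?y n) * ((?y (Suc n) - ?y n) * norm x)"
    using Suc.IH[OF x] sqrt_majorant_bounds(1)[of n] sqrt_majorant_bounds(1)[of "Suc n"]
    unfolding d_def by (intro mult_left_mono) auto
  also have "\<dots> = (?y (Suc (Suc n)) - ?y (Suc n)) * norm x"
  proof -
    have "(1/2) * (b + a) * (b - a) = (1 + b\<^sup>2) / 2 - (1 + a\<^sup>2) / 2" for a b :: real
      by (simp add: power2_eq_square algebra_simps diff_divide_distrib add_divide_distrib)
    from this[of "?y (Suc n)" "?y n"] show ?thesis by (metis mult.assoc sqrt_majorant.simps(2))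
  qed
  finally show ?case .
qed

lemma sqrt_iter_diff:
  assumes x: "x \<in> M" and "m \<le> n"
  shows "norm (sqrt_iter B n x - sqrt_iter B m x) \<le> (sqrt_majorant n - sqrt_majorant m) * norm x"
  using assms(2)
proof (induction n rule: dec_induct)
  case (step n)
  have "norm (sqrt_iter B (Suc n) x - sqrt_iter B m x) \<le>
      norm (sqrt_iter B (Suc n) x - sqrt_iter B n x) + norm (sqrt_iter B n x - sqrt_iter B m x)"
    by (metis diff_add_cancel add_diff_eq norm_triangle_ineq)
  also have "\<dots> \<le> (sqrt_majorant (Suc n) - sqrt_majorant n) * norm x + (sqrt_majorant n - sqrt_majorant m) * norm x"
    using sqrt_iter_step[OF x, of n] step.IH by linarith
  finally show ?case by (simp add: left_diff_distrib)
qed simp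

lemma sqrt_iter_Cauchy: assumes x: "x \<in> M" shows "Cauchy (\<lambda>n. sqrt_iter B n x)"
proof (cases "x = 0")
  case True
  then show ?thesis using bounded_ops_0[OF sqrt_iter_bounded sM] by (simp add: Cauchy_def)
next
  case False
  show ?thesis
  proof (rule CauchyI')
    fix e :: real assume e: "e > 0"
    have "Cauchy sqrt_majorant" using convergent_sqrt_majorant by (simp add: Cauchy_convergent_iff)
    then obtain N where N: "\<forall>m\<ge>N. \<forall>n\<ge>N. norm (sqrt_majorant m - sqrt_majorant n) < e / norm x"
      using False e by (metis CauchyD divide_pos_pos zero_less_norm_iff)
    show "\<exists>N. \<forall>m\<ge>N. \<forall>n>m. dist (sqrt_iter B m x) (sqrt_iter B n x) < e"
    proof (intro exI[of _ N] allI impI)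
      fix m n assume mn: "m \<ge> N" "n > m"
      have "dist (sqrt_iter B m x) (sqrt_iter B n x) \<le> (sqrt_majorant n - sqrt_majorant m) * norm x"
        using sqrt_iter_diff[OF x, of m n] mn by (simp add: dist_norm norm_minus_commute)
      also have "\<dots> < e"
      proof -
        have "sqrt_majorant n - sqrt_majorant m < e / norm x"
          using N[rule_format, of n m] mn by auto
        then show ?thesis using False by (simp add: field_simps)
      qed
      finally show "dist (sqrt_iter B m x) (sqrt_iter B n x) < e" .
    qed
  qed
qed

definition "sqrt_iter_lim x = lim (\<lambda>n. sqrt_iter B n x)"

lemma sqrt_iter_tendsto: "x \<in> M \<Longrightarrow> (\<lambda>n. sqrt_iter B n x) \<longlonglongrightarrow> sqrt_iter_lim x"
  using sqrt_iter_Cauchy[of x] unfolding sqrt_iter_lim_def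
  by (simp add: Cauchy_convergent_iff convergent_LIMSEQ_iff)

lemma sqrt_iter_lim_in: "x \<in> M \<Longrightarrow> sqrt_iter_lim x \<in> M"
  by (rule closed_sequentially[OF closed_csubspaceD(2)[OF M] _ sqrt_iter_tendsto]) (auto intro: sqrt_iter_in)

lemma sqrt_iter_lim_norm: "x \<in> M \<Longrightarrow> norm (sqrt_iter_lim x) \<le> norm x"
proof (rule LIMSEQ_le_const2[OF tendsto_norm[OF sqrt_iter_tendsto]])
  assume x: "x \<in> M"
  show "\<exists>N. \<forall>n\<ge>N. norm (sqrt_iter B n x) \<le> norm x"
  proof (intro exI allI impI)
    fix n
    have "norm (sqrt_iter B n x) \<le> sqrt_majorant n * norm x" by (rule sqrt_iter_norm[OF x])
    also have "\<dots> \<le> norm x" using sqrt_majorant_bounds[of n] by (simp add: mult_left_le_one_le)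
    finally show "norm (sqrt_iter B n x) \<le> norm x" .
  qed
qed

lemma sqrt_iter_lim_bounded: "sqrt_iter_lim \<in> bounded_ops M M"
proof (rule bounded_opsI[where C = 1])
  fix x y assume xy: "x \<in> M" "y \<in> M"
  have "(\<lambda>n. sqrt_iter B n (x + y)) \<longlonglongrightarrow> sqrt_iter_lim x + sqrt_iter_lim y"
    using xy by (auto simp: sqrt_iter_add intro!: tendsto_intros sqrt_iter_tendsto)
  then show "sqrt_iter_lim (x + y) = sqrt_iter_lim x + sqrt_iter_lim y"
    using xy sqrt_iter_tendsto[of "x + y"] by (metis LIMSEQ_unique complex_vector.subspace_add sM)
next
  fix x a assume x: "x \<in> M"
  have "(\<lambda>n. sqrt_iter B n (a *\<^sub>C x)) \<longlonglongrightarrow> a *\<^sub>C sqrt_iter_lim x"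
    using x by (auto simp: sqrt_iter_scaleC intro!: tendsto_scaleC sqrt_iter_tendsto)
  then show "sqrt_iter_lim (a *\<^sub>C x) = a *\<^sub>C sqrt_iter_lim x"
    using x sqrt_iter_tendsto[of "a *\<^sub>C x"] by (metis LIMSEQ_unique complex_vector.subspace_scale sM)
qed (auto simp: sqrt_iter_lim_in sqrt_iter_lim_norm)

lemma sqrt_iter_lim_selfadjoint: "selfadjoint_op M sqrt_iter_lim"
  unfolding selfadjoint_op_def
proof (intro conjI ballI sqrt_iter_lim_bounded)
  fix x y assume xy: "x \<in> M" "y \<in> M"
  have "(\<lambda>n. cinner (sqrt_iter B n x) y) \<longlonglongrightarrow> cinner (sqrt_iter_lim x) y"
    by (intro tendsto_cinner_left sqrt_iter_tendsto xy)
  moreover have "(\<lambda>n. cinner x (sqrt_iter B n y)) \<longlonglongrightarrow> cinner x (sqrt_iter_lim y)"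
    by (intro bounded_linear.tendsto[OF bounded_linear_cinner_right] sqrt_iter_tendsto xy)
  ultimately show "cinner (sqrt_iter_lim x) y = cinner x (sqrt_iter_lim y)"
    using xy by (simp add: sqrt_iter_selfadjoint LIMSEQ_unique)
qed

lemma sqrt_iter_lim_square:
  assumes x: "x \<in> M"
  shows "sqrt_iter_lim (sqrt_iter_lim x) = 2 *\<^sub>R sqrt_iter_lim x - B x"
proof -
  let ?Y = "sqrt_iter B" and ?L = sqrt_iter_lim
  have LM: "?L x \<in> M" by (rule sqrt_iter_lim_in[OF x])
  \<comment> \<open>Operator and argument both vary with \<open>n\<close>. The iterates are
    contractions, so replacing the inner iterate by its limit costs a null sequence, and only
    \<open>?Y n (?L x)\<close> remains.\<close>
  have "(\<lambda>n. ?Y n (?Y n x - ?L x)) \<longlonglongrightarrow> 0"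
  proof (rule Lim_null_comparison)
    have "norm (?Y n (?Y n x - ?L x)) \<le> norm (?Y n x - ?L x)" for n
      using sqrt_iter_norm[of "?Y n x - ?L x" n] sqrt_majorant_bounds[of n]
        complex_vector.subspace_diff[OF sM sqrt_iter_in[OF x, of n] LM]
      by (meson mult_left_le_one_le norm_ge_zero order_trans)
    then show "\<forall>\<^sub>F n in sequentially. norm (?Y n (?Y n x - ?L x)) \<le> norm (?Y n x - ?L x)" by simp
    show "(\<lambda>n. norm (?Y n x - ?L x)) \<longlonglongrightarrow> 0"
      using sqrt_iter_tendsto[OF x] by (simp add: LIM_zero_iff tendsto_norm_zero)
  qed
  from tendsto_add[OF this sqrt_iter_tendsto[OF LM]]
  have "(\<lambda>n. ?Y n (?Y n x)) \<longlonglongrightarrow> ?L (?L x)"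
    by (simp add: bounded_ops_diff[OF sqrt_iter_bounded sM] sqrt_iter_in x LM)
  then have "(\<lambda>n. ?Y (Suc n) x) \<longlonglongrightarrow> (1/2) *\<^sub>R (B x + ?L (?L x))"
    by (auto intro!: tendsto_intros)
  moreover have "(\<lambda>n. ?Y (Suc n) x) \<longlonglongrightarrow> ?L x" by (rule LIMSEQ_Suc[OF sqrt_iter_tendsto[OF x]])
  ultimately have "?L x = (1/2) *\<^sub>R (B x + ?L (?L x))" by (rule LIMSEQ_unique[rotated])
  then have "2 *\<^sub>R ?L x = 2 *\<^sub>R ((1/2) *\<^sub>R (B x + ?L (?L x)))" by (rule arg_cong)
  also have "\<dots> = B x + ?L (?L x)" by simp
  finally show ?thesis by (simp add: algebra_simps)
qed

lemma sqrt_iter_lim_commute: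
  assumes C: "C \<in> bounded_ops M M" and CB: "\<And>x. x \<in> M \<Longrightarrow> C (B x) = B (C x)" and x: "x \<in> M"
  shows "C (sqrt_iter_lim x) = sqrt_iter_lim (C x)"
proof -
  have "(\<lambda>n. C (sqrt_iter B n x)) \<longlonglongrightarrow> C (sqrt_iter_lim x)"
    by (rule bounded_ops_tendsto[OF C sM]) (auto simp: x sqrt_iter_in sqrt_iter_lim_in sqrt_iter_tendsto)
  then show ?thesis
    using sqrt_iter_tendsto[OF bounded_ops_in[OF C x]]
    by (simp add: sqrt_iter_commute[OF C CB x] LIMSEQ_unique)
qed

end

text \<open>After scaling by a norm bound \<open>c\<close>, \<open>B = 1 - A / c\<close> is a
  contraction; its limit \<open>L\<close> solves \<open>L\<^sup>2 = 2 L - B\<close>, hence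
  \<open>(1 - L)\<^sup>2 = 1 - B = A / c\<close> and \<open>R = sqrt c (1 - L)\<close>. The
  commutation clause is carried along for the uniqueness proof.\<close>

lemma positive_sqrt_exists:
  assumes M: "closed_csubspace M" and A: "positive_op M A"
  shows "\<exists>R. positive_op M R \<and> (\<forall>x\<in>M. R (R x) = A x) \<and>
    (\<forall>S\<in>bounded_ops M M. (\<forall>x\<in>M. S (A x) = A (S x)) \<longrightarrow> (\<forall>x\<in>M. S (R x) = R (S x)))"
proof -
  note sM = closed_csubspaceD(1)[OF M] and bA = positive_op_bounded[OF A]
  note sA = positive_op_selfadjoint[OF A sM]
  obtain c where c: "c > 0" "\<And>x. x \<in> M \<Longrightarrow> norm (A x) \<le> c * norm x"
    using bounded_ops_bound[OF bA] by blast
  define B where "B x = x - (1 / c) *\<^sub>R A x" for x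
  have B1: "norm (B x) \<le> norm x" if x: "x \<in> M" for x
  proof -
    have "(norm (B x))\<^sup>2 = (norm x)\<^sup>2 - 2 / c * Re (cinner (A x) x) + (1 / c)\<^sup>2 * (norm (A x))\<^sup>2"
      using c(1) selfadjoint_opD[OF sA x x] unfolding B_def
      by (simp add: norm_diff_square power_mult_distrib power_divide)
    also have "\<dots> \<le> (norm x)\<^sup>2 - 2 / c * Re (cinner (A x) x) + (1 / c)\<^sup>2 * (c * Re (cinner (A x) x))"
      using positive_op_norm_square_le[OF A sM x c] by (intro add_left_mono mult_left_mono) auto
    also have "\<dots> = (norm x)\<^sup>2 - 1 / c * Re (cinner (A x) x)"
      using c(1) by (simp add: power2_eq_square field_simps)
    also have "\<dots> \<le> (norm x)\<^sup>2" using positive_op_cinner_ge_0[OF A x] c(1) by simp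
    finally show ?thesis by (rule power2_le_imp_le) simp
  qed
  have sB: "selfadjoint_op M B"
    unfolding B_def by (intro selfadjoint_op_diff selfadjoint_op_id selfadjoint_op_scale sA sM)
  define L where "L = sqrt_iter_lim B"
  have L_in: "L x \<in> M" and L_norm: "norm (L x) \<le> norm x" if "x \<in> M" for x
    using sqrt_iter_lim_in[OF M sB B1 that] sqrt_iter_lim_norm[OF M sB B1 that] by (simp_all add: L_def)
  note bL = sqrt_iter_lim_bounded[OF M sB B1, folded L_def]
    and sL = sqrt_iter_lim_selfadjoint[OF M sB B1, folded L_def]
  have L_sq: "L (L x) = 2 *\<^sub>R L x - B x" if "x \<in> M" for x
    using sqrt_iter_lim_square[OF M sB B1 that] by (simp add: L_def)
  have L_comm: "S (L x) = L (S x)"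
    if "S \<in> bounded_ops M M" "\<And>x. x \<in> M \<Longrightarrow> S (B x) = B (S x)" "x \<in> M" for S x
    using sqrt_iter_lim_commute[OF M sB B1 that] by (simp add: L_def)
  define R where "R x = sqrt c *\<^sub>R (x - L x)" for x
  have sR: "selfadjoint_op M R"
    unfolding R_def by (intro selfadjoint_op_diff selfadjoint_op_id selfadjoint_op_scale sL sM)
  have "0 \<le> Re (cinner (R x) x)" if x: "x \<in> M" for x
  proof -
    have "Re (cinner (L x) x) \<le> norm (L x) * norm x"
      using complex_Re_le_cmod cmod_cinner_le order_trans by blast
    also have "\<dots> \<le> norm x * norm x" using L_norm[OF x] by (simp add: mult_right_mono)
    finally show ?thesis using c(1) by (simp add: R_def cinner_diff_left cinner_self power2_eq_square)
  qed
  with sR have "positive_op M R" by (intro positive_opI)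
  moreover have "R (R x) = A x" if x: "x \<in> M" for x
  proof -
    have "L (R x) = sqrt c *\<^sub>R (L x - L (L x))"
      using x by (simp add: R_def bounded_ops_scaleR[OF bL] bounded_ops_diff[OF bL sM] L_in csubspace_intros sM)
    then have "R (R x) = (sqrt c * sqrt c) *\<^sub>R (x - L x - (L x - L (L x)))"
      by (simp add: R_def scaleR_diff_right)
    also have "x - L x - (L x - L (L x)) = (1 / c) *\<^sub>R A x"
      by (simp add: L_sq[OF x] B_def scaleR_2)
    finally show ?thesis using c(1) by simp
  qed
  moreover have "S (R x) = R (S x)"
    if S: "S \<in> bounded_ops M M" and SA: "\<And>x. x \<in> M \<Longrightarrow> S (A x) = A (S x)" and x: "x \<in> M" for S x
  proof -
    have "S (B x) = B (S x)" if "x \<in> M" for x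
      using that by (simp add: B_def bounded_ops_diff[OF S sM] bounded_ops_scaleR[OF S] SA
          csubspace_intros sM bounded_ops_in[OF bA])
    from L_comm[OF S this x] show ?thesis
      using x by (simp add: R_def bounded_ops_diff[OF S sM] bounded_ops_scaleR[OF S] csubspace_intros sM L_in)
  qed
  ultimately show ?thesis by blast
qed

text \<open>For \<open>y = S x - R x\<close>, commutation gives
  \<open>(S + R) y = S\<^sup>2 x - R\<^sup>2 x = 0\<close>, so both nonnegative forms vanish at
  \<open>y\<close> and \<open>S y = R y = 0\<close>. Then
  \<open>cinner y y = cinner ((S - R) y) x = 0\<close>.\<close>

lemma positive_sqrt_unique:
  assumes sM: "csubspace M" and R: "positive_op M R" and S: "positive_op M S"
    and sq: "\<And>x. x \<in> M \<Longrightarrow> S (S x) = R (R x)" and comm: "\<And>x. x \<in> M \<Longrightarrow> S (R x) = R (S x)"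
    and x: "x \<in> M"
  shows "S x = R x"
proof -
  note bR = positive_op_bounded[OF R] and bS = positive_op_bounded[OF S]
  note selfR = positive_op_selfadjoint[OF R sM] and selfS = positive_op_selfadjoint[OF S sM]
  have RxM: "R x \<in> M" and SxM: "S x \<in> M" using x bR bS bounded_ops_in by blast+
  define y where "y = S x - R x"
  have yM: "y \<in> M" unfolding y_def by (intro csubspace_intros sM RxM SxM)
  have "S y + R y = 0"
    unfolding y_def using x RxM SxM
    by (simp add: bounded_ops_diff[OF bR sM] bounded_ops_diff[OF bS sM] sq comm)
  then have "Re (cinner (S y) y) + Re (cinner (R y) y) = 0"
    by (metis cinner_add_left cinner_zero_left plus_complex.simps(1) zero_complex.simps(1))
  then have "Re (cinner (S y) y) = 0" "Re (cinner (R y) y) = 0"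
    using positive_op_cinner_ge_0[OF R yM] positive_op_cinner_ge_0[OF S yM] by linarith+
  then have "S y = 0" "R y = 0" using positive_op_eq_0 R S sM yM by blast+
  then have "cinner y y = 0"
    using selfadjoint_opD[OF selfS yM x] selfadjoint_opD[OF selfR yM x]
    by (subst (2) y_def) (simp add: cinner_diff_right)
  then show ?thesis by (simp add: y_def)
qed

lemma sqrt_op_props:
  assumes M: "closed_csubspace M" and A: "positive_op M A"
  shows "positive_op M (sqrt_op M A) \<and> (\<forall>x\<in>M. sqrt_op M A (sqrt_op M A x) = A x)"
proof -
  note sM = closed_csubspaceD(1)[OF M]
  obtain R where R: "positive_op M R" "\<And>x. x \<in> M \<Longrightarrow> R (R x) = A x"
    "\<And>S x. S \<in> bounded_ops M M \<Longrightarrow> \<forall>x\<in>M. S (A x) = A (S x) \<Longrightarrow> x \<in> M \<Longrightarrow> S (R x) = R (S x)"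
    using positive_sqrt_exists[OF M A] by blast
  \<comment> \<open>The definite description in \<open>sqrt_op\<close> asks for an extensional
    function, so the values outside \<open>M\<close> are normalized.\<close>
  define R' where "R' = restrict R M"
  have R'in: "R x \<in> M" if "x \<in> M" for x using R(1) that positive_op_bounded bounded_ops_in by blast
  have posR': "positive_op M R'"
    using R(1) sM unfolding positive_op_def R'_def bounded_ops_def
    by (auto simp: complex_vector.subspace_add complex_vector.subspace_scale)
  have sqR': "R' (R' x) = A x" if "x \<in> M" for x using that R(2) R'in by (simp add: R'_def)
  have "sqrt_op M A = R'"
    unfolding sqrt_op_def
  proof (rule the_equality)
    fix S assume S: "S \<in> extensional M \<and> positive_op M S \<and> (\<forall>x\<in>M. S (S x) = A x)"
    then have S1: "S \<in> extensional M" and S2: "positive_op M S" and S3: "\<And>x. x \<in> M \<Longrightarrow> S (S x) = A x"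
      by blast+
    note bS = positive_op_bounded[OF S2]
    \<comment> \<open>Any competing root commutes with its own square \<open>A\<close>, hence with
      \<open>R\<close> by the commutation clause.\<close>
    have "\<forall>x\<in>M. S (A x) = A (S x)"
      by (simp flip: S3 add: bounded_ops_in[OF bS])
    note comm = R(3)[OF bS this]
    have "S x = R x" if "x \<in> M" for x
      by (rule positive_sqrt_unique[OF sM R(1) S2 _ comm that]) (simp add: S3 R(2))
    then show "S = R'"
      by (intro extensionalityI[OF S1, of R']) (simp_all add: R'_def)
  qed (use posR' sqR' in \<open>auto simp: R'_def\<close>)
  then show ?thesis using posR' sqR' by simp
qed

section \<open>The absolute value of a restricted self-adjoint operator\<close>

lemma adj_op_selfadjoint:
  assumes P: "selfadjoint_op UNIV P" and M: "closed_csubspace M"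
  shows "adj_op M P y = orth_proj M (P y)"
  unfolding adj_op_def
proof (rule the_equality)
  show "orth_proj M (P y) \<in> M \<and> (\<forall>x\<in>M. cinner (P x) y = cinner x (orth_proj M (P y)))"
    using M by (simp add: orth_proj_in cinner_orth_proj_right selfadjoint_opD[OF P])
  fix z assume "z \<in> M \<and> (\<forall>x\<in>M. cinner (P x) y = cinner x z)"
  then show "z = orth_proj M (P y)"
    using closed_csubspaceD(1)[OF M]
    by (intro orth_proj_eqI[symmetric])
       (auto simp: cinner_diff_left selfadjoint_opD[OF P] cinner_commute[of _ z] cinner_commute[of "P y"])
qed

text \<open>For non-invariant \<open>M\<close> only the square of the absolute value is explicit: it
  is the compression of \<open>P\<^sup>2\<close>. The equality of norms is the bridge over which
  attainment passes between \<open>P\<close> and the operator that defines the s-numbers.\<close>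

lemma abs_op_props:
  assumes P: "selfadjoint_op UNIV P" and M: "closed_csubspace M"
  shows "positive_op M (abs_op M P)"
    and "x \<in> M \<Longrightarrow> abs_op M P (abs_op M P x) = orth_proj M (P (P x))"
    and "x \<in> M \<Longrightarrow> norm (abs_op M P x) = norm (P x)"
proof -
  note sM = closed_csubspaceD(1)[OF M] and bP = selfadjoint_op_bounded[OF P]
  define A where "A x = orth_proj M (P (P x))" for x
  have A: "cinner (A x) y = cinner (P x) (P y)" if "y \<in> M" for x y
    using that M by (simp add: A_def cinner_orth_proj selfadjoint_opD[OF P])
  have "positive_op M A"
  proof (rule positive_opI)
    obtain C where C: "C > 0" "\<And>x. norm (P x) \<le> C * norm x"
      using bounded_ops_bound[OF bP] by auto
    have "norm (A x) \<le> (C * C) * norm x" for x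
    proof -
      have "norm (A x) \<le> norm (P (P x))" unfolding A_def by (rule norm_orth_proj_le[OF M])
      also have "\<dots> \<le> C * (C * norm x)" using C by (meson mult_left_mono less_imp_le order_trans)
      finally show ?thesis by simp
    qed
    then show "selfadjoint_op M A"
      unfolding selfadjoint_op_def
      by (intro conjI bounded_opsI[where C = "C * C"])
         (auto simp: A_def orth_proj_in M orth_proj_add orth_proj_scaleC bounded_ops_add[OF bP]
           bounded_ops_scaleC[OF bP] cinner_orth_proj cinner_orth_proj_right selfadjoint_opD[OF P])
    show "0 \<le> Re (cinner (A x) x)" if "x \<in> M" for x
      using A[OF that, of x] by (simp add: cinner_self)
  qed
  moreover have "abs_op M P = sqrt_op M A"
    unfolding abs_op_def A_def by (simp add: adj_op_selfadjoint[OF P M])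
  ultimately have S: "positive_op M (abs_op M P)" "\<And>x. x \<in> M \<Longrightarrow> abs_op M P (abs_op M P x) = A x"
    using sqrt_op_props[OF M] by auto
  then show "positive_op M (abs_op M P)" "x \<in> M \<Longrightarrow> abs_op M P (abs_op M P x) = orth_proj M (P (P x))"
    by (auto simp: A_def)
  assume x: "x \<in> M"
  have "complex_of_real ((norm (abs_op M P x))\<^sup>2) = cinner (A x) x"
    using selfadjoint_opD[OF positive_op_selfadjoint[OF S(1) sM] bounded_ops_in[OF positive_op_bounded[OF S(1)] x] x] S(2)[OF x]
    by (simp add: cinner_self)
  also have "\<dots> = complex_of_real ((norm (P x))\<^sup>2)" by (simp add: A[OF x] cinner_self)
  finally show "norm (abs_op M P x) = norm (P x)"
    by (simp only: of_real_eq_iff) (simp add: power2_eq_iff_nonneg)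
qed

section \<open>Spectrum\<close>

text \<open>A bounded left inverse of \<open>A - z\<close> with bound \<open>C\<close> would keep
  \<open>norm (A x - z *\<^sub>C x)\<close> above \<open>1 / C\<close> on unit vectors.\<close>

lemma spectrum_if_approx_eigenvalue:
  assumes "\<And>\<delta>. \<delta> > 0 \<Longrightarrow> \<exists>x\<in>M. norm x = 1 \<and> norm (A x - z *\<^sub>C x) < \<delta>"
    and A: "A \<in> bounded_ops M M" and sM: "csubspace M"
  shows "z \<in> spectrum M A"
proof (rule ccontr)
  assume "z \<notin> spectrum M A"
  then obtain B where B: "B \<in> bounded_ops M M" "\<And>x. x \<in> M \<Longrightarrow> B (A x - z *\<^sub>C x) = x"
    by (auto simp: spectrum_def)
  obtain C where C: "C > 0" "\<And>x. x \<in> M \<Longrightarrow> norm (B x) \<le> C * norm x"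
    using bounded_ops_bound[OF B(1)] by blast
  obtain x where x: "x \<in> M" "norm x = 1" "norm (A x - z *\<^sub>C x) < 1 / C"
    using assms(1)[of "1 / C"] C(1) by auto
  have "A x - z *\<^sub>C x \<in> M" by (intro csubspace_intros sM x bounded_ops_in[OF A])
  from C(2)[OF this] have "1 \<le> C * norm (A x - z *\<^sub>C x)" by (simp add: B(2) x)
  also have "\<dots> < C * (1 / C)" using x(3) C(1) by (rule mult_strict_left_mono)
  finally show False using C(1) by simp
qed

lemma eigenvalue_in_spectrum:
  assumes "A \<in> bounded_ops M M" "csubspace M" "x \<in> M" "norm x = 1" "A x = z *\<^sub>C x"
  shows "z \<in> spectrum M A"
  by (rule spectrum_if_approx_eigenvalue[OF _ assms(1,2)]) (use assms in auto)

text \<open>The lower bound makes \<open>A - z\<close> injective with closed range. A vector of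
  \<open>M\<close> orthogonal to that range is annihilated by \<open>A - cnj z\<close>, and since
  \<open>cinner (A x) x\<close> is real, \<open>A - z\<close> and \<open>A - cnj z\<close> have
  equal norms at each vector; so the range is all of \<open>M\<close> and the inverse has bound
  \<open>1 / \<delta>\<close>.\<close>

lemma not_spectrum_if_bounded_below:
  assumes A: "selfadjoint_op M A" and M: "closed_csubspace M"
    and d: "\<delta> > 0" "\<And>x. x \<in> M \<Longrightarrow> \<delta> * norm x \<le> norm (A x - z *\<^sub>C x)"
  shows "z \<notin> spectrum M A"
proof -
  note sM = closed_csubspaceD(1)[OF M] and bA = selfadjoint_op_bounded[OF A]
  define D where "D w x = A x - w *\<^sub>C x" for w x
  have DM: "D w x \<in> M" if "x \<in> M" for w x
    unfolding D_def by (intro csubspace_intros sM that bounded_ops_in[OF bA])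
  have D_add: "D w (x + y) = D w x + D w y" if "x \<in> M" "y \<in> M" for w x y
    using that by (simp add: D_def bounded_ops_add[OF bA] scaleC_add_right)
  have D_diff: "D w (x - y) = D w x - D w y" if "x \<in> M" "y \<in> M" for w x y
    using that by (simp add: D_def bounded_ops_diff[OF bA sM] complex_vector.scale_right_diff_distrib)
  have D_scale: "D w (a *\<^sub>C x) = a *\<^sub>C D w x" if "x \<in> M" for w a x
    using that by (simp add: D_def bounded_ops_scaleC[OF bA] complex_vector.scale_right_diff_distrib
        scaleC_scaleC mult.commute)
  have norm_D: "norm (D z x) = norm (D (cnj z) x)" if "x \<in> M" for x
  proof -
    have "Re (w * cinner (A x) x) = Re w * Re (cinner (A x) x)" for w
      by (subst selfadjoint_op_cinner_real[OF A that]) simp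
    then have "(norm (D w x))\<^sup>2 = (norm (A x))\<^sup>2 - 2 * (Re w * Re (cinner (A x) x)) + (cmod w * norm x)\<^sup>2" for w
      by (simp add: D_def norm_diff_square cinner_scaleC_right)
    then have "(norm (D z x))\<^sup>2 = (norm (D (cnj z) x))\<^sup>2" by simp
    then show ?thesis by simp
  qed
  have below: "\<delta> * norm x \<le> norm (D z x)" if "x \<in> M" for x
    using d(2)[OF that] by (simp add: D_def)
  define R where "R = D z ` M"
  have sR: "csubspace R"
    unfolding complex_vector.subspace_def
  proof (intro conjI ballI allI)
    have "D z 0 = 0" by (simp add: D_def bounded_ops_0[OF bA sM])
    then show "0 \<in> R" unfolding R_def using complex_vector.subspace_0[OF sM] by force
    fix x y c assume "x \<in> R" "y \<in> R"
    then obtain u v where uv: "u \<in> M" "x = D z u" "v \<in> M" "y = D z v" by (auto simp: R_def)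
    show "x + y \<in> R"
      using uv by (auto simp: R_def D_add[symmetric] intro!: imageI complex_vector.subspace_add sM)
    show "c *\<^sub>C x \<in> R"
      using uv by (auto simp: R_def D_scale[symmetric] intro!: imageI complex_vector.subspace_scale sM)
  qed
  have "closed R"
    unfolding closed_sequential_limits
  proof (intro allI impI, elim conjE)
    fix y l assume y: "\<forall>n. y n \<in> R" "y \<longlonglongrightarrow> l"
    then have "\<forall>n. \<exists>x. x \<in> M \<and> y n = D z x" by (auto simp: R_def)
    then obtain x where x: "\<And>n. x n \<in> M" "\<And>n. y n = D z (x n)" by metis
    have "Cauchy x"
    proof (rule CauchyI)
      fix e :: real assume "e > 0"
      then obtain N where N: "\<forall>m\<ge>N. \<forall>n\<ge>N. norm (y m - y n) < \<delta> * e"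
        using LIMSEQ_imp_Cauchy[OF y(2)] d(1) by (meson CauchyD mult_pos_pos)
      show "\<exists>N. \<forall>m\<ge>N. \<forall>n\<ge>N. norm (x m - x n) < e"
      proof (intro exI[of _ N] allI impI)
        fix m n assume "m \<ge> N" "n \<ge> N"
        then have "norm (y m - y n) < \<delta> * e" using N by blast
        moreover have "\<delta> * norm (x m - x n) \<le> norm (y m - y n)"
          using below[OF complex_vector.subspace_diff[OF sM x(1)[of m] x(1)[of n]]] by (simp add: x D_diff)
        ultimately have "\<delta> * norm (x m - x n) < \<delta> * e" by linarith
        then show "norm (x m - x n) < e" using d(1) by simp
      qed
    qed
    then obtain p where p: "x \<longlonglongrightarrow> p" using Cauchy_convergent_iff convergent_def by blast
    have pM: "p \<in> M" by (rule closed_sequentially[OF closed_csubspaceD(2)[OF M] _ p]) (rule x)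
    have "(\<lambda>n. D z (x n)) \<longlonglongrightarrow> D z p"
      unfolding D_def by (intro tendsto_diff tendsto_scaleC p bounded_ops_tendsto[OF bA sM _ pM p] x)
    then have "y \<longlonglongrightarrow> D z p" by (simp flip: x(2))
    with y(2) have "l = D z p" by (rule LIMSEQ_unique)
    then show "l \<in> R" using pM by (simp add: R_def)
  qed
  with sR have R: "closed_csubspace R" by (simp add: closed_csubspace_def)
  have RM: "R \<subseteq> M" using DM by (auto simp: R_def)
  have MR: "M \<subseteq> R"
  proof
    fix u assume u: "u \<in> M"
    define w where "w = u - orth_proj R u"
    have wM: "w \<in> M" unfolding w_def using orth_proj_in[OF R] RM by (intro csubspace_intros sM u) auto
    have "cinner x (D (cnj z) w) = 0" if x: "x \<in> M" for x
    proof -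
      have "cinner x (D (cnj z) w) = cinner (D z x) w"
        by (simp add: D_def cinner_diff_left cinner_diff_right cinner_scaleC_left cinner_scaleC_right
            selfadjoint_opD[OF A x wM])
      also have "\<dots> = 0"
        using orth_proj_orthogonal[OF R, of "D z x" u] x cinner_eq_0_commute by (auto simp: R_def w_def)
      finally show ?thesis .
    qed
    then have "D (cnj z) w = 0" using DM[OF wM] cinner_eq_zero_iff by blast
    then have "\<delta> * norm w \<le> 0" using below[OF wM] norm_D[OF wM] by simp
    then have "w = 0" using d(1) by (simp add: mult_le_0_iff)
    then show "u \<in> R" using orth_proj_in[OF R, of u] by (simp add: w_def)
  qed
  have inj: "inj_on (D z) M"
  proof (rule inj_onI)
    fix x y assume xy: "x \<in> M" "y \<in> M" "D z x = D z y"
    then have "\<delta> * norm (x - y) \<le> 0"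
      using below[OF complex_vector.subspace_diff[OF sM xy(1,2)]] by (simp add: D_diff)
    then show "x = y" using d(1) by (simp add: mult_le_0_iff)
  qed
  define B where "B = inv_into M (D z)"
  have B1: "B (D z x) = x" if "x \<in> M" for x using inj that by (simp add: B_def)
  have B2: "D z (B y) = y" "B y \<in> M" if "y \<in> M" for y
    using MR that by (auto simp: B_def R_def f_inv_into_f inv_into_into)
  have "B \<in> bounded_ops M M"
  proof (rule bounded_opsI[where C = "1 / \<delta>"])
    fix x y assume "x \<in> M" "y \<in> M"
    then show "B (x + y) = B x + B y"
      using B1[of "B x + B y"] by (simp add: D_add B2 complex_vector.subspace_add[OF sM])
  next
    fix x a assume "x \<in> M"
    then show "B (a *\<^sub>C x) = a *\<^sub>C B x"
      using B1[of "a *\<^sub>C B x"] by (simp add: D_scale B2 complex_vector.subspace_scale[OF sM])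
  next
    fix x assume "x \<in> M"
    then show "norm (B x) \<le> 1 / \<delta> * norm x"
      using below[of "B x"] B2 d(1) by (simp add: field_simps)
  qed (simp add: B2)
  moreover have "\<forall>x\<in>M. B (A x - z *\<^sub>C x) = x \<and> A (B x) - z *\<^sub>C B x = x"
    using B1 B2 by (simp add: D_def)
  ultimately show ?thesis unfolding spectrum_def by blast
qed

text \<open>A real \<open>r > c\<close> is not spectral, because \<open>A - r\<close> is bounded
  below by \<open>r - c\<close>.\<close>

lemma sup_spectrum_eqI:
  assumes A: "selfadjoint_op M A" and M: "closed_csubspace M"
    and c: "0 \<le> c" "\<And>x. x \<in> M \<Longrightarrow> norm (A x) \<le> c * norm x" "complex_of_real c \<in> spectrum M A"
  shows "sup_spectrum M A = c"
  unfolding sup_spectrum_def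
proof (rule cSup_eq_maximum)
  show "c \<in> {r. complex_of_real r \<in> spectrum M A}" using c by simp
  fix r assume r: "r \<in> {r. complex_of_real r \<in> spectrum M A}"
  show "r \<le> c"
  proof (rule ccontr)
    assume "\<not> r \<le> c"
    have "(r - c) * norm x \<le> norm (A x - complex_of_real r *\<^sub>C x)" if "x \<in> M" for x
    proof -
      have "r * norm x = norm (complex_of_real r *\<^sub>C x)" using c(1) \<open>\<not> r \<le> c\<close> by simp
      also have "\<dots> \<le> norm (A x - complex_of_real r *\<^sub>C x) + norm (A x)"
        by (metis norm_minus_commute norm_triangle_sub add.commute)
      finally show ?thesis using c(2)[OF that] by (simp add: left_diff_distrib)
    qed
    then have "complex_of_real r \<notin> spectrum M A"
      using \<open>\<not> r \<le> c\<close> by (intro not_spectrum_if_bounded_below[OF A M, of "r - c"]) auto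
    with r show False by simp
  qed
qed

section \<open>Operators attaining their norm on every closed subspace\<close>

text \<open>The absolutely norm attaining operators. The inequality says that
  \<open>norm (T x)\<close> is the operator norm of the restriction to \<open>N\<close>, without
  naming that norm.\<close>

definition abs_attaining ::
  "'a::complex_hilbert_space set \<Rightarrow> ('a \<Rightarrow> 'b::complex_hilbert_space) \<Rightarrow> bool" where
  "abs_attaining M T \<longleftrightarrow> (\<forall>N. closed_csubspace N \<and> N \<subseteq> M \<and> N \<noteq> {0} \<longrightarrow>
     (\<exists>x\<in>N. norm x = 1 \<and> (\<forall>y\<in>N. norm (T y) \<le> norm (T x) * norm y)))"

lemma abs_attainingD:
  assumes "abs_attaining M T" "closed_csubspace N" "N \<subseteq> M" "N \<noteq> {0}"
  obtains x where "x \<in> N" "norm x = 1" "\<And>y. y \<in> N \<Longrightarrow> norm (T y) \<le> norm (T x) * norm y"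
  using assms unfolding abs_attaining_def by blast

lemma orthonormal_upto_append:
  assumes y: "orthonormal_upto m y" and w: "orthonormal_upto k w"
    and yw: "\<And>i j. i \<in> {1..m} \<Longrightarrow> j \<in> {1..k} \<Longrightarrow> cinner (w j) (y i) = 0"
  shows "orthonormal_upto (m + k) (\<lambda>j. if j \<le> m then y j else w (j - m))" (is "orthonormal_upto _ ?x")
  unfolding orthonormal_upto_def
proof (intro ballI)
  fix i j assume ij: "i \<in> {1..m + k}" "j \<in> {1..m + k}"
  show "cinner (?x i) (?x j) = (if i = j then 1 else 0)"
  proof (cases "i \<le> m"; cases "j \<le> m")
    assume "i \<le> m" "j \<le> m"
    then show ?thesis using orthonormal_uptoD[OF y, of i j] ij by simp
  next
    assume "\<not> i \<le> m" "\<not> j \<le> m"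
    moreover from this ij have "i - m \<in> {1..k}" "j - m \<in> {1..k}" "i - m = j - m \<longleftrightarrow> i = j" by auto
    ultimately show ?thesis using orthonormal_uptoD[OF w, of "i - m" "j - m"] by simp
  next
    assume "i \<le> m" "\<not> j \<le> m"
    moreover from this ij have "j - m \<in> {1..k}" by auto
    ultimately show ?thesis using yw[of i "j - m"] ij cinner_eq_0_commute[of "y i" "w (j - m)"] by auto
  next
    assume "\<not> i \<le> m" "j \<le> m"
    moreover from this ij have "i - m \<in> {1..k}" by auto
    ultimately show ?thesis using yw[of j "i - m"] ij by auto
  qed
qed

text \<open>Invariance makes \<open>S \<circ> P\<^sub>N\<close> coincide with
  \<open>P\<^sub>N S P\<^sub>N\<close>. It serves the recursion for the s-numbers and later the
  compact part of the decomposition.\<close>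

lemma selfadjoint_op_compose_orth_proj:
  assumes S: "selfadjoint_op M S" and M: "csubspace M" and N: "closed_csubspace N" "N \<subseteq> M" "S ` N \<subseteq> N"
    and S': "\<And>x. x \<in> M \<Longrightarrow> S' x = S (orth_proj N x)"
  shows "selfadjoint_op M S'"
  unfolding selfadjoint_op_def
proof (intro conjI ballI)
  note bS = selfadjoint_op_bounded[OF S]
  have p: "orth_proj N x \<in> N" "orth_proj N x \<in> M" "S (orth_proj N x) \<in> N" "S (orth_proj N x) \<in> M" for x
    using orth_proj_in[OF N(1), of x] N by auto
  obtain C where C: "C > 0" "\<And>x. x \<in> M \<Longrightarrow> norm (S x) \<le> C * norm x"
    using bounded_ops_bound[OF bS] by blast
  show "S' \<in> bounded_ops M M"
  proof (rule bounded_opsI[where C = C])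
    fix x assume "x \<in> M"
    then have "norm (S' x) \<le> C * norm (orth_proj N x)" using C(2)[OF p(2)[of x]] S' by simp
    also have "\<dots> \<le> C * norm x"
      using C(1) by (intro mult_left_mono norm_orth_proj_le(1)[OF N(1)]) simp
    finally show "norm (S' x) \<le> C * norm x" .
  qed (simp_all add: S' p complex_vector.subspace_add[OF M] complex_vector.subspace_scale[OF M]
      orth_proj_add[OF N(1)] orth_proj_scaleC[OF N(1)] bounded_ops_add[OF bS] bounded_ops_scaleC[OF bS])
  fix x y assume xy: "x \<in> M" "y \<in> M"
  have "cinner (S' x) y = cinner (S (orth_proj N x)) (orth_proj N y)"
    by (simp add: S' xy cinner_orth_proj_right[OF N(1) p(3)])
  also have "\<dots> = cinner (orth_proj N x) (S (orth_proj N y))"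
    by (rule selfadjoint_opD[OF S p(2) p(2)])
  also have "\<dots> = cinner x (S' y)"
    by (simp add: S' xy cinner_orth_proj[OF N(1) p(3)])
  finally show "cinner (S' x) y = cinner x (S' y)" .
qed

text \<open>Pythagoras on both sides. It combines lower bounds for \<open>A - z\<close> on an
  eigenspace and on its complement into one bound, which shows that the top eigenvalue is
  isolated.\<close>

lemma norm_ge_min_orthogonal:
  fixes u v e g :: "'a::complex_hilbert_space"
  assumes "cinner u v = 0" "cinner e g = 0" "0 \<le> \<delta>" "\<delta> * norm e \<le> norm u" "\<delta> * norm g \<le> norm v"
  shows "\<delta> * norm (e + g) \<le> norm (u + v)"
proof (rule power2_le_imp_le)
  have "(\<delta> * norm (e + g))\<^sup>2 = (\<delta> * norm e)\<^sup>2 + (\<delta> * norm g)\<^sup>2"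
    using norm_add_square_orthogonal[OF assms(2)] by (simp add: power_mult_distrib distrib_left)
  also have "\<dots> \<le> (norm u)\<^sup>2 + (norm v)\<^sup>2"
    using assms by (intro add_mono power_mono) auto
  also have "\<dots> = (norm (u + v))\<^sup>2"
    using norm_add_square_orthogonal[OF assms(1)] by simp
  finally show "(\<delta> * norm (e + g))\<^sup>2 \<le> (norm (u + v))\<^sup>2" .
qed simp

text \<open>
  The recursion defining \<open>eig_num\<close> splits off the top eigenspace by passing from
  \<open>A\<close> to \<open>A - \<mu> P\<^sub>E\<close>, an operator with domain \<open>M\<close> again.  All operators that arise are of the form
  \<open>S \<circ> P\<^sub>N\<close> with \<open>N\<close> a closed \<open>S\<close>-invariant subspace, and the step replaces \<open>N\<close> by
  \<open>N \<inter> E\<^sup>\<bottom>\<close>.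
\<close>

lemma eig_num_attained:
  assumes M: "closed_csubspace M" and S: "positive_op M S" and att: "abs_attaining M S"
    and "closed_csubspace N" "N \<subseteq> M" "S ` N \<subseteq> N" "enat n \<le> cdim N"
    and "\<And>x. x \<in> M \<Longrightarrow> S' x = S (orth_proj N x)"
  shows "\<exists>x. orthonormal_upto n x \<and> x ` {1..n} \<subseteq> N \<and> (\<forall>j\<in>{1..n}. norm (S (x j)) = eig_num M S' j)"
  using assms(4-)
proof (induction n arbitrary: N S' rule: less_induct)
  case (less n)
  note sM = closed_csubspaceD(1)[OF M] and bS = positive_op_bounded[OF S]
  note aS = positive_op_selfadjoint[OF S sM]
  note N = \<open>closed_csubspace N\<close> and NM = \<open>N \<subseteq> M\<close> and inv = \<open>S ` N \<subseteq> N\<close> and S' = less.prems(5)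
  note sN = closed_csubspaceD(1)[OF N]
  note aS' = selfadjoint_op_compose_orth_proj[OF aS sM N NM inv S', simplified]
  note bS' = selfadjoint_op_bounded[OF aS']
  have S'N: "S' x = S x" if "x \<in> N" for x using that NM S' orth_proj_id[OF N] by auto
  have S'_in: "S' x \<in> N" if "x \<in> M" for x using that S' orth_proj_in[OF N] inv by auto
  show ?case
  proof (cases "\<forall>x\<in>N. S x = 0")
    case True
    obtain x where x: "orthonormal_upto n x" "x ` {1..n} \<subseteq> N"
      using enat_le_cdim_iff[OF sN] less.prems(4) by blast
    have "S' ` M \<subseteq> cspan {}" using True S' orth_proj_in[OF N] by auto
    then have "op_rank M S' = 0"
      unfolding op_rank_def using cdim_le_card[of "{}" "S' ` M"] by (simp add: zero_enat_def[symmetric])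
    \<comment> \<open>With rank zero the first branch of \<open>eig_num\<close> applies to every
      \<open>j \<ge> 1\<close>.\<close>
    then have "eig_num M S' j = 0" if "j \<in> {1..n}" for j
      using that by (subst eig_num.simps) (simp add: zero_enat_def)
    moreover have "norm (S (x j)) = 0" if "j \<in> {1..n}" for j
      using True x(2) that by (simp add: image_subset_iff)
    ultimately show ?thesis using x by auto
  next
    case False
    then have "N \<noteq> {0}" using bounded_ops_0[OF bS sM] by auto
    from abs_attainingD[OF att N NM this] obtain x0 where
      x0: "x0 \<in> N" "norm x0 = 1" "\<And>y. y \<in> N \<Longrightarrow> norm (S y) \<le> norm (S x0) * norm y" by blast
    define \<mu> where "\<mu> = norm (S x0)"
    have "\<mu> > 0" using False x0(3) by (force simp: \<mu>_def)
    have Sx0: "S x0 = \<mu> *\<^sub>R x0"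
      unfolding \<mu>_def by (rule positive_op_eigenvector_of_max[OF S sM NM inv x0])
    have S'le: "norm (S' x) \<le> \<mu> * norm x" if "x \<in> M" for x
    proof -
      have "norm (S' x) \<le> \<mu> * norm (orth_proj N x)"
        using x0(3)[OF orth_proj_in[OF N]] that by (simp add: \<mu>_def S')
      also have "\<dots> \<le> \<mu> * norm x"
        using \<open>\<mu> > 0\<close> norm_orth_proj_le[OF N] by (simp add: mult_left_mono)
      finally show ?thesis .
    qed
    have spec: "complex_of_real \<mu> \<in> spectrum M S'"
      using x0 NM Sx0 S'N by (intro eigenvalue_in_spectrum[OF bS' sM, of x0]) (auto simp: scaleR_eq_scaleC)
    have sup: "sup_spectrum M S' = \<mu>"
      using \<open>\<mu> > 0\<close> S'le spec by (intro sup_spectrum_eqI[OF aS' M]) auto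
    define E where "E = eigenspace M S' (complex_of_real \<mu>)"
    have E: "closed_csubspace E" unfolding E_def by (rule closed_csubspace_eigenspace[OF bS' M])
    note sE = closed_csubspaceD(1)[OF E]
    \<comment> \<open>The eigenspace is taken in all of \<open>M\<close>, but an eigenvector for
      \<open>\<mu> > 0\<close> lies in the range of \<open>S'\<close> and therefore in
      \<open>N\<close>.\<close>
    have E_iff: "x \<in> E \<longleftrightarrow> x \<in> N \<and> S x = \<mu> *\<^sub>R x" for x
    proof
      assume x: "x \<in> E"
      then have xM: "x \<in> M" and e: "S' x = \<mu> *\<^sub>R x" by (auto simp: E_def eigenspace_def scaleR_eq_scaleC)
      have "(1 / \<mu>) *\<^sub>R S' x \<in> N" by (intro csubspace_intros sN S'_in xM)
      then have "x \<in> N" using e \<open>\<mu> > 0\<close> by simp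
      then show "x \<in> N \<and> S x = \<mu> *\<^sub>R x" using e S'N by simp
    next
      assume "x \<in> N \<and> S x = \<mu> *\<^sub>R x"
      then show "x \<in> E" using NM S'N by (auto simp: E_def eigenspace_def scaleR_eq_scaleC)
    qed
    have E_range: "E \<subseteq> S' ` M"
    proof
      fix x assume x: "x \<in> E"
      then have "S' ((1 / \<mu>) *\<^sub>R x) = x" and "(1 / \<mu>) *\<^sub>R x \<in> M"
        using E_iff[of x] \<open>\<mu> > 0\<close> NM by (auto simp: bounded_ops_scaleR[OF bS'] S'N intro!: csubspace_intros sM)
      then show "x \<in> S' ` M" by (metis imageI)
    qed
    then have rank_ge: "cdim E \<le> op_rank M S'" unfolding op_rank_def by (rule cdim_subset)
    show ?thesis
    proof (cases "cdim E = \<infinity>")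
      case True
      \<comment> \<open>Infinite multiplicity stops the recursion: the rank is infinite too, so
        every value is \<mu> and any orthonormal family in \<open>E\<close> will do.\<close>
      then have "complex_of_real \<mu> \<in> ess_spectrum M S'"
        using spec by (simp add: ess_spectrum_def E_def)
      then have eig: "eig_num M S' j = \<mu>" for j
        using rank_ge True by (subst eig_num.simps) (simp add: sup)
      obtain x where x: "orthonormal_upto n x" "x ` {1..n} \<subseteq> E"
        using enat_le_cdim_iff[OF sE, of n] True by auto
      have "norm (S (x j)) = \<mu>" if "j \<in> {1..n}" for j
      proof -
        have "x j \<in> E" using x(2) that by blast
        then show ?thesis using E_iff[of "x j"] orthonormal_upto_norm[OF x(1) that] \<open>\<mu> > 0\<close> by simp
      qed
      moreover have "x ` {1..n} \<subseteq> N" using x(2) E_iff by blast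
      ultimately show ?thesis using x(1) eig by (intro exI[of _ x]) simp
    next
      case False
      then obtain m where m: "cdim E = enat m" by auto
      have "x0 \<in> E" using E_iff x0(1) Sx0 by simp
      then have "enat 1 \<le> cdim E"
        using x0(2) by (intro orthonormal_upto_le_cdim[of 1 "\<lambda>_. x0"]) (auto simp: orthonormal_upto_def cinner_self)
      then have "m \<ge> 1" using m by simp
      obtain y where y: "orthonormal_upto m y" "y ` {1..m} \<subseteq> E"
        "\<And>v. v \<in> E \<Longrightarrow> v = (\<Sum>i\<in>{1..m}. cinner v (y i) *\<^sub>C y i)"
        using orthonormal_basis[OF sE m] by blast
      have y_in: "y i \<in> E" if "i \<in> {1..m}" for i using y(2) that by blast
      define N' where "N' = N \<inter> orth_compl E"
      have N': "closed_csubspace N'"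
        unfolding N'_def by (intro closed_csubspace_Int N closed_csubspace_orth_compl)
      note sN' = closed_csubspaceD(1)[OF N']
      have N'M: "N' \<subseteq> M" using NM by (auto simp: N'_def)
      have inv': "S ` N' \<subseteq> N'"
      proof
        fix w assume "w \<in> S ` N'"
        then obtain x where x: "x \<in> N" "\<And>e. e \<in> E \<Longrightarrow> cinner x e = 0" "w = S x"
          by (auto simp: N'_def orth_compl_def)
        have "cinner w e = 0" if "e \<in> E" for e
        proof -
          have "cinner w e = cinner x (S e)"
            unfolding x(3) using x(1) that E_iff NM by (intro selfadjoint_opD[OF aS]) auto
          then show ?thesis using x(2)[OF that] that E_iff by simp
        qed
        then show "w \<in> N'" using x inv by (auto simp: N'_def orth_compl_def)
      qed
      \<comment> \<open>The spectral gap comes from attainment on \<open>N'\<close>: a maximizer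
        there with value \<mu> would be an eigenvector in \<open>E\<close> and at the same time
        orthogonal to \<open>E\<close>.\<close>
      have "\<exists>\<mu>'. 0 \<le> \<mu>' \<and> \<mu>' < \<mu> \<and> (\<forall>y\<in>N'. norm (S y) \<le> \<mu>' * norm y)"
      proof (cases "N' = {0}")
        case True
        then show ?thesis using \<open>\<mu> > 0\<close> bounded_ops_0[OF bS sM] by (intro exI[of _ 0]) auto
      next
        case False
        from abs_attainingD[OF att N' N'M this] obtain x1 where
          x1: "x1 \<in> N'" "norm x1 = 1" "\<And>y. y \<in> N' \<Longrightarrow> norm (S y) \<le> norm (S x1) * norm y" by blast
        have Sx1: "S x1 = norm (S x1) *\<^sub>R x1"
          by (rule positive_op_eigenvector_of_max[OF S sM N'M inv' x1])
        have x1N: "x1 \<in> N" using x1(1) by (simp add: N'_def)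
        have "norm (S x1) \<noteq> \<mu>"
        proof
          assume "norm (S x1) = \<mu>"
          then have "x1 \<in> E" using E_iff x1N Sx1 by simp
          then have "cinner x1 x1 = 0" using x1(1) by (auto simp: N'_def orth_compl_def)
          then show False using x1(2) by simp
        qed
        moreover have "norm (S x1) \<le> \<mu>" using x0(3)[OF x1N] x1(2) by (simp add: \<mu>_def)
        ultimately show ?thesis using x1(3) by (intro exI[of _ "norm (S x1)"]) auto
      qed
      then obtain \<mu>' where \<mu>': "0 \<le> \<mu>'" "\<mu>' < \<mu>" "\<And>y. y \<in> N' \<Longrightarrow> norm (S y) \<le> \<mu>' * norm y" by blast
      have projN': "orth_proj N' x = orth_proj N x - orth_proj E x" for x
      proof (rule orth_proj_eqI[OF sN'])
        have "orth_proj N x - orth_proj E x \<in> N"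
          using E_iff orth_proj_in[OF E] by (intro csubspace_intros sN orth_proj_in N) blast
        moreover have "cinner (orth_proj N x - orth_proj E x) e = 0" if "e \<in> E" for e
          using that E_iff by (simp add: cinner_diff_left cinner_orth_proj[OF N] cinner_orth_proj[OF E])
        ultimately show "orth_proj N x - orth_proj E x \<in> N'" by (simp add: N'_def orth_compl_def)
        fix z assume z: "z \<in> N'"
        then have "cinner (orth_proj E x) z = 0"
          using orth_proj_in[OF E, of x] cinner_eq_0_commute by (auto simp: N'_def orth_compl_def)
        then show "cinner (x - (orth_proj N x - orth_proj E x)) z = 0"
          using z by (simp add: cinner_diff_left cinner_orth_proj[OF N] N'_def)
      qed
      \<comment> \<open>Written as in the recursion for \<open>eig_num\<close>; by
        \<open>projN'\<close> it is again \<open>S\<close> composed with a projection, now onto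
        \<open>N'\<close>, which is the form that the induction hypothesis accepts.\<close>
      define S'' where "S'' = (\<lambda>x. S' x - \<mu> *\<^sub>R orth_proj E x)"
      have S'': "S'' x = S (orth_proj N' x)" if "x \<in> M" for x
      proof -
        have e: "orth_proj E x \<in> N" "S (orth_proj E x) = \<mu> *\<^sub>R orth_proj E x"
          using orth_proj_in[OF E, of x] E_iff by blast+
        then show ?thesis
          unfolding S''_def projN' using NM orth_proj_in[OF N] that
          by (subst bounded_ops_diff[OF bS sM]) (auto simp: S')
      qed
      have split: "S' x = \<mu> *\<^sub>R orth_proj E x + S'' x" for x by (simp add: S''_def)
      have S''_in: "S'' x \<in> N'" if "x \<in> M" for x using S''[OF that] inv' orth_proj_in[OF N'] by auto
      have not_ess: "complex_of_real \<mu> \<notin> ess_spectrum M S'"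
      proof -
        \<comment> \<open>Half the gap: for \<open>z\<close> within \<epsilon> of \<mu> one still
          has \<open>cmod z - \<mu>' \<ge> \<epsilon>\<close>. On \<open>E\<close> the operator
          \<open>S' - z\<close> acts as the scalar \<open>\<mu> - z\<close>, on the complement of
          \<open>E\<close> it is bounded below by \<open>cmod z - \<mu>'\<close>.\<close>
        define \<epsilon> where "\<epsilon> = (\<mu> - \<mu>') / 2"
        have "\<epsilon> > 0" using \<mu>' by (simp add: \<epsilon>_def)
        have "z \<notin> spectrum M S'" if z: "z \<noteq> complex_of_real \<mu>" "dist z (complex_of_real \<mu>) < \<epsilon>" for z
        proof (rule not_spectrum_if_bounded_below[OF aS' M])
          define \<delta> where "\<delta> = min \<epsilon> (cmod (complex_of_real \<mu> - z))"
          show "\<delta> > 0" using z(1) \<open>\<epsilon> > 0\<close> by (simp add: \<delta>_def)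
          have "cmod z \<ge> \<mu> - \<epsilon>"
            using z(2) norm_triangle_ineq2[of "complex_of_real \<mu>" z] \<open>\<mu> > 0\<close>
            by (simp add: dist_norm norm_minus_commute)
          then have zge: "cmod z - \<mu>' \<ge> \<delta>" by (simp add: \<delta>_def \<epsilon>_def min_def field_simps)
          fix x assume x: "x \<in> M"
          define e where "e = orth_proj E x"
          define g where "g = x - e"
          have eE: "e \<in> E" unfolding e_def by (rule orth_proj_in[OF E])
          have gE: "cinner e' g = 0" if "e' \<in> E" for e'
            using orth_proj_orthogonal[OF E that, of x] cinner_eq_0_commute[of e' g] by (simp add: g_def e_def)
          have nS'': "norm (S'' x) \<le> \<mu>' * norm g"
          proof -
            have "orth_proj N' x = orth_proj N g"
              unfolding projN' g_def e_def
              using orth_proj_id[OF N, of "orth_proj E x"] orth_proj_in[OF E, of x] E_iff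
                orth_proj_add[OF N, of "x - orth_proj E x" "orth_proj E x"] by simp
            then have "norm (orth_proj N' x) \<le> norm g" using norm_orth_proj_le(1)[OF N, of g] by simp
            then have "\<mu>' * norm (orth_proj N' x) \<le> \<mu>' * norm g" using \<mu>'(1) by (rule mult_left_mono)
            then show ?thesis using \<mu>'(3)[OF orth_proj_in[OF N'], of x] S''[OF x] by simp
          qed
          have "\<delta> * norm (e + g) \<le> norm ((complex_of_real \<mu> - z) *\<^sub>C e + (S'' x - z *\<^sub>C g))"
          proof (rule norm_ge_min_orthogonal)
            have "cinner e (S'' x) = 0"
              using S''_in[OF x] eE cinner_eq_0_commute by (auto simp: N'_def orth_compl_def)
            then show "cinner ((complex_of_real \<mu> - z) *\<^sub>C e) (S'' x - z *\<^sub>C g) = 0"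
              using gE[OF eE] by (simp add: cinner_scaleC_left cinner_scaleC_right cinner_diff_right)
            show "cinner e g = 0" by (rule gE[OF eE])
            show "\<delta> * norm e \<le> norm ((complex_of_real \<mu> - z) *\<^sub>C e)"
              by (simp add: \<delta>_def mult_right_mono)
            have "\<delta> * norm g \<le> (cmod z - \<mu>') * norm g" using zge by (rule mult_right_mono) simp
            also have "\<dots> \<le> norm (z *\<^sub>C g) - norm (S'' x)" using nS'' by (simp add: left_diff_distrib)
            also have "\<dots> \<le> norm (S'' x - z *\<^sub>C g)" by (metis norm_minus_commute norm_triangle_ineq2)
            finally show "\<delta> * norm g \<le> norm (S'' x - z *\<^sub>C g)" .
          qed (use \<open>\<delta> > 0\<close> in simp)
          moreover have "(complex_of_real \<mu> - z) *\<^sub>C e + (S'' x - z *\<^sub>C g) = S' x - z *\<^sub>C x"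
            unfolding split
            by (simp add: e_def[symmetric] g_def scaleR_eq_scaleC complex_vector.scale_left_diff_distrib
                complex_vector.scale_right_diff_distrib)
          ultimately show "\<delta> * norm x \<le> norm (S' x - z *\<^sub>C x)" by (simp add: g_def)
        qed
        then have "\<not> complex_of_real \<mu> islimpt spectrum M S'"
          unfolding islimpt_approachable using \<open>\<epsilon> > 0\<close> by blast
        then show ?thesis using m by (simp add: ess_spectrum_def E_def[symmetric])
      qed
      have eig: "eig_num M S' j = (if op_rank M S' < enat j then 0 else if j \<le> m then \<mu> else eig_num M S'' (j - m))" for j
        using not_ess \<open>m \<ge> 1\<close> m by (subst eig_num.simps) (simp add: sup S''_def E_def[symmetric] Let_def)
      have normE: "norm (S v) = \<mu>" if "v \<in> E" "norm v = 1" for v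
        using that E_iff[of v] \<open>\<mu> > 0\<close> by simp
      have eigE: "eig_num M S' j = \<mu>" if "j \<le> m" for j
      proof -
        have "enat j \<le> op_rank M S'" using that rank_ge m order_trans[of "enat j" "enat m" "op_rank M S'"] by simp
        then show ?thesis using eig[of j] that by (simp add: not_less)
      qed
      show ?thesis
      proof (cases "n \<le> m")
        case True
        have "orthonormal_upto n y" by (rule orthonormal_upto_le[OF y(1) True])
        moreover have "y ` {1..n} \<subseteq> N" using y_in E_iff True by (auto simp: image_subset_iff)
        moreover have "norm (S (y j)) = eig_num M S' j" if "j \<in> {1..n}" for j
          using that True normE[OF y_in, of j] eigE[of j] orthonormal_upto_norm[OF y(1), of j] by simp
        ultimately show ?thesis by (intro exI[of _ y]) auto
      next
        case False
        have "y ` {1..m} \<subseteq> N" using y_in E_iff by blast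
        \<comment> \<open>Completing the basis of \<open>E\<close> to \<open>n\<close> orthonormal
          vectors of \<open>N\<close> shows that \<open>N'\<close> still has dimension at least
          \<open>n - m\<close>; the new vectors are then discarded in favour of those from the
          induction hypothesis.\<close>
        then obtain z where z: "orthonormal_upto n z" "z ` {1..n} \<subseteq> N" "\<forall>i\<in>{1..m}. z i = y i"
          using orthonormal_upto_extend[OF sN less.prems(4), of m y] y(1) False by auto
        have yE: "cinner w v = 0" if "v \<in> E" "\<And>i. i \<in> {1..m} \<Longrightarrow> cinner w (y i) = 0" for w v
        proof -
          have "cinner w v = cinner w (\<Sum>i\<in>{1..m}. cinner v (y i) *\<^sub>C y i)" using y(3)[OF that(1)] by simp
          also have "\<dots> = 0" using that(2) by (simp add: cinner_sum_right cinner_scaleC_right)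
          finally show ?thesis .
        qed
        have "z (m + i) \<in> N'" if "i \<in> {1..n - m}" for i
        proof -
          have "cinner (z (m + i)) (y j) = 0" if "j \<in> {1..m}" for j
            using orthonormal_uptoD[OF z(1), of "m + i" j] z(3) that \<open>i \<in> {1..n - m}\<close> by auto
          moreover have "m + i \<in> {1..n}" using that False by auto
          then have "z (m + i) \<in> N" using z(2) by blast
          ultimately show ?thesis using yE by (simp add: N'_def orth_compl_def)
        qed
        moreover have "orthonormal_upto (n - m) (\<lambda>i. z (m + i))"
          unfolding orthonormal_upto_def
        proof (intro ballI)
          fix i j assume "i \<in> {1..n - m}" "j \<in> {1..n - m}"
          then have "m + i \<in> {1..n}" "m + j \<in> {1..n}" using False by auto
          from orthonormal_uptoD[OF z(1) this] show "cinner (z (m + i)) (z (m + j)) = (if i = j then 1 else 0)"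
            by simp
        qed
        ultimately have "enat (n - m) \<le> cdim N'"
          by (intro orthonormal_upto_le_cdim[of _ "\<lambda>i. z (m + i)"] image_subsetI)
        moreover have "n - m < n" using False \<open>m \<ge> 1\<close> by auto
        ultimately obtain w where w: "orthonormal_upto (n - m) w" "w ` {1..n - m} \<subseteq> N'"
          "\<And>j. j \<in> {1..n - m} \<Longrightarrow> norm (S (w j)) = eig_num M S'' j"
          using less.IH[OF _ N' N'M inv' _ S''] by blast
        define x where "x j = (if j \<le> m then y j else w (j - m))" for j
        have orth: "cinner v (y i) = 0" if "v \<in> N'" "i \<in> {1..m}" for v i
          using that y_in by (simp add: N'_def orth_compl_def)
        have w_in: "w i \<in> N'" if "i \<in> {1..n - m}" for i using w(2) that by blast
        have "orthonormal_upto (m + (n - m)) x"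
          unfolding x_def using w_in orth by (intro orthonormal_upto_append[OF y(1) w(1)] orth)
        then have "orthonormal_upto n x" using False by simp
        moreover have "x j \<in> N" if "j \<in> {1..n}" for j
        proof (cases "j \<le> m")
          case True
          then show ?thesis using that y_in[of j] E_iff[of "y j"] by (simp add: x_def)
        next
          case False
          then have "j - m \<in> {1..n - m}" using that by auto
          with False show ?thesis using w_in[of "j - m"] by (simp add: x_def N'_def)
        qed
        moreover have "norm (S (x j)) = eig_num M S' j" if j: "j \<in> {1..n}" for j
        proof (cases "j \<le> m")
          case True
          then show ?thesis using j normE[OF y_in, of j] eigE[of j] orthonormal_upto_norm[OF y(1), of j]
            by (simp add: x_def)
        next
          case jm: False
          \<comment> \<open>The rank test is repeated at each level, so the default value zero for
            \<open>S'\<close> at \<open>j\<close> must agree with the recursive value. Otherwise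
            \<open>j - m\<close> orthonormal vectors in the range of \<open>S''\<close> together
            with the basis of \<open>E\<close> would give \<open>j\<close> orthonormal vectors in
            the range of \<open>S'\<close>.\<close>
          have "eig_num M S'' (j - m) = 0" if rank: "op_rank M S' < enat j"
          proof (cases "op_rank M S'' < enat (j - m)")
            case True
            then show ?thesis by (subst eig_num.simps) simp
          next
            case False
            have "S'' ` M = S ` N'"
            proof (intro equalityI subsetI)
              fix v assume "v \<in> S'' ` M"
              then show "v \<in> S ` N'" using S'' orth_proj_in[OF N'] by blast
            next
              fix v assume "v \<in> S ` N'"
              then obtain x where "x \<in> N'" "v = S x" by blast
              then show "v \<in> S'' ` M" using S''[of x] orth_proj_id[OF N', of x] N'M by (intro image_eqI[of _ _ x]) auto
            qed
            moreover have "S \<in> bounded_ops N' UNIV" by (rule bounded_ops_mono[OF bS N'M]) simp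
            then have "csubspace (S ` N')" using sN' by (rule csubspace_image)
            ultimately obtain u where u: "orthonormal_upto (j - m) u" "u ` {1..j - m} \<subseteq> S ` N'"
              using False enat_le_cdim_iff[of "S'' ` M" "j - m"] by (auto simp: op_rank_def not_less)
            have u_in: "u i \<in> S ` N'" if "i \<in> {1..j - m}" for i using u(2) that by blast
            then have "u i \<in> N'" if "i \<in> {1..j - m}" for i using that inv' by blast
            with orth have "orthonormal_upto (m + (j - m)) (\<lambda>i. if i \<le> m then y i else u (i - m))"
              by (intro orthonormal_upto_append[OF y(1) u(1)]) blast
            moreover have range_sub: "S ` N' \<subseteq> S' ` M"
            proof
              fix v assume "v \<in> S ` N'"
              then obtain x where "x \<in> N'" "v = S x" by blast
              then show "v \<in> S' ` M" using S'N[of x] N'M by (intro image_eqI[of _ _ x]) (auto simp: N'_def)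
            qed
            have "(\<lambda>i. if i \<le> m then y i else u (i - m)) ` {1..m + (j - m)} \<subseteq> S' ` M"
            proof (intro image_subsetI)
              fix i assume i: "i \<in> {1..m + (j - m)}"
              show "(if i \<le> m then y i else u (i - m)) \<in> S' ` M"
              proof (cases "i \<le> m")
                case True
                then show ?thesis using i y_in[of i] E_range by auto
              next
                case False
                then have "i - m \<in> {1..j - m}" using i by auto
                with u_in range_sub False show ?thesis by auto
              qed
            qed
            ultimately have "enat (m + (j - m)) \<le> op_rank M S'"
              unfolding op_rank_def by (rule orthonormal_upto_le_cdim)
            then show ?thesis using rank jm by simp
          qed
          then have "eig_num M S' j = eig_num M S'' (j - m)" using eig[of j] jm by simp
          moreover have "j - m \<in> {1..n - m}" using jm j by auto
          ultimately show ?thesis using w(3)[of "j - m"] jm by (simp add: x_def)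
        qed
        ultimately show ?thesis by (intro exI[of _ x]) auto
      qed
    qed
  qed
qed

text \<open>Equal norms transfer attainment from \<open>P\<close> to \<open>abs_op M P\<close>, and
  \<open>eig_num_attained\<close> with \<open>N = M\<close> gives orthonormal vectors that realize
  the s-numbers one by one. Hence the weights are arbitrary.\<close>

lemma norming_if_abs_attaining:
  assumes P: "selfadjoint_op UNIV P" and att: "abs_attaining UNIV P" and M: "closed_csubspace M"
  shows "norming \<pi> k M P"
proof -
  define S where "S = abs_op M P"
  note sM = closed_csubspaceD(1)[OF M] and bP = selfadjoint_op_bounded[OF P]
  have S: "positive_op M S" and nS: "\<And>x. x \<in> M \<Longrightarrow> norm (S x) = norm (P x)"
    using abs_op_props[OF P M] by (auto simp: S_def)
  have SM: "S ` M \<subseteq> M" using bounded_ops_in[OF positive_op_bounded[OF S]] by auto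
  have attS: "abs_attaining M S"
    unfolding abs_attaining_def
  proof (intro allI impI, elim conjE)
    fix N assume N: "closed_csubspace N" "N \<subseteq> M" "N \<noteq> {0}"
    then obtain x where x: "x \<in> N" "norm x = 1" "\<And>y. y \<in> N \<Longrightarrow> norm (P y) \<le> norm (P x) * norm y"
      using abs_attainingD[OF att N(1) subset_UNIV N(3)] by blast
    then show "\<exists>x\<in>N. norm x = 1 \<and> (\<forall>y\<in>N. norm (S y) \<le> norm (S x) * norm y)"
      using nS[OF subsetD[OF N(2)]] by (intro bexI[of _ x]) simp_all
  qed
  \<comment> \<open>The number of vectors prescribed by \<open>norming\<close>. If \<open>M\<close>
    has dimension below \<open>k\<close>, the surplus summands of the Ky Fan norm vanish because the
    rank does not exceed the dimension.\<close>
  define n where "n = (if cdim M < enat k then the_enat (cdim M) else k)"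
  have n: "enat n \<le> cdim M \<and> n \<le> k \<and> (\<forall>j\<in>{1..k} - {1..n}. cdim M < enat j)"
  proof (cases "cdim M < enat k")
    case True
    then obtain d where "cdim M = enat d" by (cases "cdim M") auto
    with True show ?thesis by (auto simp: n_def)
  next
    case False
    then have "n = k" by (simp add: n_def)
    with False show ?thesis by (simp add: not_less)
  qed
  obtain x where x: "orthonormal_upto n x" "x ` {1..n} \<subseteq> M" "\<And>j. j \<in> {1..n} \<Longrightarrow> norm (S (x j)) = eig_num M S j"
    using eig_num_attained[OF M S attS M subset_refl SM, of n S] n orth_proj_id[OF M] by auto
  have "eig_num M S j = 0" if "j \<in> {1..k} - {1..n}" for j
  proof -
    have "op_rank M S < enat j"
      unfolding op_rank_def using cdim_subset[OF SM] n that by (blast intro: order.strict_trans1)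
    then show ?thesis by (subst eig_num.simps) simp
  qed
  then have "ky_fan_norm \<pi> k M P = (\<Sum>j=1..n. \<pi> j * eig_num M S j)"
    unfolding ky_fan_norm_def s_num_def S_def[symmetric]
    using n by (intro sum.mono_neutral_right) auto
  also have "\<dots> = (\<Sum>j=1..n. \<pi> j * norm (P (x j)))"
  proof (intro sum.cong refl)
    fix j assume j: "j \<in> {1..n}"
    then have "x j \<in> M" using x(2) by blast
    then show "\<pi> j * eig_num M S j = \<pi> j * norm (P (x j))" using x(3)[OF j] nS by simp
  qed
  finally have "ky_fan_norm \<pi> k M P = (\<Sum>j=1..n. \<pi> j * norm (P (x j)))" .
  moreover have "P \<in> bounded_ops M UNIV" by (rule bounded_ops_mono[OF bP]) auto
  ultimately show ?thesis
    unfolding norming_def Let_def n_def[symmetric] using x by blast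
qed

section \<open>Orthogonal sequences with strictly increasing image norms\<close>

text \<open>On the span the form is a sum of \<open>(cmod (r b))\<^sup>2\<close> times diagonal
  entries, and its sign passes to the closure by continuity. This takes the place of infinite
  orthonormal expansions.\<close>

lemma Re_cinner_diagonal_nonneg:
  assumes A: "A \<in> bounded_ops UNIV UNIV"
    and off: "\<And>b b'. b \<in> B \<Longrightarrow> b' \<in> B \<Longrightarrow> b \<noteq> b' \<Longrightarrow> cinner (A b) b' = 0"
    and diag: "\<And>b. b \<in> B \<Longrightarrow> 0 \<le> Re (cinner (A b) b)"
    and x: "x \<in> closure (cspan B)"
  shows "0 \<le> Re (cinner (A x) x)"
proof -
  have span: "0 \<le> Re (cinner (A x) x)" if "x \<in> cspan B" for x
  proof -
    obtain t r where t: "finite t" "t \<subseteq> B" "x = (\<Sum>b\<in>t. r b *\<^sub>C b)"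
      using \<open>x \<in> cspan B\<close> unfolding complex_vector.span_explicit by blast
    have "A x = (\<Sum>b\<in>t. r b *\<^sub>C A b)"
      unfolding t(3) by (simp add: bounded_ops_sum[OF A complex_vector.subspace_UNIV] bounded_ops_scaleC[OF A])
    then have "cinner (A x) x = (\<Sum>b\<in>t. r b * cinner (A b) x)"
      by (simp add: cinner_sum_left cinner_scaleC_left)
    also have "\<dots> = (\<Sum>b\<in>t. \<Sum>b'\<in>t. r b * cnj (r b') * cinner (A b) b')"
      unfolding t(3) by (simp add: cinner_sum_right cinner_scaleC_right sum_distrib_left mult_ac)
    also have "\<dots> = (\<Sum>b\<in>t. \<Sum>b'\<in>t. if b' = b then r b * cnj (r b) * cinner (A b) b else 0)"
      using off t(2) by (intro sum.cong refl) (auto simp: subset_iff)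
    also have "\<dots> = (\<Sum>b\<in>t. complex_of_real ((cmod (r b))\<^sup>2) * cinner (A b) b)"
      using t(1) by (simp add: complex_norm_square del: of_real_power)
    finally have "Re (cinner (A x) x) = (\<Sum>b\<in>t. (cmod (r b))\<^sup>2 * Re (cinner (A b) b))"
      by (simp del: of_real_power)
    then show ?thesis using diag t(2) by (auto intro!: sum_nonneg mult_nonneg_nonneg)
  qed
  have "continuous_on UNIV A" by (rule bounded_ops_continuous_on[OF A complex_vector.subspace_UNIV])
  then have "closed {x. 0 \<le> Re (cinner (A x) x)}"
    unfolding Re_cinner by (intro closed_Collect_le continuous_intros) auto
  moreover have "cspan B \<subseteq> {x. 0 \<le> Re (cinner (A x) x)}" using span by blast
  ultimately have "closure (cspan B) \<subseteq> {x. 0 \<le> Re (cinner (A x) x)}" by (rule closure_minimal[rotated])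
  then show ?thesis using x by blast
qed

definition orthonormal_seq :: "(nat \<Rightarrow> 'a::complex_hilbert_space) \<Rightarrow> bool" where
  "orthonormal_seq e \<longleftrightarrow> (\<forall>i j. cinner (e i) (e j) = (if i = j then 1 else 0))"

lemma orthonormal_seqD: "orthonormal_seq e \<Longrightarrow> cinner (e i) (e j) = (if i = j then 1 else 0)"
  by (simp add: orthonormal_seq_def)

lemma orthonormal_seq_norm: "orthonormal_seq e \<Longrightarrow> norm (e i) = 1"
  using orthonormal_upto_norm[of 1 "\<lambda>_. e i" 1] by (simp add: orthonormal_upto_def orthonormal_seq_def)

lemma orthonormal_seq_cdim:
  assumes "orthonormal_seq e" "range e \<subseteq> V"
  shows "cdim V = \<infinity>"
proof -
  have "enat n \<le> cdim V" for n
    using assms by (intro orthonormal_upto_le_cdim[of n e]) (auto simp: orthonormal_upto_def orthonormal_seq_def)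
  then show ?thesis by (metis Suc_n_not_le_n enat.exhaust enat_ord_simps(1))
qed

lemma orthonormal_seqI:
  assumes "\<And>i. norm (e i) = 1" "\<And>i j. j < i \<Longrightarrow> cinner (e i) (e j) = 0"
  shows "orthonormal_seq e"
  unfolding orthonormal_seq_def
proof (intro allI)
  fix i j
  show "cinner (e i) (e j) = (if i = j then 1 else 0)"
    using assms(1)[of i] assms(2)[of i j] assms(2)[of j i] cinner_eq_0_commute[of "e i" "e j"]
    by (cases i j rule: linorder_cases) (auto simp: cinner_self)
qed

text \<open>Neither weights nor an index \<open>k\<close> occur here, which is why one norming pair
  already has consequences for all pairs.\<close>

definition increasing_seq_free :: "('a::complex_hilbert_space \<Rightarrow> 'a) \<Rightarrow> bool" where
  "increasing_seq_free P \<longleftrightarrow> \<not> (\<exists>e. orthonormal_seq e \<and>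
     (\<forall>i j. i \<noteq> j \<longrightarrow> cinner (P (e i)) (P (e j)) = 0) \<and> strict_mono (\<lambda>n. norm (P (e n))))"

text \<open>
  On the closed span of such a sequence all s-numbers coincide with the limit of the norms, which
  is an accumulation point of the spectrum and is not attained at any unit vector.
\<close>

lemma increasing_seq_free_if_abs_norming:
  assumes P: "selfadjoint_op UNIV P" and norming: "abs_norming \<pi> k P" and \<pi>: "\<pi> \<in> weights" and k: "k \<ge> 1"
  shows "increasing_seq_free P"
  unfolding increasing_seq_free_def
proof (intro notI, elim exE conjE)
  fix e0 :: "nat \<Rightarrow> 'a"
  assume e0: "orthonormal_seq e0" "\<forall>i j. i \<noteq> j \<longrightarrow> cinner (P (e0 i)) (P (e0 j)) = 0"
    "strict_mono (\<lambda>n. norm (P (e0 n)))"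
  \<comment> \<open>The first image norm may be zero; dropping that vector makes all
    \<open>c n\<close> positive, so that each \<open>e n\<close> lies in the range of
    \<open>S\<close>.\<close>
  define e where "e n = e0 (Suc n)" for n
  have e: "orthonormal_seq e" using e0(1) by (auto simp: e_def orthonormal_seq_def)
  have Pe: "cinner (P (e i)) (P (e j)) = 0" if "i \<noteq> j" for i j using e0(2) that by (simp add: e_def)
  define c where "c n = norm (P (e n))" for n
  have c_mono: "strict_mono c" using e0(3) by (simp add: c_def e_def strict_mono_def)
  have c_pos: "c n > 0" for n
    using strict_monoD[OF e0(3), of 0 "Suc n"] norm_ge_zero[of "P (e0 0)"] unfolding c_def e_def by linarith
  note bP = selfadjoint_op_bounded[OF P]
  obtain C where C: "C > 0" "\<And>x. norm (P x) \<le> C * norm x" using bounded_ops_bound[OF bP] by auto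
  have "c n \<le> C" for n using C(2)[of "e n"] orthonormal_seq_norm[OF e] by (simp add: c_def)
  then obtain s where s: "c \<longlonglongrightarrow> s" "\<And>n. c n \<le> s"
    using incseq_convergent[of c] strict_mono_mono[OF c_mono] by blast
  have c_less: "c n < s" for n using strict_monoD[OF c_mono, of n "Suc n"] s(2)[of "Suc n"] by simp
  have "s > 0" using c_pos[of 0] c_less[of 0] by linarith
  define M where "M = closure (cspan (range e))"
  have M: "closed_csubspace M" unfolding M_def by (rule closed_csubspace_closure_cspan)
  note sM = closed_csubspaceD(1)[OF M]
  have eM: "e n \<in> M" for n
    unfolding M_def using closure_subset complex_vector.span_base by (metis rangeI subsetD)
  define S where "S = abs_op M P"
  have S: "positive_op M S" and SS: "\<And>x. x \<in> M \<Longrightarrow> S (S x) = orth_proj M (P (P x))"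
    and nS: "\<And>x. x \<in> M \<Longrightarrow> norm (S x) = norm (P x)"
    using abs_op_props[OF P M] by (auto simp: S_def)
  note bS = positive_op_bounded[OF S] and aS = positive_op_selfadjoint[OF S sM]
  have Se: "S (e n) = c n *\<^sub>R e n" for n
  proof (rule positive_op_eigenvector_of_square[OF S sM eM])
    show "0 \<le> c n" using c_pos[of n] by simp
    \<comment> \<open>\<open>P\<^sup>2 (e n)\<close> may leave \<open>M\<close>, but orthogonality
      of the images makes its deviation from \<open>(c n)\<^sup>2 *\<^sub>R e n\<close> orthogonal
      to every \<open>e m\<close>, hence to \<open>M\<close>.\<close>
    define v where "v = P (P (e n)) - (c n)\<^sup>2 *\<^sub>R e n"
    have "cinner (e m) v = 0" for m
      using selfadjoint_opD[OF P, of "e m" "P (e n)"] Pe[of m n] orthonormal_seqD[OF e, of m n]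
      by (cases "m = n") (simp_all add: v_def cinner_diff_right cinner_self c_def)
    then have "M \<subseteq> orth_compl {v}"
      unfolding M_def by (intro closure_cspan_least closed_csubspace_orth_compl) (auto simp: orth_compl_def)
    then have "cinner v z = 0" if "z \<in> M" for z
      using that cinner_eq_0_commute by (auto simp: orth_compl_def)
    then have "orth_proj M (P (P (e n))) = (c n)\<^sup>2 *\<^sub>R e n"
      by (intro orth_proj_eqI sM csubspace_scaleR eM) (simp add: v_def)
    then show "S (S (e n)) = (c n)\<^sup>2 *\<^sub>R e n" using SS[OF eM] by simp
  qed
  have S_le: "norm (S x) \<le> s * norm x" if x: "x \<in> M" for x
  proof -
    \<comment> \<open>The operator \<open>s\<^sup>2 - P\<^sup>2\<close> has vanishing off-diagonal
      entries along \<open>e\<close> and diagonal entries \<open>s\<^sup>2 - (c n)\<^sup>2\<close>;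
      nonnegativity of its form on \<open>M\<close> is the desired norm bound.\<close>
    define A where "A x = s\<^sup>2 *\<^sub>R x + (-1) *\<^sub>R P (P x)" for x
    have "(\<lambda>x. P (P x)) \<in> bounded_ops UNIV UNIV"
    proof (rule bounded_opsI[where C = "C * C"])
      show "norm (P (P x)) \<le> C * C * norm x" for x
        using order_trans[OF C(2)[of "P x"] mult_left_mono[OF C(2)[of x], of C]] C(1) by simp
    qed (simp_all add: bounded_ops_add[OF bP] bounded_ops_scaleC[OF bP])
    then have bA: "A \<in> bounded_ops UNIV UNIV"
      unfolding A_def by (intro bounded_ops_plus bounded_ops_scale bounded_ops_id complex_vector.subspace_UNIV)
    have A: "cinner (A x) y = complex_of_real (s\<^sup>2) * cinner x y - cinner (P x) (P y)" for x y
      using selfadjoint_opD[OF P, of "P x" y] by (simp add: A_def cinner_diff_left)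
    have off: "cinner (A b) b' = 0" if "b \<in> range e" "b' \<in> range e" "b \<noteq> b'" for b b'
      using that Pe orthonormal_seqD[OF e] by (auto simp: A)
    have diag: "0 \<le> Re (cinner (A b) b)" if b: "b \<in> range e" for b
    proof -
      obtain n where "b = e n" using b by blast
      then have "Re (cinner (A b) b) = s\<^sup>2 - (c n)\<^sup>2"
        by (simp add: A cinner_self orthonormal_seq_norm[OF e] c_def)
      then show ?thesis using s(2)[of n] c_pos[of n] by (simp add: power_mono)
    qed
    have "0 \<le> Re (cinner (A x) x)"
      by (rule Re_cinner_diagonal_nonneg[OF bA off diag x[unfolded M_def]])
    then have "(norm (S x))\<^sup>2 \<le> (s * norm x)\<^sup>2" by (simp add: A cinner_self nS[OF x] power_mult_distrib)
    then show ?thesis by (rule power2_le_imp_le) (use \<open>s > 0\<close> in simp)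
  qed
  have S_less: "norm (P x) < s" if x: "x \<in> M" "norm x = 1" for x
  proof (rule ccontr)
    assume "\<not> norm (P x) < s"
    then have "norm (S x) = s" using S_le[OF x(1)] x nS[OF x(1)] by simp
    then have Sx: "S x = s *\<^sub>R x"
      using positive_op_eigenvector_of_max[OF S sM subset_refl _ x] S_le bounded_ops_in[OF bS] by auto
    \<comment> \<open>Eigenvectors of a self-adjoint operator for the different eigenvalues
      \<open>c n\<close> and \<open>s\<close> are orthogonal.\<close>
    have "cinner (e n) x = 0" for n
    proof -
      have "complex_of_real (c n) * cinner (e n) x = cinner (S (e n)) x" by (simp add: Se)
      also have "\<dots> = cinner (e n) (S x)" by (rule selfadjoint_opD[OF aS eM x(1)])
      also have "\<dots> = complex_of_real s * cinner (e n) x" by (simp add: Sx)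
      finally show ?thesis using c_less[of n] by simp
    qed
    then have "M \<subseteq> orth_compl {x}"
      unfolding M_def by (intro closure_cspan_least closed_csubspace_orth_compl) (auto simp: orth_compl_def)
    then have "cinner x x = 0" using x(1) by (auto simp: orth_compl_def)
    then show False using x(2) by simp
  qed
  have c_spec: "complex_of_real (c n) \<in> spectrum M S" for n
    using eM orthonormal_seq_norm[OF e] Se
    by (intro eigenvalue_in_spectrum[OF bS sM, of "e n"]) (auto simp: scaleR_eq_scaleC)
  have near: "\<exists>n. s - c n < \<delta>" if "\<delta> > 0" for \<delta>
  proof -
    have "\<forall>\<^sub>F n in sequentially. s - \<delta> < c n" using s(1) that by (intro order_tendstoD(1)) auto
    then obtain n where "s - \<delta> < c n" by (auto simp: eventually_sequentially)
    then show ?thesis by (intro exI[of _ n]) simp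
  qed
  have s_spec: "complex_of_real s \<in> spectrum M S"
  proof (rule spectrum_if_approx_eigenvalue[OF _ bS sM])
    fix \<delta> :: real assume "\<delta> > 0"
    then obtain n where n: "s - c n < \<delta>" using near by blast
    have "S (e n) - complex_of_real s *\<^sub>C e n = (c n - s) *\<^sub>R e n"
      by (simp add: Se scaleR_eq_scaleC[of s, symmetric] scaleR_diff_left)
    then have "norm (S (e n) - complex_of_real s *\<^sub>C e n) = s - c n"
      using c_less[of n] by (simp add: orthonormal_seq_norm[OF e])
    then show "\<exists>x\<in>M. norm x = 1 \<and> norm (S x - complex_of_real s *\<^sub>C x) < \<delta>"
      using n eM[of n] orthonormal_seq_norm[OF e, of n] by (intro bexI[of _ "e n"]) auto
  qed
  have sup: "sup_spectrum M S = s"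
    using \<open>s > 0\<close> S_le s_spec by (intro sup_spectrum_eqI[OF aS M]) auto
  have "complex_of_real s islimpt spectrum M S"
    unfolding islimpt_approachable
  proof (intro allI impI)
    fix \<delta> :: real assume "\<delta> > 0"
    then obtain n where n: "s - c n < \<delta>" using near by blast
    have "dist (complex_of_real (c n)) (complex_of_real s) = s - c n"
      using c_less[of n] by (simp add: dist_of_real dist_real_def)
    then show "\<exists>x'\<in>spectrum M S. x' \<noteq> complex_of_real s \<and> dist x' (complex_of_real s) < \<delta>"
      using c_spec[of n] c_less[of n] n by (intro bexI[of _ "complex_of_real (c n)"]) auto
  qed
  then have ess: "complex_of_real s \<in> ess_spectrum M S" using s_spec by (simp add: ess_spectrum_def)
  \<comment> \<open>Infinite rank excludes the default value zero of \<open>eig_num\<close> for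
    every \<open>j\<close>.\<close>
  have "range e \<subseteq> S ` M"
  proof clarify
    fix n
    have "S ((1 / c n) *\<^sub>R e n) = e n"
      using c_pos[of n] by (simp add: bounded_ops_scaleR[OF bS eM] Se)
    moreover have "(1 / c n) *\<^sub>R e n \<in> M" by (intro csubspace_scaleR sM eM)
    ultimately show "e n \<in> S ` M" by (metis imageI)
  qed
  then have "op_rank M S = \<infinity>" unfolding op_rank_def by (rule orthonormal_seq_cdim[OF e])
  then have eig: "s_num M P j = s" for j
    unfolding s_num_def S_def[symmetric] using ess by (subst eig_num.simps) (simp add: sup)
  have "cdim M = \<infinity>" using orthonormal_seq_cdim[OF e] eM by auto
  moreover have "norming \<pi> k M P"
    using norming M eM[of 0] orthonormal_seq_norm[OF e, of 0] unfolding abs_norming_def by force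
  ultimately have "\<exists>x. (\<forall>j\<in>{1..k}. x j \<in> M) \<and> orthonormal_upto k x \<and>
      (\<Sum>j=1..k. \<pi> j * s) = (\<Sum>j=1..k. \<pi> j * norm (P (x j)))"
    by (simp add: norming_def ky_fan_norm_def eig)
  then obtain x where x: "\<And>j. j \<in> {1..k} \<Longrightarrow> x j \<in> M" "orthonormal_upto k x"
    "(\<Sum>j=1..k. \<pi> j * s) = (\<Sum>j=1..k. \<pi> j * norm (P (x j)))"
    by blast
  have "(\<Sum>j=1..k. \<pi> j * norm (P (x j))) < (\<Sum>j=1..k. \<pi> j * s)"
  proof (rule sum_strict_mono)
    fix j assume j: "j \<in> {1..k}"
    then have "\<pi> j > 0" using \<pi> by (auto simp: weights_def)
    then show "\<pi> j * norm (P (x j)) < \<pi> j * s"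
      using S_less[OF x(1)[OF j] orthonormal_upto_norm[OF x(2) j]] by simp
  qed (use k in auto)
  then show False using x(3) by simp
qed

section \<open>Attainment of the norm on closed subspaces\<close>

text \<open>
  On \<open>N\<close> the form \<open>q x = s \<parallel>x\<parallel>\<^sup>2 - \<parallel>P x\<parallel>\<^sup>2\<close>, with \<open>s\<close> the supremum of \<open>\<parallel>P x\<parallel>\<^sup>2\<close> over unit vectors, is
  nonnegative, so by the parallelogram law \<open>q (x - y) \<le> 2 q x + 2 q y\<close>; the bound by \<open>C\<close> then makes
  a subsequence of any maximizing sequence Cauchy.
\<close>

lemma attains_norm_if_compact_perturbation:
  fixes P :: "'a::complex_hilbert_space \<Rightarrow> 'b::complex_hilbert_space"
    and C :: "'a \<Rightarrow> 'c::real_normed_vector"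
  assumes P: "P \<in> bounded_ops UNIV UNIV" and N: "closed_csubspace N" and L: "L \<ge> 0"
    and le: "\<And>x. x \<in> N \<Longrightarrow> (norm (P x))\<^sup>2 \<le> t * (norm x)\<^sup>2 + L * norm (C x) * norm x"
    and C_diff: "\<And>x y. x \<in> N \<Longrightarrow> y \<in> N \<Longrightarrow> C (x - y) = C x - C y"
    and comp: "\<And>f. (\<And>n::nat. f n \<in> N) \<Longrightarrow> (\<And>n. norm (f n) = 1) \<Longrightarrow>
      \<exists>r l. strict_mono r \<and> (\<lambda>n. C (f (r n))) \<longlonglongrightarrow> l"
    and above: "u \<in> N" "norm u = 1" "t < (norm (P u))\<^sup>2"
  shows "\<exists>x\<in>N. norm x = 1 \<and> (\<forall>y\<in>N. norm (P y) \<le> norm (P x) * norm y)"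
proof -
  note sN = closed_csubspaceD(1)[OF N]
  obtain c where c: "c > 0" "\<And>x. norm (P x) \<le> c * norm x" using bounded_ops_bound[OF P] by auto
  define U where "U = {x \<in> N. norm x = 1}"
  define s where "s = (SUP x\<in>U. (norm (P x))\<^sup>2)"
  have uU: "u \<in> U" using above by (simp add: U_def)
  have "(norm (P x))\<^sup>2 \<le> c\<^sup>2" if "x \<in> U" for x
    using c(2)[of x] that by (intro power_mono) (auto simp: U_def)
  then have bdd: "bdd_above ((\<lambda>x. (norm (P x))\<^sup>2) ` U)" by (intro bdd_aboveI2) auto
  have s_ge: "(norm (P x))\<^sup>2 \<le> s" if "x \<in> U" for x
    unfolding s_def by (rule cSUP_upper[OF that bdd])
  have "t < s" using above(3) s_ge[OF uU] by linarith
  have s_ge': "(norm (P x))\<^sup>2 \<le> s * (norm x)\<^sup>2" if "x \<in> N" for x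
  proof (cases "x = 0")
    case True
    then show ?thesis using bounded_ops_0[OF P complex_vector.subspace_UNIV] by simp
  next
    case False
    have "(1 / norm x) *\<^sub>R x \<in> U" using False that by (simp add: U_def csubspace_scaleR[OF sN])
    from s_ge[OF this] show ?thesis
      using False by (simp add: bounded_ops_scaleR[OF P] power_divide field_simps)
  qed
  define q where "q x = s * (norm x)\<^sup>2 - (norm (P x))\<^sup>2" for x
  have q_ge: "q x \<ge> 0" if "x \<in> N" for x using s_ge'[OF that] by (simp add: q_def)
  have q_diff: "q (x - y) \<le> 2 * q x + 2 * q y" if "x \<in> N" "y \<in> N" for x y
  proof -
    have "q (x - y) + q (x + y) = 2 * q x + 2 * q y"
      by (simp add: q_def bounded_ops_diff[OF P complex_vector.subspace_UNIV] bounded_ops_add[OF P]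
          norm_add_square norm_diff_square algebra_simps)
    then show ?thesis using q_ge[OF complex_vector.subspace_add[OF sN that]] by linarith
  qed
  have "\<exists>x\<in>U. s - 1 / real (Suc n) < (norm (P x))\<^sup>2" for n
    using less_cSUP_iff[OF _ bdd, of "s - 1 / real (Suc n)"] uU unfolding s_def by auto
  then obtain f where f: "\<And>n. f n \<in> U" "\<And>n. s - 1 / real (Suc n) < (norm (P (f n)))\<^sup>2" by metis
  obtain r l where r: "strict_mono r" "(\<lambda>n. C (f (r n))) \<longlonglongrightarrow> l"
    using comp[of f] f(1) by (auto simp: U_def)
  define g where "g n = f (r n)" for n
  have g: "g n \<in> N" "norm (g n) = 1" for n using f(1)[of "r n"] by (auto simp: g_def U_def)
  have qg: "q (g n) \<le> 1 / real (Suc n)" for n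
  proof -
    have "q (g n) \<le> 1 / real (Suc (r n))"
      using f(2)[of "r n"] g(2)[of n] by (simp add: q_def g_def)
    also have "\<dots> \<le> 1 / real (Suc n)" using seq_suble[OF r(1), of n] by (simp add: frac_le)
    finally show ?thesis .
  qed
  have qg0: "(\<lambda>n. q (g n)) \<longlonglongrightarrow> 0"
    by (rule tendsto_sandwich[OF _ _ tendsto_const LIMSEQ_Suc[OF lim_1_over_n]])
       (use q_ge g(1) qg in auto)
  \<comment> \<open>Chosen from \<open>(s - t) \<parallel>d\<parallel>\<^sup>2 \<le> q d + L
    \<parallel>C d\<parallel> \<parallel>d\<parallel>\<close> for a difference \<open>d\<close> of
    two unit vectors: the factor 2 at \<open>q\<close> is the parallelogram law, the factor 2 at
    \<open>L\<close> is the bound for \<open>norm d\<close>.\<close>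
  define b where "b n = (2 * q (g n) + L * 2 * norm (C (g n) - l)) / (s - t)" for n
  have "Cauchy g"
  proof (rule Cauchy_if_dist_le)
    fix m n
    define d where "d = g m - g n"
    have dN: "d \<in> N" unfolding d_def by (intro csubspace_intros sN g)
    have d2: "norm d \<le> 2" using norm_triangle_ineq4[of "g m" "g n"] g(2) by (simp add: d_def)
    have "norm (C d) \<le> norm (C (g m) - l) + norm (C (g n) - l)"
      unfolding d_def C_diff[OF g(1) g(1)] by (metis dist_norm dist_triangle2)
    then have "L * norm (C d) * norm d \<le> L * (norm (C (g m) - l) + norm (C (g n) - l)) * 2"
      using L d2 by (intro mult_mono) auto
    moreover have "(s - t) * (norm d)\<^sup>2 \<le> q d + L * norm (C d) * norm d"
      using le[OF dN] by (simp add: q_def left_diff_distrib)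
    moreover have "q d \<le> 2 * q (g m) + 2 * q (g n)" unfolding d_def by (rule q_diff[OF g(1) g(1)])
    moreover have b: "(s - t) * b n = 2 * q (g n) + L * 2 * norm (C (g n) - l)" for n
      using \<open>t < s\<close> by (simp add: b_def)
    have "(s - t) * (b m + b n) = 2 * q (g m) + L * 2 * norm (C (g m) - l)
        + (2 * q (g n) + L * 2 * norm (C (g n) - l))"
      by (simp only: distrib_left b)
    ultimately have "(s - t) * (norm d)\<^sup>2 \<le> (s - t) * (b m + b n)"
      by (simp add: distrib_left distrib_right)
    then show "(norm (g m - g n))\<^sup>2 \<le> b m + b n" using \<open>t < s\<close> by (simp add: d_def)
  next
    have "(\<lambda>n. norm (C (g n) - l)) \<longlonglongrightarrow> 0"
      using r(2) by (simp add: g_def LIM_zero tendsto_norm_zero)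
    then have "b \<longlonglongrightarrow> (2 * 0 + L * 2 * 0) / (s - t)"
      unfolding b_def using \<open>t < s\<close> by (intro tendsto_intros qg0) auto
    then show "b \<longlonglongrightarrow> 0" by simp
  qed
  then obtain x where x: "g \<longlonglongrightarrow> x" using Cauchy_convergent_iff convergent_def by blast
  have xN: "x \<in> N" by (rule closed_sequentially[OF closed_csubspaceD(2)[OF N] g(1) x])
  have "(\<lambda>n. norm (g n)) \<longlonglongrightarrow> norm x" by (rule tendsto_norm[OF x])
  then have nx: "norm x = 1" using LIMSEQ_unique tendsto_const by (simp add: g(2) LIMSEQ_const_iff)
  have "(\<lambda>n. q (g n)) \<longlonglongrightarrow> q x"
    unfolding q_def by (intro tendsto_intros x bounded_ops_tendsto[OF P complex_vector.subspace_UNIV]) auto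
  then have "q x = 0" using qg0 LIMSEQ_unique by blast
  then have Px: "(norm (P x))\<^sup>2 = s" using nx by (simp add: q_def)
  have "norm (P y) \<le> norm (P x) * norm y" if "y \<in> N" for y
    by (rule power2_le_imp_le) (use s_ge'[OF that] Px in \<open>simp_all add: power_mult_distrib\<close>)
  then show ?thesis using xN nx by blast
qed

text \<open>Otherwise \<open>norm (P u)\<close> bounds \<open>P\<close> on the part of
  \<open>N\<close> orthogonal to \<open>B\<close>. Then the excess of
  \<open>\<parallel>P x\<parallel>\<^sup>2\<close> over \<open>\<parallel>P u\<parallel>\<^sup>2
  \<parallel>x\<parallel>\<^sup>2\<close> is controlled by the projection to the span of
  \<open>B\<close>, while some unit vector lies above that level; so the norm would be attained on
  \<open>N\<close>.\<close>

lemma exists_orthogonal_above: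
  assumes P: "P \<in> bounded_ops UNIV UNIV" and N: "closed_csubspace N"
    and not_att: "\<And>x. x \<in> N \<Longrightarrow> norm x = 1 \<Longrightarrow> \<exists>y\<in>N. norm (P x) * norm y < norm (P y)"
    and B: "finite B" "B \<subseteq> N" and u: "u \<in> N" "norm u = 1"
  shows "\<exists>x\<in>N. norm x = 1 \<and> (\<forall>b\<in>B. cinner x b = 0) \<and> norm (P u) < norm (P x)"
proof (rule ccontr)
  assume neg: "\<not> ?thesis"
  note sN = closed_csubspaceD(1)[OF N]
  define V where "V = cspan B"
  have V: "csubspace V" "cdim V \<noteq> \<infinity>" "V \<subseteq> N"
    unfolding V_def by (rule complex_vector.subspace_span cdim_cspan_finite[OF B(1)]
      complex_vector.span_minimal[OF B(2) sN])+
  then have cV: "closed_csubspace V" by (simp add: closed_csubspace_finite_cdim)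
  obtain c where c: "c > 0" "\<And>x. norm (P x) \<le> c * norm x" using bounded_ops_bound[OF P] by auto
  have bound: "norm (P x) \<le> norm (P u) * norm x" if "x \<in> N" "\<And>b. b \<in> B \<Longrightarrow> cinner x b = 0" for x
  proof (cases "x = 0")
    case True
    then show ?thesis using bounded_ops_0[OF P complex_vector.subspace_UNIV] by simp
  next
    case False
    define y where "y = (1 / norm x) *\<^sub>R x"
    have "y \<in> N" "norm y = 1" "\<forall>b\<in>B. cinner y b = 0"
      using False that csubspace_scaleR[OF sN] by (auto simp: y_def)
    then have "norm (P y) \<le> norm (P u)" using neg by (meson not_le)
    then show ?thesis using False by (simp add: y_def bounded_ops_scaleR[OF P] field_simps)
  qed
  obtain y where y: "y \<in> N" "norm (P u) * norm y < norm (P y)" using not_att[OF u] by blast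
  then have "y \<noteq> 0" using bounded_ops_0[OF P complex_vector.subspace_UNIV] by auto
  define w where "w = (1 / norm y) *\<^sub>R y"
  have w: "w \<in> N" "norm w = 1" using y \<open>y \<noteq> 0\<close> csubspace_scaleR[OF sN] by (auto simp: w_def)
  have "norm (P u) < norm (P w)"
    using y(2) \<open>y \<noteq> 0\<close> by (simp add: w_def bounded_ops_scaleR[OF P] field_simps)
  then have w': "(norm (P u))\<^sup>2 < (norm (P w))\<^sup>2" by (simp add: power_strict_mono)
  \<comment> \<open>The constant \<open>3 * c\<^sup>2\<close> collects one \<open>c\<^sup>2\<close>
    from \<open>\<parallel>P f\<parallel>\<^sup>2\<close> and two from the cross term of
    \<open>P f\<close> and \<open>P g\<close>.\<close>
  have "\<exists>x\<in>N. norm x = 1 \<and> (\<forall>y\<in>N. norm (P y) \<le> norm (P x) * norm y)"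
  proof (rule attains_norm_if_compact_perturbation[OF P N, of "3 * c\<^sup>2" _ "orth_proj V" w])
    fix x assume x: "x \<in> N"
    define f where "f = orth_proj V x"
    define g where "g = x - f"
    have fV: "f \<in> V" unfolding f_def by (rule orth_proj_in[OF cV])
    have gN: "g \<in> N" unfolding g_def using x fV V(3) by (intro csubspace_intros sN) auto
    have "cinner g b = 0" if "b \<in> B" for b
      unfolding g_def f_def using that by (intro orth_proj_orthogonal[OF cV]) (simp add: V_def complex_vector.span_base)
    from bound[OF gN this] have Pg: "norm (P g) \<le> norm (P u) * norm g" .
    have fx: "norm f \<le> norm x" and gx: "norm g \<le> norm x"
      unfolding g_def f_def by (rule norm_orth_proj_le[OF cV])+
    have "P x = P f + P g" by (simp add: g_def flip: bounded_ops_add[OF P])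
    then have "(norm (P x))\<^sup>2 = (norm (P f))\<^sup>2 + 2 * Re (cinner (P f) (P g)) + (norm (P g))\<^sup>2"
      by (simp add: norm_add_square)
    moreover have "(norm (P f))\<^sup>2 \<le> c\<^sup>2 * (norm f * norm x)"
    proof -
      have "(norm (P f))\<^sup>2 \<le> (c * norm f)\<^sup>2" using c(2) by (intro power_mono) auto
      also have "\<dots> = c\<^sup>2 * (norm f * norm f)" by (simp add: power2_eq_square)
      also have "\<dots> \<le> c\<^sup>2 * (norm f * norm x)" using fx by (intro mult_left_mono) auto
      finally show ?thesis .
    qed
    moreover have "Re (cinner (P f) (P g)) \<le> c\<^sup>2 * (norm f * norm x)"
    proof -
      have "Re (cinner (P f) (P g)) \<le> norm (P f) * norm (P g)"
        using complex_Re_le_cmod cmod_cinner_le order_trans by blast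
      also have "\<dots> \<le> (c * norm f) * (c * norm x)"
        using c gx order_trans[OF c(2)[of g] mult_left_mono[of "norm g" "norm x" c]] by (intro mult_mono c(2)) auto
      finally show ?thesis by (simp add: power2_eq_square mult_ac)
    qed
    moreover have "(norm (P g))\<^sup>2 \<le> (norm (P u))\<^sup>2 * (norm x)\<^sup>2"
    proof -
      have "norm (P g) \<le> norm (P u) * norm x" using Pg gx by (meson mult_left_mono norm_ge_zero order_trans)
      then have "(norm (P g))\<^sup>2 \<le> (norm (P u) * norm x)\<^sup>2" by (intro power_mono) auto
      then show ?thesis by (simp add: power_mult_distrib)
    qed
    ultimately show "(norm (P x))\<^sup>2 \<le> (norm (P u))\<^sup>2 * (norm x)\<^sup>2 + 3 * c\<^sup>2 * norm (orth_proj V x) * norm x"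
      by (simp add: f_def)
  next
    fix x y
    show "orth_proj V (x - y) = orth_proj V x - orth_proj V y"
      using orth_proj_add[OF cV, of "x - y" y] by simp
  next
    fix f :: "nat \<Rightarrow> 'a" assume "\<And>n. norm (f n) = 1"
    then have "norm (orth_proj V (f n)) \<le> 1" for n using norm_orth_proj_le(1)[OF cV, of "f n"] by simp
    then show "\<exists>r l. strict_mono r \<and> (\<lambda>n. orth_proj V (f (r n))) \<longlonglongrightarrow> l"
      using finite_cdim_bounded_subseq[OF V(1,2), of "\<lambda>n. orth_proj V (f n)" 1] orth_proj_in[OF cV]
      by (auto simp: o_def)
  qed (use w w' in auto)
  then show False using not_att by (meson not_le)
qed

lemma abs_attaining_if_increasing_seq_free:
  assumes P: "selfadjoint_op UNIV P" and free: "increasing_seq_free P"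
  shows "abs_attaining UNIV P"
proof (rule ccontr)
  note bP = selfadjoint_op_bounded[OF P]
  assume "\<not> abs_attaining UNIV P"
  then obtain N where N: "closed_csubspace N" "N \<noteq> {0}"
    and not_att: "\<And>x. x \<in> N \<Longrightarrow> norm x = 1 \<Longrightarrow> \<exists>y\<in>N. norm (P x) * norm y < norm (P y)"
    unfolding abs_attaining_def by (meson not_le)
  define Q where "Q f n x \<longleftrightarrow> x \<in> N \<and> norm x = 1 \<and>
    (\<forall>i<n. cinner x (f i) = 0 \<and> cinner (P x) (P (f i)) = 0 \<and> norm (P (f i)) < norm (P x))"
    for f :: "nat \<Rightarrow> 'a" and n x
  have "\<exists>f. \<forall>n. Q f n (f n)"
  proof (rule dependent_wellorder_choice)
    show "Q f n x = Q g n x" if "\<And>i. i < n \<Longrightarrow> f i = g i" for x f g n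
      using that by (simp add: Q_def)
    fix n f assume IH: "\<And>i. i < n \<Longrightarrow> Q f i (f i)"
    have fN: "f i \<in> N" "norm (f i) = 1" if "i < n" for i using IH[OF that] by (auto simp: Q_def)
    show "\<exists>x. Q f n x"
    proof (cases n)
      case 0
      then show ?thesis using N csubspace_eq_0_iff[OF closed_csubspaceD(1)[OF N(1)]] by (auto simp: Q_def)
    next
      case (Suc m)
      \<comment> \<open>Orthogonality to the second family encodes orthogonality of images: for
        \<open>x\<close> in \<open>N\<close>, \<open>cinner x (orth_proj N (P (P (f i))))\<close>
        equals \<open>cinner (P x) (P (f i))\<close>. Exceeding the last image norm suffices, since
        the earlier ones are smaller.\<close>
      define B where "B = f ` {..<n} \<union> (\<lambda>i. orth_proj N (P (P (f i)))) ` {..<n}"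
      have "finite B" "B \<subseteq> N" using fN orth_proj_in[OF N(1)] by (auto simp: B_def)
      from exists_orthogonal_above[OF bP N(1) not_att this, of "f m"] fN[of m] Suc
      obtain x where x: "x \<in> N" "norm x = 1" "\<And>b. b \<in> B \<Longrightarrow> cinner x b = 0" "norm (P (f m)) < norm (P x)"
        by blast
      have "Q f n x"
        unfolding Q_def
      proof (intro conjI allI impI x(1,2))
        fix i assume i: "i < n"
        then show "cinner x (f i) = 0" by (intro x(3)) (simp add: B_def)
        have "cinner x (orth_proj N (P (P (f i)))) = 0" using i by (intro x(3)) (auto simp: B_def)
        then show "cinner (P x) (P (f i)) = 0"
          using selfadjoint_opD[OF P, of x "P (f i)"] by (simp add: cinner_orth_proj_right[OF N(1) x(1)])
        have "norm (P (f i)) \<le> norm (P (f m))"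
          using IH[of m] Suc i by (cases "i = m") (auto simp: Q_def less_Suc_eq less_imp_le)
        then show "norm (P (f i)) < norm (P x)" using x(4) by linarith
      qed
      then show ?thesis ..
    qed
  qed
  then obtain e where e: "\<And>n. Q e n (e n)" by blast
  have "orthonormal_seq e" using e by (intro orthonormal_seqI) (auto simp: Q_def)
  moreover have "cinner (P (e i)) (P (e j)) = 0" if "i \<noteq> j" for i j
    using that e[of i] e[of j] cinner_eq_0_commute[of "P (e i)"] by (cases i j rule: linorder_cases) (auto simp: Q_def)
  moreover have "strict_mono (\<lambda>n. norm (P (e n)))" using e by (auto simp: strict_mono_def Q_def)
  ultimately show False using free unfolding increasing_seq_free_def by blast
qed

section \<open>The structure of absolutely norm attaining positive operators\<close>

text \<open>Each vector maximizes the image norm on the part of \<open>N\<close> orthogonal to its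
  predecessors, which is nonzero by infinite dimension. The eigenvector property follows afterwards
  by strong induction: once the predecessors are eigenvectors, their complement in \<open>N\<close>
  is invariant.\<close>

lemma greedy_eigenvectors:
  assumes P: "positive_op UNIV P" and att: "abs_attaining UNIV P"
    and N: "closed_csubspace N" "P ` N \<subseteq> N" "cdim N = \<infinity>"
  obtains x where "orthonormal_seq x" "\<And>n. x n \<in> N" "\<And>n. P (x n) = norm (P (x n)) *\<^sub>R x n"
    "\<And>n y. y \<in> N \<Longrightarrow> (\<And>i. i < n \<Longrightarrow> cinner y (x i) = 0) \<Longrightarrow> norm (P y) \<le> norm (P (x n)) * norm y"
proof -
  note aP = positive_op_selfadjoint[OF P complex_vector.subspace_UNIV]
  define R where "R f n = N \<inter> orth_compl (f ` {..<n})" for f :: "nat \<Rightarrow> 'a" and n :: nat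
  define Q where "Q f n x \<longleftrightarrow> x \<in> R f n \<and> norm x = 1 \<and> (\<forall>y\<in>R f n. norm (P y) \<le> norm (P x) * norm y)"
    for f :: "nat \<Rightarrow> 'a" and n x
  have "\<exists>f. \<forall>n. Q f n (f n)"
  proof (rule dependent_wellorder_choice)
    fix x and f g :: "nat \<Rightarrow> 'a" and n :: nat
    assume "\<And>i. i < n \<Longrightarrow> f i = g i"
    then have "f ` {..<n} = g ` {..<n}" by auto
    then show "Q f n x = Q g n x" by (simp add: Q_def R_def)
  next
    fix n and f :: "nat \<Rightarrow> 'a"
    have R: "closed_csubspace (R f n)"
      unfolding R_def by (intro closed_csubspace_Int N closed_csubspace_orth_compl)
    obtain v where "v \<in> N" "norm v = 1" "\<forall>c\<in>f ` {..<n}. cinner v c = 0"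
      using exists_orthogonal_unit[of "f ` {..<n}" N] N(3) closed_csubspaceD(1)[OF N(1)] by auto
    then have "v \<in> R f n" "v \<noteq> 0" by (auto simp: R_def orth_compl_def)
    then have "R f n \<noteq> {0}" by blast
    from abs_attainingD[OF att R subset_UNIV this] obtain x where
      "x \<in> R f n" "norm x = 1" "\<And>y. y \<in> R f n \<Longrightarrow> norm (P y) \<le> norm (P x) * norm y" by blast
    then have "Q f n x" by (simp add: Q_def)
    then show "\<exists>x. Q f n x" ..
  qed
  then obtain x where x: "\<And>n. Q x n (x n)" by blast
  have xN: "x n \<in> N" "norm (x n) = 1" for n using x[of n] by (auto simp: Q_def R_def)
  have orth: "cinner (x i) (x j) = 0" if "j < i" for i j
    using x[of i] that by (auto simp: Q_def R_def orth_compl_def)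
  have max: "norm (P y) \<le> norm (P (x n)) * norm y" if "y \<in> N" "\<And>i. i < n \<Longrightarrow> cinner y (x i) = 0" for n y
    using x[of n] that by (auto simp: Q_def R_def orth_compl_def)
  have eig: "P (x n) = norm (P (x n)) *\<^sub>R x n" for n
  proof (induction n rule: less_induct)
    case (less n)
    have "P ` R x n \<subseteq> R x n"
    proof clarify
      fix y assume y: "y \<in> R x n"
      have "cinner (P y) (x i) = 0" if "i < n" for i
      proof -
        have "cinner (P y) (x i) = cinner y (P (x i))" by (rule selfadjoint_opD[OF aP]) auto
        also have "\<dots> = complex_of_real (norm (P (x i))) * cinner y (x i)"
          by (subst less.IH[OF that]) simp
        also have "\<dots> = 0" using y that by (simp add: R_def orth_compl_def)
        finally show ?thesis .
      qed
      moreover have "P y \<in> N" using y N(2) by (auto simp: R_def)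
      ultimately show "P y \<in> R x n" by (simp add: R_def orth_compl_def)
    qed
    then show ?case
      using x[of n] by (intro positive_op_eigenvector_of_max[OF P complex_vector.subspace_UNIV subset_UNIV])
        (auto simp: Q_def)
  qed
  show ?thesis
  proof (rule that)
    show "orthonormal_seq x" by (rule orthonormal_seqI[OF xN(2) orth])
    show "x n \<in> N" "P (x n) = norm (P (x n)) *\<^sub>R x n" for n by (rule xN(1) eig)+
    show "norm (P y) \<le> norm (P (x n)) * norm y" if "y \<in> N" "\<And>i. i < n \<Longrightarrow> cinner y (x i) = 0" for n y
      by (rule max[OF that])
  qed
qed

text \<open>Total boundedness of the approximating compact set passes to the closure, with
  \<open>e / 3\<close> spent on each of three distances. In this form operators approximated by
  finite-rank ones are recognized as compact.\<close>

lemma compact_closure_if_approximated: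
  fixes S :: "'a::complete_space set"
  assumes "\<And>e. e > 0 \<Longrightarrow> \<exists>L. compact L \<and> (\<forall>y\<in>S. \<exists>l\<in>L. dist l y < e)"
  shows "compact (closure S)"
  unfolding compact_eq_totally_bounded
proof (intro conjI allI impI)
  show "complete (closure S)" by (simp add: complete_eq_closed)
  fix e :: real assume "e > 0"
  then obtain L where L: "compact L" "\<And>y. y \<in> S \<Longrightarrow> \<exists>l\<in>L. dist l y < e / 3"
    using assms[of "e / 3"] by auto
  have "\<forall>e>0. \<exists>k. finite k \<and> L \<subseteq> (\<Union>x\<in>k. ball x e)"
    using L(1) unfolding compact_eq_totally_bounded by blast
  then obtain k where k: "finite k" "L \<subseteq> (\<Union>x\<in>k. ball x (e / 3))"
    using \<open>e > 0\<close> by (meson divide_pos_pos zero_less_numeral)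
  have "closure S \<subseteq> (\<Union>x\<in>k. ball x e)"
  proof
    fix z assume "z \<in> closure S"
    then obtain y where y: "y \<in> S" "dist y z < e / 3"
      using \<open>e > 0\<close> closure_approachable[of z S] by (metis divide_pos_pos zero_less_numeral)
    obtain l where l: "l \<in> L" "dist l y < e / 3" using L(2)[OF y(1)] by blast
    then obtain x where x: "x \<in> k" "dist x l < e / 3" using k(2) by auto
    have "dist x z \<le> dist x l + (dist l y + dist y z)"
      by (meson add_left_mono dist_triangle order_trans)
    then have "dist x z < e" using y l x by linarith
    then show "z \<in> (\<Union>x\<in>k. ball x e)" using x(1) by auto
  qed
  with k(1) show "\<exists>k. finite k \<and> closure S \<subseteq> (\<Union>x\<in>k. ball x e)" by blast
qed

lemma compact_op_zero:
  "compact_op UNIV (\<lambda>x::'a::complex_hilbert_space. 0::'b::complex_hilbert_space)"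
proof -
  have "(\<lambda>x. 0) ` (UNIV \<inter> cball (0::'a) 1) = {0::'b}" by (rule image_constant[of 0]) simp
  then show ?thesis by (simp add: compact_op_def bounded_ops_def) (auto intro: exI[of _ 0])
qed

section \<open>The operator \<open>P - \<alpha>\<close> on the closed span of the greedy
  eigenvectors and on its complement\<close>

context
  fixes P :: "'a::complex_hilbert_space \<Rightarrow> 'a" and x :: "nat \<Rightarrow> 'a" and \<alpha> :: real and G :: "'a set"
  assumes P: "positive_op UNIV P" and x: "orthonormal_seq x"
    and eig: "\<And>n. P (x n) = norm (P (x n)) *\<^sub>R x n"
    and max: "\<And>n y. (\<And>i. i < n \<Longrightarrow> cinner y (x i) = 0) \<Longrightarrow> norm (P y) \<le> norm (P (x n)) * norm y"
    and lim: "(\<lambda>n. norm (P (x n))) \<longlonglongrightarrow> \<alpha>" and ge: "\<And>n. \<alpha> \<le> norm (P (x n))" and \<alpha>: "0 \<le> \<alpha>"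
  defines "G \<equiv> closure (cspan (range x))"
begin

private definition "D y = P y - \<alpha> *\<^sub>R y"

private lemma aP: "selfadjoint_op UNIV P"
  by (rule positive_op_selfadjoint[OF P complex_vector.subspace_UNIV])

private lemma aD: "selfadjoint_op UNIV D"
  unfolding D_def
  by (intro selfadjoint_op_diff selfadjoint_op_scale selfadjoint_op_id aP complex_vector.subspace_UNIV)

private lemma bD: "D \<in> bounded_ops UNIV UNIV"
  by (rule selfadjoint_op_bounded[OF aD])

private lemma Dx: "D (x n) = (norm (P (x n)) - \<alpha>) *\<^sub>R x n"
  by (subst D_def, subst eig) (simp add: scaleR_diff_left)

lemma greedy_closed_span: "closed_csubspace G"
  unfolding G_def by (rule closed_csubspace_closure_cspan)

private lemma x_in_G: "x n \<in> G"
  unfolding G_def using closure_subset complex_vector.span_base by (metis rangeI subsetD)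

lemma greedy_closed_span_invariant: "y \<in> G \<Longrightarrow> D y \<in> G"
proof -
  note sG = closed_csubspaceD(1)[OF greedy_closed_span]
  have "closed_csubspace {y. D y \<in> G}"
    unfolding closed_csubspace_def
  proof
    show "csubspace {y. D y \<in> G}"
      using sG bounded_ops_0[OF bD complex_vector.subspace_UNIV]
      by (auto simp: complex_vector.subspace_def bounded_ops_add[OF bD] bounded_ops_scaleC[OF bD])
    have "continuous_on UNIV D" by (rule bounded_ops_continuous_on[OF bD complex_vector.subspace_UNIV])
    then show "closed {y. D y \<in> G}"
      using closed_vimage[of G D] closed_csubspaceD(2)[OF greedy_closed_span] by (simp add: vimage_def)
  qed
  then have "G \<subseteq> {y. D y \<in> G}"
    unfolding G_def by (intro closure_cspan_least) (auto simp: Dx G_def[symmetric] intro!: csubspace_scaleR sG x_in_G)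
  then show "y \<in> G \<Longrightarrow> D y \<in> G" by blast
qed

private lemma D_nonneg: "y \<in> G \<Longrightarrow> 0 \<le> Re (cinner (D y) y)"
proof (rule Re_cinner_diagonal_nonneg[OF bD])
  show "cinner (D b) b' = 0" if "b \<in> range x" "b' \<in> range x" "b \<noteq> b'" for b b'
    using that orthonormal_seqD[OF x] by (auto simp: Dx)
  show "0 \<le> Re (cinner (D b) b)" if "b \<in> range x" for b
    using that ge by (auto simp: Dx cinner_self)
qed (simp add: G_def)

private lemma D_compress_selfadjoint: "selfadjoint_op UNIV (\<lambda>y. D (orth_proj G y))"
  by (rule selfadjoint_op_compose_orth_proj[OF aD complex_vector.subspace_UNIV greedy_closed_span])
     (auto intro: greedy_closed_span_invariant)

private lemma D_compress_positive: "positive_op UNIV (\<lambda>y. D (orth_proj G y))"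
proof (rule positive_opI[OF D_compress_selfadjoint])
  fix y
  have pG: "orth_proj G y \<in> G" by (rule orth_proj_in[OF greedy_closed_span])
  have "cinner (D (orth_proj G y)) y = cinner (D (orth_proj G y)) (orth_proj G y)"
    by (simp add: cinner_orth_proj_right[OF greedy_closed_span greedy_closed_span_invariant[OF pG]])
  then show "0 \<le> Re (cinner (D (orth_proj G y)) y)" using D_nonneg[OF pG] by simp
qed

text \<open>Expanding \<open>\<parallel>P g - \<alpha> g\<parallel>\<^sup>2\<close> and using
  nonnegativity of \<open>D\<close> on \<open>G\<close> in the cross term leaves at most
  \<open>\<parallel>P g\<parallel>\<^sup>2 - \<alpha>\<^sup>2
  \<parallel>g\<parallel>\<^sup>2\<close>, to which greedy maximality applies. The factor tends to
  zero, which is all that compactness requires.\<close>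

private lemma D_norm_le:
  assumes g: "g \<in> G" "\<And>i. i < n \<Longrightarrow> cinner g (x i) = 0"
  shows "(norm (D g))\<^sup>2 \<le> ((norm (P (x n)))\<^sup>2 - \<alpha>\<^sup>2) * (norm g)\<^sup>2"
proof -
  define a where "a = Re (cinner (P g) g)"
  have "(norm (D g))\<^sup>2 = (norm (P g))\<^sup>2 - 2 * \<alpha> * a + \<alpha>\<^sup>2 * (norm g)\<^sup>2"
    by (simp add: D_def norm_diff_square a_def power_mult_distrib)
  moreover have "\<alpha> * (norm g)\<^sup>2 \<le> a"
    using D_nonneg[OF g(1)] by (simp add: D_def cinner_diff_left cinner_self a_def)
  then have "\<alpha> * (\<alpha> * (norm g)\<^sup>2) \<le> \<alpha> * a" using \<alpha> by (rule mult_left_mono)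
  moreover have "(norm (P g))\<^sup>2 \<le> (norm (P (x n)) * norm g)\<^sup>2"
    using max[OF g(2)] by (intro power_mono) auto
  ultimately show ?thesis by (simp add: power_mult_distrib algebra_simps power2_eq_square[of \<alpha>])
qed

text \<open>A vector of \<open>G\<close> splits into its component along the first \<open>n\<close>
  eigenvectors and a rest orthogonal to them. The first has its image in a fixed compact set, the
  second an image of norm below \<epsilon>.\<close>

private lemma D_compress_compact: "compact_op UNIV (\<lambda>y. D (orth_proj G y))"
  unfolding compact_op_def
proof (intro conjI compact_closure_if_approximated)
  show "(\<lambda>y. D (orth_proj G y)) \<in> bounded_ops UNIV UNIV"
    by (rule selfadjoint_op_bounded[OF D_compress_selfadjoint])
  fix \<epsilon> :: real assume "\<epsilon> > 0"
  have "(\<lambda>n. (norm (P (x n)))\<^sup>2 - \<alpha>\<^sup>2) \<longlonglongrightarrow> \<alpha>\<^sup>2 - \<alpha>\<^sup>2" by (intro tendsto_intros lim)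
  then have "\<forall>\<^sub>F n in sequentially. (norm (P (x n)))\<^sup>2 - \<alpha>\<^sup>2 < \<epsilon>\<^sup>2"
    using \<open>\<epsilon> > 0\<close> by (intro order_tendstoD(2)) auto
  then obtain n where n: "(norm (P (x n)))\<^sup>2 - \<alpha>\<^sup>2 < \<epsilon>\<^sup>2" by (auto simp: eventually_sequentially)
  \<comment> \<open>The coefficients of \<open>D f\<close> are
    \<open>norm (P (x i)) - \<alpha>\<close> times numbers of modulus at most one, and the largest
    eigenvalue \<open>norm (P (x 0))\<close> dominates them all.\<close>
  define R where "R = norm (P (x 0))"
  define L where "L = {(\<Sum>i\<in>{..<n}. a i *\<^sub>C x i) | a. \<forall>i\<in>{..<n}. cmod (a i) \<le> R}"
  have "compact L" unfolding L_def by (rule compact_bounded_combinations) simp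
  moreover have "\<exists>l\<in>L. dist l y < \<epsilon>" if y: "y \<in> (\<lambda>y. D (orth_proj G y)) ` (UNIV \<inter> cball 0 1)" for y
  proof -
    obtain z where z: "norm z \<le> 1" "y = D (orth_proj G z)" using y by auto
    define p where "p = orth_proj G z"
    have p: "p \<in> G" "norm p \<le> 1"
      using orth_proj_in[OF greedy_closed_span] norm_orth_proj_le(1)[OF greedy_closed_span, of z] z(1)
      by (auto simp: p_def)
    define c where "c i = cinner p (x i)" for i
    define f where "f = (\<Sum>i\<in>{..<n}. c i *\<^sub>C x i)"
    define g where "g = p - f"
    have fG: "f \<in> G"
      unfolding f_def by (intro csubspace_intros closed_csubspaceD(1) greedy_closed_span x_in_G)
    have gG: "g \<in> G" unfolding g_def by (intro csubspace_intros closed_csubspaceD(1) greedy_closed_span p fG)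
    have gx: "cinner g (x i) = 0" if "i < n" for i
    proof -
      have "cinner f (x i) = (\<Sum>j\<in>{..<n}. if j = i then c i else 0)"
        unfolding f_def cinner_sum_left
        by (intro sum.cong) (auto simp: cinner_scaleC_left orthonormal_seqD[OF x])
      then show ?thesis using that by (simp add: g_def cinner_diff_left c_def)
    qed
    then have "cinner g f = 0" by (simp add: f_def cinner_sum_right cinner_scaleC_right)
    then have "(norm p)\<^sup>2 = (norm g)\<^sup>2 + (norm f)\<^sup>2"
      using norm_add_square_orthogonal[of g f] by (simp add: g_def)
    moreover have "(norm p)\<^sup>2 \<le> 1" using p(2) by (simp add: power_le_one)
    ultimately have "(norm g)\<^sup>2 \<le> 1" using zero_le_power2[of "norm f"] by linarith
    have "0 \<le> (norm (P (x n)))\<^sup>2 - \<alpha>\<^sup>2" using ge[of n] \<alpha> by (simp add: power_mono)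
    then have "(norm (D g))\<^sup>2 \<le> ((norm (P (x n)))\<^sup>2 - \<alpha>\<^sup>2) * 1"
      using D_norm_le[OF gG gx] mult_left_mono[OF \<open>(norm g)\<^sup>2 \<le> 1\<close>] order_trans by blast
    then have "(norm (D g))\<^sup>2 < \<epsilon>\<^sup>2" using n by simp
    then have "norm (D g) < \<epsilon>" by (rule power2_less_imp_less) (use \<open>\<epsilon> > 0\<close> in simp)
    moreover have "D p = D f + D g" by (simp add: g_def flip: bounded_ops_add[OF bD])
    ultimately have "dist (D f) y < \<epsilon>" by (simp add: z(2) p_def[symmetric] dist_norm)
    moreover have "D f \<in> L"
    proof -
      define a where "a i = complex_of_real (norm (P (x i)) - \<alpha>) * c i" for i
      have "D f = (\<Sum>i\<in>{..<n}. a i *\<^sub>C x i)"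
        unfolding f_def
        by (simp add: bounded_ops_sum[OF bD complex_vector.subspace_UNIV] bounded_ops_scaleC[OF bD] Dx
            scaleR_eq_scaleC scaleC_scaleC a_def mult.commute)
      moreover have "cmod (a i) \<le> R" for i
      proof -
        have "cmod (c i) \<le> 1"
          using cmod_cinner_le[of p "x i"] p(2) orthonormal_seq_norm[OF x] by (simp add: c_def)
        moreover have "norm (P (x i)) \<le> R"
          using max[of 0 "x i"] orthonormal_seq_norm[OF x] by (simp add: R_def)
        then have "\<bar>norm (P (x i)) - \<alpha>\<bar> \<le> R" using ge[of i] \<alpha> by simp
        ultimately have "\<bar>norm (P (x i)) - \<alpha>\<bar> * cmod (c i) \<le> R * 1" by (intro mult_mono) auto
        then show ?thesis by (simp add: a_def norm_mult del: of_real_diff)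
      qed
      ultimately show ?thesis unfolding L_def by blast
    qed
    ultimately show ?thesis by blast
  qed
  ultimately show "\<exists>L. compact L \<and>
      (\<forall>y\<in>(\<lambda>y. D (orth_proj G y)) ` (UNIV \<inter> cball 0 1). \<exists>l\<in>L. dist l y < \<epsilon>)" by blast
qed

text \<open>
  If the remaining part had infinite rank, a second greedy sequence \<open>y\<^sub>n\<close> would live strictly below
  \<open>\<alpha>\<close>, and unit vectors in the planes spanned by \<open>x\<^sub>n\<close> and \<open>y\<^sub>n\<close> could be chosen with image norms
  increasing to \<open>\<alpha>\<close>.
\<close>

private lemma D_remainder_finite_rank:
  assumes att: "abs_attaining UNIV P" and free: "increasing_seq_free P"
  shows "op_rank UNIV (\<lambda>y. D (y - orth_proj G y)) \<noteq> \<infinity>"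
proof
  assume inf: "op_rank UNIV (\<lambda>y. D (y - orth_proj G y)) = \<infinity>"
  define E where "E = eigenspace UNIV P (complex_of_real \<alpha>)"
  have E_iff: "y \<in> E \<longleftrightarrow> D y = 0" for y by (simp add: E_def eigenspace_def D_def scaleR_eq_scaleC)
  \<comment> \<open>Removing the kernel \<open>E\<close> of \<open>D\<close> along with
    \<open>G\<close> makes the later inequality \<open>t n < \<alpha>\<close> strict.
    \<open>D\<close> maps the complement of \<open>G\<close> into \<open>N\<close>, so infinite rank
    of the remainder forces \<open>N\<close> to be infinite-dimensional.\<close>
  define N where "N = orth_compl (G \<union> E)"
  have N: "closed_csubspace N" unfolding N_def by (rule closed_csubspace_orth_compl)
  note sN = closed_csubspaceD(1)[OF N]
  have DN: "D y \<in> N" if "y \<in> orth_compl G" for y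
    unfolding N_def orth_compl_def
  proof clarify
    fix v assume v: "v \<in> G \<union> E"
    have "cinner (D y) v = cinner y (D v)" by (rule selfadjoint_opD[OF aD]) auto
    also have "\<dots> = 0"
      using v that E_iff greedy_closed_span_invariant by (auto simp: orth_compl_def)
    finally show "cinner (D y) v = 0" .
  qed
  have "(\<lambda>y. D (y - orth_proj G y)) ` UNIV \<subseteq> N"
    using DN diff_orth_proj_in[OF greedy_closed_span] by blast
  from cdim_subset[OF this] have "cdim N = \<infinity>" using inf by (simp add: op_rank_def)
  moreover have "P ` N \<subseteq> N"
  proof clarify
    fix y assume y: "y \<in> N"
    then have "D y \<in> N" by (intro DN) (auto simp: N_def orth_compl_def)
    then have "D y + \<alpha> *\<^sub>R y \<in> N" by (intro csubspace_intros sN y)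
    then show "P y \<in> N" by (simp add: D_def)
  qed
  ultimately obtain y where y: "orthonormal_seq y" "\<And>n. y n \<in> N" "\<And>n. P (y n) = norm (P (y n)) *\<^sub>R y n"
    "\<And>n z. z \<in> N \<Longrightarrow> (\<And>i. i < n \<Longrightarrow> cinner z (y i) = 0) \<Longrightarrow> norm (P z) \<le> norm (P (y n)) * norm z"
    using greedy_eigenvectors[OF P att N] by blast
  define s where "s n = norm (P (x n))" for n
  define t where "t n = norm (P (y n))" for n
  have yx: "cinner (y i) (x j) = 0" for i j
    using y(2)[of i] x_in_G[of j] by (simp add: N_def orth_compl_def)
  have xy: "cinner (x i) (y j) = 0" for i j using yx[of j i] cinner_eq_0_commute by blast
  note nx = orthonormal_seq_norm[OF x] and ny = orthonormal_seq_norm[OF y(1)]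
  have t0: "t n \<le> t 0" for n using y(4)[OF y(2), of 0 n] ny by (simp add: t_def)
  \<comment> \<open>\<open>y n\<close> competed with every \<open>x m\<close> and lost, which gives
    the weak inequality; equality would put \<open>y n\<close> into \<open>E\<close>, to which it is
    orthogonal.\<close>
  have "t n < \<alpha>" for n
  proof -
    have "t n \<le> norm (P (x m))" for m using max[OF yx, of n m] ny by (simp add: t_def)
    then have "t n \<le> \<alpha>" by (intro LIMSEQ_le_const[OF lim]) auto
    moreover have "t n \<noteq> \<alpha>"
    proof
      assume "t n = \<alpha>"
      then have "y n \<in> E" using y(3)[of n] E_iff by (simp add: D_def t_def)
      then have "cinner (y n) (y n) = 0" using y(2)[of n] by (simp add: N_def orth_compl_def)
      then show False using ny[of n] by simp
    qed
    ultimately show ?thesis by simp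
  qed
  note t_less = this
  have t_nonneg: "0 \<le> t n" for n by (simp add: t_def)
  define \<beta> where "\<beta> = \<alpha>\<^sup>2 - (t 0)\<^sup>2"
  have "\<beta> > 0" using t_less[of 0] t_nonneg[of 0] by (simp add: \<beta>_def power_strict_mono)
  \<comment> \<open>The squared image norms to be realized, increasing strictly to
    \<open>\<alpha>\<^sup>2\<close>. The shift by 2 keeps \<open>u 0\<close> above
    \<open>(t 0)\<^sup>2\<close>, since \<beta> is the whole distance from there to
    \<open>\<alpha>\<^sup>2\<close>.\<close>
  define u where "u n = \<alpha>\<^sup>2 - \<beta> / real (n + 2)" for n
  have u_less: "u n < \<alpha>\<^sup>2" for n using \<open>\<beta> > 0\<close> by (simp add: u_def)
  have u_gt: "(t n)\<^sup>2 < u n" for n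
  proof -
    have "(t n)\<^sup>2 \<le> (t 0)\<^sup>2" using t0 t_nonneg by (intro power_mono)
    also have "(t 0)\<^sup>2 < u n"
    proof -
      have "\<beta> / real (n + 2) < \<beta>" using \<open>\<beta> > 0\<close> by (simp add: divide_less_eq)
      then show ?thesis unfolding u_def by (simp only: \<beta>_def)
    qed
    finally show ?thesis .
  qed
  have u_mono: "strict_mono u"
    unfolding strict_mono_Suc_iff u_def using \<open>\<beta> > 0\<close> by (auto intro!: divide_strict_left_mono)
  \<comment> \<open>The convex weight that places \<open>u n\<close> between
    \<open>(t n)\<^sup>2\<close> and \<open>(s n)\<^sup>2\<close>; it is a legitimate weight because
    \<open>(t n)\<^sup>2 < u n < \<alpha>\<^sup>2 \<le> (s n)\<^sup>2\<close>.\<close>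
  define c where "c n = (u n - (t n)\<^sup>2) / ((s n)\<^sup>2 - (t n)\<^sup>2)" for n
  have s_ge: "\<alpha>\<^sup>2 \<le> (s n)\<^sup>2" for n using ge[of n] \<alpha> by (simp add: s_def power_mono)
  have den: "(s n)\<^sup>2 - (t n)\<^sup>2 > 0" for n using s_ge[of n] u_gt[of n] u_less[of n] by linarith
  have c01: "0 \<le> c n" "c n \<le> 1" for n
    using den[of n] s_ge[of n] u_gt[of n] u_less[of n] by (auto simp: c_def)
  have c_eq: "c n * (s n)\<^sup>2 + (1 - c n) * (t n)\<^sup>2 = u n" for n
  proof -
    have "c n * ((s n)\<^sup>2 - (t n)\<^sup>2) = u n - (t n)\<^sup>2" using den[of n] by (simp add: c_def)
    then show ?thesis by (simp add: algebra_simps)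
  qed
  define e where "e n = sqrt (c n) *\<^sub>R x n + sqrt (1 - c n) *\<^sub>R y n" for n
  have Pe: "P (e n) = (sqrt (c n) * s n) *\<^sub>R x n + (sqrt (1 - c n) * t n) *\<^sub>R y n" for n
  proof -
    note bP = selfadjoint_op_bounded[OF aP]
    have "P (e n) = sqrt (c n) *\<^sub>R P (x n) + sqrt (1 - c n) *\<^sub>R P (y n)"
      by (simp add: e_def bounded_ops_add[OF bP] bounded_ops_scaleR[OF bP])
    then show ?thesis
      using eig[of n] y(3)[of n] by (simp add: s_def t_def) (metis scaleR_scaleR)
  qed
  have comb: "(norm (a *\<^sub>R x n + b *\<^sub>R y n))\<^sup>2 = a\<^sup>2 + b\<^sup>2" for a b n
    using norm_add_square_orthogonal[of "a *\<^sub>R x n" "b *\<^sub>R y n"] nx[of n] ny[of n] xy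
    by (simp add: power_mult_distrib)
  \<comment> \<open>Vectors from different planes are orthogonal. Since each plane is
    \<open>P\<close>-invariant, this covers the \<open>e n\<close> and their images alike.\<close>
  have comb_orth: "cinner (a *\<^sub>R x i + b *\<^sub>R y i) (a' *\<^sub>R x j + b' *\<^sub>R y j) = 0" if "i \<noteq> j" for a b a' b' i j
    using that by (simp add: cinner_add_left cinner_add_right xy yx orthonormal_seqD[OF x] orthonormal_seqD[OF y(1)])
  have "orthonormal_seq e"
  proof (rule orthonormal_seqI)
    fix n
    have "(norm (e n))\<^sup>2 = 1" unfolding e_def comb using c01[of n] by simp
    then show "norm (e n) = 1" by (simp add: power2_eq_1_iff) (use norm_ge_zero[of "e n"] in linarith)
  next
    fix i j :: nat assume "j < i"
    then show "cinner (e i) (e j) = 0" unfolding e_def by (intro comb_orth) simp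
  qed
  moreover have "cinner (P (e i)) (P (e j)) = 0" if "i \<noteq> j" for i j
    unfolding Pe by (rule comb_orth[OF that])
  moreover have "strict_mono (\<lambda>n. norm (P (e n)))"
  proof (rule strict_monoI)
    fix m n :: nat assume "m < n"
    have "(norm (P (e k)))\<^sup>2 = u k" for k
      unfolding Pe comb using c01[of k] c_eq[of k] by (simp add: power_mult_distrib)
    then have "(norm (P (e m)))\<^sup>2 < (norm (P (e n)))\<^sup>2"
      using strict_monoD[OF u_mono \<open>m < n\<close>] by simp
    then show "norm (P (e m)) < norm (P (e n))" by (rule power2_less_imp_less) simp
  qed
  ultimately show False using free unfolding increasing_seq_free_def by blast
qed

text \<open>\<open>P - \<alpha>\<close> is precomposed with the projection onto \<open>G\<close> for
  \<open>K\<close> and with the complementary projection for \<open>F\<close>; self-adjointness of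
  \<open>F\<close> is read off from \<open>F = D - K\<close>.\<close>

lemma greedy_decomposition:
  assumes "abs_attaining UNIV P" "increasing_seq_free P"
  shows "\<exists>K F. positive_op UNIV K \<and> compact_op UNIV K \<and> selfadjoint_op UNIV F \<and> finite_rank_op UNIV F \<and>
    (\<forall>y. P y = \<alpha> *\<^sub>R y + K y + F y)"
proof (intro exI conjI allI)
  let ?K = "\<lambda>y. D (orth_proj G y)" and ?F = "\<lambda>y. D (y - orth_proj G y)"
  show "positive_op UNIV ?K" by (rule D_compress_positive)
  show "compact_op UNIV ?K" by (rule D_compress_compact)
  have F: "?F = (\<lambda>y. D y - ?K y)"
    by (simp add: bounded_ops_diff[OF bD complex_vector.subspace_UNIV])
  show aF: "selfadjoint_op UNIV ?F"
    unfolding F by (intro selfadjoint_op_diff aD D_compress_selfadjoint complex_vector.subspace_UNIV)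
  show "finite_rank_op UNIV ?F"
    using selfadjoint_op_bounded[OF aF] D_remainder_finite_rank[OF assms] by (simp add: finite_rank_op_def)
  show "P y = \<alpha> *\<^sub>R y + ?K y + ?F y" for y
    unfolding fun_cong[OF F] by (simp add: D_def)
qed

end

lemma decomposition_if_abs_attaining:
  assumes P: "positive_op UNIV P" and att: "abs_attaining UNIV P" and free: "increasing_seq_free P"
  shows "\<exists>(\<alpha>::real) K F. \<alpha> \<ge> 0 \<and> positive_op UNIV K \<and> compact_op UNIV K \<and>
    selfadjoint_op UNIV F \<and> finite_rank_op UNIV F \<and> (\<forall>x. P x = \<alpha> *\<^sub>R x + K x + F x)"
proof (cases "cdim (UNIV :: 'a set) = \<infinity>")
  case False
  note aP = positive_op_selfadjoint[OF P complex_vector.subspace_UNIV]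
  have "op_rank UNIV P \<noteq> \<infinity>"
  proof
    assume "op_rank UNIV P = \<infinity>"
    then show False using cdim_subset[of "range P" UNIV] False by (simp add: op_rank_def)
  qed
  then have "finite_rank_op UNIV P" using selfadjoint_op_bounded[OF aP] by (simp add: finite_rank_op_def)
  moreover have "positive_op UNIV (\<lambda>x::'a. 0::'a)"
    by (auto simp: positive_op_def bounded_ops_def intro: exI[of _ 0])
  \<comment> \<open>In finite dimension the greedy sequence does not exist, but \<open>P\<close>
    itself is the finite-rank part.\<close>
  ultimately show ?thesis
    using aP compact_op_zero by (intro exI[of _ 0] exI[of _ "\<lambda>x. 0"] exI[of _ P]) auto
next
  case True
  then obtain x where x: "orthonormal_seq x" "\<And>n. P (x n) = norm (P (x n)) *\<^sub>R x n"
    "\<And>n y. (\<And>i. i < n \<Longrightarrow> cinner y (x i) = 0) \<Longrightarrow> norm (P y) \<le> norm (P (x n)) * norm y"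
    using greedy_eigenvectors[OF P att closed_csubspace_UNIV] by auto
  have dec: "norm (P (x n)) \<le> norm (P (x m))" if "m \<le> n" for m n
    using x(3)[of m "x n"] orthonormal_seqD[OF x(1)] orthonormal_seq_norm[OF x(1)] that by auto
  obtain \<alpha> where \<alpha>: "(\<lambda>n. norm (P (x n))) \<longlonglongrightarrow> \<alpha>" "\<And>n. \<alpha> \<le> norm (P (x n))"
    using decseq_convergent[of "\<lambda>n. norm (P (x n))" 0] dec by (auto simp: decseq_def)
  have "0 \<le> \<alpha>" by (rule LIMSEQ_le_const[OF \<alpha>(1)]) auto
  with greedy_decomposition[OF P x \<alpha> this att free] show ?thesis by blast
qed

section \<open>Attainment for compact and finite-rank perturbations of a multiple of the
  identity\<close>

lemma compact_op_subseq:
  assumes K: "compact_op UNIV K" and f: "\<And>n::nat. norm (f n) \<le> 1"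
  shows "\<exists>r l. strict_mono r \<and> (\<lambda>n. K (f (r n))) \<longlonglongrightarrow> l"
proof -
  have "compact (closure (K ` (UNIV \<inter> cball 0 1)))" using K by (simp add: compact_op_def)
  moreover have "K (f n) \<in> closure (K ` (UNIV \<inter> cball 0 1))" for n
    using f closure_subset by fastforce
  ultimately show ?thesis
    unfolding compact_def by (auto simp: o_def dest!: spec[of _ "\<lambda>n. K (f n)"])
qed

lemma finite_rank_op_subseq:
  assumes F: "finite_rank_op UNIV F" and f: "\<And>n::nat. norm (f n) \<le> 1"
  shows "\<exists>r l. strict_mono r \<and> (\<lambda>n. F (f (r n))) \<longlonglongrightarrow> l"
proof -
  have bF: "F \<in> bounded_ops UNIV UNIV" and fin: "cdim (range F) \<noteq> \<infinity>"
    using F by (auto simp: finite_rank_op_def op_rank_def)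
  obtain C where C: "C > 0" "\<And>x. norm (F x) \<le> C * norm x" using bounded_ops_bound[OF bF] by auto
  have "norm (F (f n)) \<le> C" for n
    using C(2)[of "f n"] mult_left_mono[OF f[of n], of C] C(1) by linarith
  then show ?thesis
    using finite_cdim_bounded_subseq[OF csubspace_image[OF bF complex_vector.subspace_UNIV] fin, of "\<lambda>n. F (f n)" C]
    by (auto simp: o_def)
qed

text \<open>If some unit vector of \<open>N\<close> has image norm above \<alpha>, the perturbation
  criterion applies with \<open>K + F\<close>. Otherwise \<alpha> bounds \<open>P\<close> on
  \<open>N\<close> and must itself be attained: a unit vector of \<open>N\<close> in the kernel of
  \<open>F\<close> does so by positivity of \<open>K\<close>, and it exists unless \<open>N\<close>
  is finite-dimensional, where compactness suffices.\<close>

lemma abs_attaining_if_decomposition: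
  fixes P :: "'a::complex_hilbert_space \<Rightarrow> 'a"
  assumes P: "P \<in> bounded_ops UNIV UNIV" and \<alpha>: "\<alpha> \<ge> 0" and K: "positive_op UNIV K" "compact_op UNIV K"
    and F: "selfadjoint_op UNIV F" "finite_rank_op UNIV F"
    and dec: "\<And>x. P x = \<alpha> *\<^sub>R x + K x + F x"
  shows "abs_attaining UNIV P"
  unfolding abs_attaining_def
proof (intro allI impI, elim conjE)
  fix N :: "'a set" assume N: "closed_csubspace N" "N \<noteq> {0}"
  note sN = closed_csubspaceD(1)[OF N(1)]
  note bK = positive_op_bounded[OF K(1)] and bF = selfadjoint_op_bounded[OF F(1)]
  define D where "D x = K x + F x" for x
  have bD: "D \<in> bounded_ops UNIV UNIV"
    unfolding D_def by (intro bounded_ops_plus bK bF complex_vector.subspace_UNIV)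
  have D_diff: "D (x - y) = D x - D y" for x y
    by (rule bounded_ops_diff[OF bD complex_vector.subspace_UNIV]) auto
  have PD: "P x = \<alpha> *\<^sub>R x + D x" for x by (simp add: dec D_def)
  obtain c where c: "c > 0" "\<And>x. norm (D x) \<le> c * norm x" using bounded_ops_bound[OF bD] by auto
  \<comment> \<open>\<open>2 * \<alpha>\<close> comes from the cross term and \<open>c\<close> from
    estimating one factor of \<open>\<parallel>D x\<parallel>\<^sup>2\<close>.\<close>
  have le: "(norm (P x))\<^sup>2 \<le> \<alpha>\<^sup>2 * (norm x)\<^sup>2 + (2 * \<alpha> + c) * norm (D x) * norm x" for x
  proof -
    have "(norm (P x))\<^sup>2 = \<alpha>\<^sup>2 * (norm x)\<^sup>2 + 2 * \<alpha> * Re (cinner x (D x)) + (norm (D x))\<^sup>2"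
      unfolding PD by (simp add: norm_add_square power_mult_distrib)
    moreover have "Re (cinner x (D x)) \<le> norm x * norm (D x)"
      using complex_Re_le_cmod cmod_cinner_le order_trans by blast
    then have "2 * \<alpha> * Re (cinner x (D x)) \<le> 2 * \<alpha> * (norm x * norm (D x))"
      using \<alpha> by (intro mult_left_mono) auto
    moreover have "norm (D x) * norm (D x) \<le> (c * norm x) * norm (D x)"
      using c(2) by (rule mult_right_mono) simp
    ultimately show ?thesis by (simp add: power2_eq_square algebra_simps)
  qed
  show "\<exists>x\<in>N. norm x = 1 \<and> (\<forall>y\<in>N. norm (P y) \<le> norm (P x) * norm y)"
  proof (cases "\<exists>u\<in>N. norm u = 1 \<and> \<alpha>\<^sup>2 < (norm (P u))\<^sup>2")
    case True
    then obtain u where u: "u \<in> N" "norm u = 1" "\<alpha>\<^sup>2 < (norm (P u))\<^sup>2" by blast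
    have comp: "\<exists>r l. strict_mono r \<and> (\<lambda>n. D (f (r n))) \<longlonglongrightarrow> l" if f: "\<And>n::nat. norm (f n) = 1" for f
    proof -
      obtain r k where r: "strict_mono r" "(\<lambda>n. K (f (r n))) \<longlonglongrightarrow> k"
        using compact_op_subseq[OF K(2), of f] f by auto
      obtain r' l where r': "strict_mono r'" "(\<lambda>n. F (f (r (r' n)))) \<longlonglongrightarrow> l"
        using finite_rank_op_subseq[OF F(2), of "\<lambda>n. f (r n)"] f by auto
      have "(\<lambda>n. K (f (r (r' n)))) \<longlonglongrightarrow> k"
        using LIMSEQ_subseq_LIMSEQ[OF r(2) r'(1)] by (simp add: o_def)
      then have "(\<lambda>n. D (f (r (r' n)))) \<longlonglongrightarrow> k + l" unfolding D_def using r'(2) by (rule tendsto_add)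
      moreover have "strict_mono (\<lambda>n. r (r' n))" using strict_mono_o[OF r(1) r'(1)] by (simp add: o_def)
      ultimately show ?thesis by (intro exI[of _ "\<lambda>n. r (r' n)"] exI[of _ "k + l"]) simp
    qed
    show ?thesis
      using \<alpha> c(1) by (intro attains_norm_if_compact_perturbation[OF P N(1) _ le D_diff comp u]) auto
  next
    case False
    have le_\<alpha>: "norm (P y) \<le> \<alpha> * norm y" if "y \<in> N" for y
    proof (cases "y = 0")
      case True
      then show ?thesis using bounded_ops_0[OF P complex_vector.subspace_UNIV] by simp
    next
      case y: False
      define v where "v = (1 / norm y) *\<^sub>R y"
      have "v \<in> N" "norm v = 1" using y that csubspace_scaleR[OF sN] by (auto simp: v_def)
      then have "(norm (P v))\<^sup>2 \<le> \<alpha>\<^sup>2" using False by (meson not_le)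
      then have "norm (P v) \<le> \<alpha>" using \<alpha> by (rule power2_le_imp_le)
      then show ?thesis using y by (simp add: v_def bounded_ops_scaleR[OF P] field_simps)
    qed
    have sR: "csubspace (range F)" by (rule csubspace_image[OF bF complex_vector.subspace_UNIV])
    have "cdim (range F) \<noteq> \<infinity>" using F(2) by (auto simp: finite_rank_op_def op_rank_def)
    then obtain B where B: "finite B" "range F \<subseteq> cspan B" by (rule finite_basis_of_cdim)
    show ?thesis
    proof (cases "enat (card B) < cdim N")
      case True
      then obtain v where v: "v \<in> N" "norm v = 1" "\<And>b. b \<in> B \<Longrightarrow> cinner v b = 0"
        using exists_orthogonal_unit[OF B(1) sN] by blast
      \<comment> \<open>By self-adjointness this is the squared norm of \<open>F v\<close>;
        orthogonality to the range thus places \<open>v\<close> in the kernel.\<close>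
      have "cinner (F (F v)) v = 0"
      proof (rule cinner_cspan_zero)
        show "cinner b v = 0" if "b \<in> B" for b using v(3)[OF that] cinner_eq_0_commute by blast
        show "F (F v) \<in> cspan B" using B(2) by blast
      qed
      then have "F v = 0" using selfadjoint_opD[OF F(1), of "F v" v] by simp
      have "\<alpha> \<le> norm (P v)"
      proof -
        have "\<alpha> \<le> Re (cinner (P v) v)"
          using positive_op_cinner_ge_0[OF K(1), of v] v(2) \<open>F v = 0\<close>
          by (simp add: dec cinner_add_left cinner_self)
        also have "\<dots> \<le> norm (P v) * norm v"
          using complex_Re_le_cmod cmod_cinner_le order_trans by blast
        finally show ?thesis using v(2) by simp
      qed
      then have "norm (P y) \<le> norm (P v) * norm y" if "y \<in> N" for y
        using le_\<alpha>[OF that] mult_right_mono[of \<alpha> "norm (P v)" "norm y"] by simp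
      then show ?thesis using v by blast
    next
      case False
      then have fin: "cdim N \<noteq> \<infinity>" by (intro notI) simp
      obtain C where C: "C > 0" "\<And>x. norm (P x) \<le> C * norm x" using bounded_ops_bound[OF P] by auto
      obtain u where u: "u \<in> N" "norm u = 1" using N(2) csubspace_eq_0_iff[OF sN] by blast
      \<comment> \<open>The criterion with the identity as compact map. The level \<open>-1\<close>
        lies below every squared norm, so any unit vector is above it, and the summand 1 in
        \<open>C\<^sup>2 + 1\<close> makes up for it.\<close>
      show ?thesis
      proof (rule attains_norm_if_compact_perturbation[OF P N(1), of "C\<^sup>2 + 1" "-1" "\<lambda>x. x" u])
        fix x
        have "(norm (P x))\<^sup>2 \<le> (C * norm x)\<^sup>2" using C(2) by (intro power_mono) auto
        then show "(norm (P x))\<^sup>2 \<le> - 1 * (norm x)\<^sup>2 + (C\<^sup>2 + 1) * norm x * norm x"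
          by (simp add: power2_eq_square algebra_simps)
      next
        fix f :: "nat \<Rightarrow> 'a" assume "\<And>n. f n \<in> N" "\<And>n. norm (f n) = 1"
        then show "\<exists>r l. strict_mono r \<and> (\<lambda>n. f (r n)) \<longlonglongrightarrow> l"
          using finite_cdim_bounded_subseq[OF sN fin, of f 1] by (auto simp: o_def)
      qed (use u in \<open>auto intro: less_le_trans[of _ 0]\<close>)
    qed
  qed
qed

theorem theorem7p15:
  fixes P :: "'a::complex_hilbert_space \<Rightarrow> 'a"
  assumes "positive_op UNIV P"
  shows "((\<forall>\<pi>\<in>weights. \<forall>k\<ge>1. abs_norming \<pi> k P) \<longleftrightarrow>
          (\<exists>\<pi>\<in>weights. \<exists>k\<ge>1. abs_norming \<pi> k P)) \<and>
         ((\<exists>\<pi>\<in>weights. \<exists>k\<ge>1. abs_norming \<pi> k P) \<longleftrightarrow>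
          (\<exists>(\<alpha>::real) K F. \<alpha> \<ge> 0 \<and> positive_op UNIV K \<and> compact_op UNIV K \<and>
             selfadjoint_op UNIV F \<and> finite_rank_op UNIV F \<and>
             (\<forall>x. P x = \<alpha> *\<^sub>R x + K x + F x)))"
proof -
  let ?all = "\<forall>\<pi>\<in>weights. \<forall>k\<ge>1. abs_norming \<pi> k P"
  let ?some = "\<exists>\<pi>\<in>weights. \<exists>k\<ge>1. abs_norming \<pi> k P"
  let ?dec = "\<exists>(\<alpha>::real) K F. \<alpha> \<ge> 0 \<and> positive_op UNIV K \<and> compact_op UNIV K \<and>
    selfadjoint_op UNIV F \<and> finite_rank_op UNIV F \<and> (\<forall>x. P x = \<alpha> *\<^sub>R x + K x + F x)"
  note aP = positive_op_selfadjoint[OF assms complex_vector.subspace_UNIV]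
  note bP = positive_op_bounded[OF assms]
  \<comment> \<open>The passage from all pairs to some pair rests on a weight sequence existing at
    all.\<close>
  have "(\<lambda>j. 1) \<in> weights" by (simp add: weights_def)
  then have "?all \<Longrightarrow> ?some" by blast
  moreover have "?some \<Longrightarrow> ?dec"
    using increasing_seq_free_if_abs_norming[OF aP] abs_attaining_if_increasing_seq_free[OF aP]
      decomposition_if_abs_attaining[OF assms] by blast
  moreover have "?dec \<Longrightarrow> ?all"
  proof -
    assume ?dec
    then have "abs_attaining UNIV P" using abs_attaining_if_decomposition[OF bP] by blast
    then show ?all using norming_if_abs_attaining[OF aP] bP by (simp add: abs_norming_def)
  qed
  ultimately show ?thesis by blast
qed

end
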